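(* Let $k$ be a field. If $\operatorname{char}k>3$, then the minimal primes over $I_3(4,4)$ are of type $(1)$, $(2)$, $(3)$, $(3A)$, or $(2,2)$. If $\operatorname{char}k=3$, then the ideal generated by the $2\times2$ minors of the generic $4\times4$ matrix is the only other minimal prime over $I_3(4,4)$.
   Context: The permanent of a $t\times t$ matrix $(a_{i,j})$ over a commutative ring is $\sum_{\sigma\in S_t}a_{1,\sigma(1)}\cdots a_{t,\sigma(t)}$. $M=(x_{i,j})$ is the generic $4\times4$ matrix of independent indeterminates over $k$, and $I_3(4,4)\subset k[x_{i,j}]$ is the ideal generated by the permanents of all $3\times3$ submatrices of $M$. The types of primes, for $3\times3$ permanents of the $4\times4$ matrix $M$, are: Type $(1)$: the ideal generated by all the entries of some $m'\times n'$ submatrix $M'$ of $M$ with $m'+n'=6$. Type $(2)$: the ideal generated by the permanent of some $2\times2$ submatrix of $M'$ and all the entries of $M'$ outside this $2\times2$ submatrix, where $M'$ is some $m'\times n'$ submatrix of $M$ with $m'+n'=7$. Type $(3)$: the ideal generated by the permanent of some $3\times3$ submatrix of $M$ and all the entries of $M$ outside this submatrix. Type $(2,2)$: the ideal generated by the permanents of two $2\times2$ submatrices of $M$, having disjoint row sets and disjoint column sets, and all the entries of $M$ outside these two submatrices. Type $(3A)$: a prime is of type $(3A)$ if it contains the ideal $J_3$ for some $3\times4$ (resp. $4\times3$) submatrix of $M$ and all the entries of the remaining row (resp. column) of $M$. Here, for a $3\times4$ matrix $N=(y_{r,p})$ of indeterminates, $J_3$ is defined as follows (for a $4\times3$ matrix,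 use its transpose). Let $P_q$ be the permanent of the $3\times3$ matrix obtained from $N$ by omitting column $q$, and for $1\le r\le3$, $1\le p,q\le4$ let $B_{r,p,q}=\partial P_q/\partial y_{r,p}$ (so $B_{r,p,p}=0$, and for $p\neq q$ it is the $2\times2$ permanent of $N$ omitting row $r$ and columns $p,q$). For each $p\in\{1,\dots,4\}$ let $f_p$ be the determinant of the $3\times3$ matrix obtained from the $3\times4$ matrix with $(r,q)$ entry $B_{r,q,p}$ by omitting its $p$-th column (which is zero). For each $r\in\{1,2,3\}$ let $g_r$ be the determinant of the symmetric $4\times4$ matrix with $(p,q)$ entry $B_{r,p,q}$. Then $J_3=\langle P_1,\dots,P_4,f_1,\dots,f_4,g_1,g_2,g_3\rangle$. *)

theory Defs
  imports
    "HOL-Library.Poly_Mapping"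
    "HOL-Library.Numeral_Type"
    "HOL-Algebra.Ideal"
    "HOL-Algebra.Algebraic_Closure_Type"
    "Jordan_Normal_Form.Determinant"
    "Jordan_Normal_Form.DL_Submatrix"
begin

text \<open>
  Multivariate polynomials with indeterminates indexed by \<open>'v\<close> are finitely supported maps from
  monomials \<open>'v \<Rightarrow>\<^sub>0 nat\<close> to coefficients, with the convolution product of
  \<^theory>\<open>HOL-Library.Poly_Mapping\<close>. All row and column indices start at 0.
\<close>

type_synonym ('v, 'k) mpoly = "('v \<Rightarrow>\<^sub>0 nat) \<Rightarrow>\<^sub>0 'k"

definition Var :: "'v \<Rightarrow> ('v, 'k::comm_ring_1) mpoly" where
  "Var v = Poly_Mapping.single (Poly_Mapping.single v 1) 1"

definition partial :: "'v \<Rightarrow> ('v, 'k::comm_ring_1) mpoly \<Rightarrow> ('v, 'k) mpoly" where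
  "partial v f =
     (\<Sum>m\<in>Poly_Mapping.keys f.
        Poly_Mapping.single (m - Poly_Mapping.single v 1)
          (of_nat (Poly_Mapping.lookup m v) * Poly_Mapping.lookup f m))"

text \<open>Ideals are taken in the library sense, in the ring carried by the whole type.\<close>

definition ideal_gen :: "'a::comm_ring_1 set \<Rightarrow> 'a set" where
  "ideal_gen S = genideal ring_of_type_algebra S"

definition prime_ideal :: "'a::comm_ring_1 set \<Rightarrow> bool" where
  "prime_ideal P \<longleftrightarrow> primeideal P ring_of_type_algebra"

definition minimal_primes :: "'a::comm_ring_1 set \<Rightarrow> 'a set set" where
  "minimal_primes I =
     {P. prime_ideal P \<and> I \<subseteq> P \<and> (\<forall>Q. prime_ideal Q \<and> I \<subseteq> Q \<and> Q \<subseteq> P \<longrightarrow> Q = P)}"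

text \<open>As for \<^const>\<open>det\<close>, the value is 0 by convention when the matrix is not square.\<close>

definition permanent :: "'a::comm_ring_1 mat \<Rightarrow> 'a" where
  "permanent A =
     (if dim_row A = dim_col A
      then \<Sum>\<sigma> | \<sigma> permutes {0..<dim_row A}. \<Prod>i = 0..<dim_row A. A $$ (i, \<sigma> i)
      else 0)"

text \<open>
  A matrix of distinct indeterminates is given by the matrix of their names. The indeterminates
  of the generic matrix are named by the 16-element type \<open>4 \<times> 4\<close>; \<open>of_nat\<close> is a bijection from
  \<open>{..<4}\<close> onto the type \<open>4\<close>.
\<close>

definition generic_names :: "(4 \<times> 4) mat" where
  "generic_names = mat 4 4 (\<lambda>(i, j). (of_nat i, of_nat j))"

definition generic_mat :: "(4 \<times> 4, 'k::comm_ring_1) mpoly mat" where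
  "generic_mat = map_mat Var generic_names"

definition permanental_ideal :: "nat \<Rightarrow> (4 \<times> 4, 'k::comm_ring_1) mpoly set" where
  "permanental_ideal t =
     ideal_gen {permanent (submatrix generic_mat I J) | I J.
       I \<subseteq> {..<4} \<and> J \<subseteq> {..<4} \<and> card I = t \<and> card J = t}"

definition determinantal_ideal :: "nat \<Rightarrow> (4 \<times> 4, 'k::comm_ring_1) mpoly set" where
  "determinantal_ideal t =
     ideal_gen {det (submatrix generic_mat I J) | I J.
       I \<subseteq> {..<4} \<and> J \<subseteq> {..<4} \<and> card I = t \<and> card J = t}"

text \<open>
  In the following definitions \<open>V\<close> is the \<open>3 \<times> 4\<close> matrix of names of the entries
  \<open>y\<^sub>r\<^sub>,\<^sub>p\<close> of \<open>N\<close>.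
\<close>

definition J3_P :: "'v mat \<Rightarrow> nat \<Rightarrow> ('v, 'k::comm_ring_1) mpoly" where
  "J3_P V q = permanent (submatrix (map_mat Var V) {..<3} ({..<4} - {q}))"

definition J3_B :: "'v mat \<Rightarrow> nat \<Rightarrow> nat \<Rightarrow> nat \<Rightarrow> ('v, 'k::comm_ring_1) mpoly" where
  "J3_B V r p q = partial (V $$ (r, p)) (J3_P V q)"

definition J3_f :: "'v mat \<Rightarrow> nat \<Rightarrow> ('v, 'k::comm_ring_1) mpoly" where
  "J3_f V p = det (submatrix (mat 3 4 (\<lambda>(r, q). J3_B V r q p)) {..<3} ({..<4} - {p}))"

definition J3_g :: "'v mat \<Rightarrow> nat \<Rightarrow> ('v, 'k::comm_ring_1) mpoly" where
  "J3_g V r = det (mat 4 4 (\<lambda>(p, q). J3_B V r p q))"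

definition J3 :: "'v mat \<Rightarrow> ('v, 'k::comm_ring_1) mpoly set" where
  "J3 V = ideal_gen (J3_P V ` {..<4} \<union> J3_f V ` {..<4} \<union> J3_g V ` {..<3})"

definition is_type_1 :: "(4 \<times> 4, 'k::comm_ring_1) mpoly set \<Rightarrow> bool" where
  "is_type_1 P \<longleftrightarrow>
     (\<exists>I J. I \<subseteq> {..<4} \<and> J \<subseteq> {..<4} \<and> card I + card J = 6 \<and>
        P = ideal_gen (($$) generic_mat ` (I \<times> J)))"

definition is_type_2 :: "(4 \<times> 4, 'k::comm_ring_1) mpoly set \<Rightarrow> bool" where
  "is_type_2 P \<longleftrightarrow>
     (\<exists>I J I' J'. I \<subseteq> {..<4} \<and> J \<subseteq> {..<4} \<and> card I + card J = 7 \<and>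
        I' \<subseteq> I \<and> J' \<subseteq> J \<and> card I' = 2 \<and> card J' = 2 \<and>
        P = ideal_gen
              ({permanent (submatrix generic_mat I' J')} \<union>
               ($$) generic_mat ` (I \<times> J - I' \<times> J')))"

definition is_type_3 :: "(4 \<times> 4, 'k::comm_ring_1) mpoly set \<Rightarrow> bool" where
  "is_type_3 P \<longleftrightarrow>
     (\<exists>I J. I \<subseteq> {..<4} \<and> J \<subseteq> {..<4} \<and> card I = 3 \<and> card J = 3 \<and>
        P = ideal_gen
              ({permanent (submatrix generic_mat I J)} \<union>
               ($$) generic_mat ` ({..<4} \<times> {..<4} - I \<times> J)))"

definition is_type_22 :: "(4 \<times> 4, 'k::comm_ring_1) mpoly set \<Rightarrow> bool" where
  "is_type_22 P \<longleftrightarrow>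
     (\<exists>I J I' J'. I \<subseteq> {..<4} \<and> J \<subseteq> {..<4} \<and> I' \<subseteq> {..<4} \<and> J' \<subseteq> {..<4} \<and>
        card I = 2 \<and> card J = 2 \<and> card I' = 2 \<and> card J' = 2 \<and>
        I \<inter> I' = {} \<and> J \<inter> J' = {} \<and>
        P = ideal_gen
              ({permanent (submatrix generic_mat I J), permanent (submatrix generic_mat I' J')} \<union>
               ($$) generic_mat ` ({..<4} \<times> {..<4} - (I \<times> J \<union> I' \<times> J'))))"

definition is_type_3A :: "(4 \<times> 4, 'k::comm_ring_1) mpoly set \<Rightarrow> bool" where
  "is_type_3A P \<longleftrightarrow> prime_ideal P \<and>
     ((\<exists>I. I \<subseteq> {..<4} \<and> card I = 3 \<and>
         J3 (submatrix generic_names I {..<4}) \<union>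
           ($$) generic_mat ` (({..<4} - I) \<times> {..<4}) \<subseteq> P) \<or>
      (\<exists>J. J \<subseteq> {..<4} \<and> card J = 3 \<and>
         J3 (transpose_mat (submatrix generic_names {..<4} J)) \<union>
           ($$) generic_mat ` ({..<4} \<times> ({..<4} - J)) \<subseteq> P))"

definition has_listed_type :: "(4 \<times> 4, 'k::comm_ring_1) mpoly set \<Rightarrow> bool" where
  "has_listed_type P \<longleftrightarrow>
     is_type_1 P \<or> is_type_2 P \<or> is_type_3 P \<or> is_type_3A P \<or> is_type_22 P"

end

theory Submission
  imports Defs "HOL-Library.Product_Lexorder"
begin

text \<open>
  Modulo a prime \<open>P\<close> containing \<open>I\<^sub>3(4,4)\<close>, the generic matrix becomes a \<open>4 \<times> 4\<close> matrix over a domain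
  all of whose \<open>3 \<times> 3\<close> permanents vanish. If it has no zero row or column and two independent
  rows, then for the other two rows and each column \<open>s\<close> some \<open>2 \<times> 2\<close> permanent involving \<open>s\<close>
  vanishes. So the vanishing \<open>2 \<times> 2\<close> permanents contain a star or a perfect matching on the columns, and
  both cases lead to a \<open>3 \<times> 3\<close> block of zeros (type 1) or to two diagonal blocks (type (2,2)).
  If the rank is 1, no entry vanishes, so \<open>6 = 0\<close> and the characteristic is 3. If a row (or a column) vanishes,
  expanding the permanents \<open>P\<^sub>q\<close> of the other three rows along a row or a column \<open>v\<close> exhibits \<open>v\<close> as
  a kernel vector of the matrices with determinants \<open>g\<^sub>r\<close>, \<open>f\<^sub>p\<close>; hence \<open>P\<close> is of type (3A), unless
  another row or a column vanishes, which gives types 1 and 3. Type 2 is subsumed by type (3A).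
\<close>

section \<open>Vanishing permanents over a domain\<close>

text \<open>The hypothesis that 2 is nonzero enters through one sign argument: if the 2 x 2
  permanents of two rows vanish, the ratio of the rows changes sign between any two columns of their
  common support, which is impossible for three columns. The same holds for three rows on two
  columns.

  The case analysis only shows that a minimal prime contains the generators of some listed ideal.
  Equality requires that ideal to be prime, hence a primality criterion that adjoins one generator
  at a time, each linear in an indeterminate absent from the others. The ideal of the 2 x 2 minors
  does not yield to this; it is identified with the kernel of the Segre map. Type (3A) asks only for
  containment, so \<open>J3\<close> never has to be decomposed.

  A prime of type (2) contains a full row or column, namely the line of \<open>M'\<close> that
  misses the 2 x 2 block, and so falls under the zero row or zero column case. In characteristic 3
  the determinantal prime is told apart from all listed ones by containing no indeterminate.\<close>

definition perm2 :: "('r \<Rightarrow> 'c \<Rightarrow> 'a::comm_ring_1) \<Rightarrow> 'r \<Rightarrow> 'r \<Rightarrow> 'c \<Rightarrow> 'c \<Rightarrow> 'a" where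
  "perm2 m i j a b = m i a * m j b + m i b * m j a"

definition perm3 ::
  "('r \<Rightarrow> 'c \<Rightarrow> 'a::comm_ring_1) \<Rightarrow> 'r \<Rightarrow> 'r \<Rightarrow> 'r \<Rightarrow> 'c \<Rightarrow> 'c \<Rightarrow> 'c \<Rightarrow> 'a" where
  "perm3 m i j k a b c =
     m i a * perm2 m j k b c + m i b * perm2 m j k a c + m i c * perm2 m j k a b"

lemma perm2_swap_rows: "perm2 m j i a b = perm2 m i j a b"
  and perm2_swap_cols: "perm2 m i j b a = perm2 m i j a b"
  by (simp_all add: perm2_def algebra_simps)

lemma perm3_transpose: "perm3 (\<lambda>a i. m i a) a b c i j k = perm3 m i j k a b c"
  by (simp add: perm3_def perm2_def algebra_simps)

text \<open>The set \<open>P\<close> is a parameter so that the same predicate can be used with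
  \<open>{0}\<close> in a domain, where the case analysis takes place, and with a prime of the
  polynomial ring. Such a block gives type (1) because 3 + 3 = 6.\<close>

definition block3_in :: "'a set \<Rightarrow> (4 \<Rightarrow> 4 \<Rightarrow> 'a) \<Rightarrow> bool" where
  "block3_in P m \<longleftrightarrow> (\<exists>i j k a b c. distinct [i, j, k] \<and> distinct [a, b, c] \<and>
     (\<forall>x\<in>{i, j, k}. \<forall>y\<in>{a, b, c}. m x y \<in> P))"

definition blocks22_in :: "'a::comm_ring_1 set \<Rightarrow> (4 \<Rightarrow> 4 \<Rightarrow> 'a) \<Rightarrow> bool" where
  "blocks22_in P m \<longleftrightarrow> (\<exists>i j k l a b c d. distinct [i, j, k, l] \<and> distinct [a, b, c, d] \<and>
     perm2 m i j a b \<in> P \<and> perm2 m k l c d \<in> P \<and>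
     (\<forall>x\<in>{i, j}. \<forall>y\<in>{c, d}. m x y \<in> P) \<and> (\<forall>x\<in>{k, l}. \<forall>y\<in>{a, b}. m x y \<in> P))"

lemma block3_inI:
  assumes "distinct [i, j, k]" "distinct [a, b, c]"
    and "\<And>x y. x \<in> {i, j, k} \<Longrightarrow> y \<in> {a, b, c} \<Longrightarrow> m x y \<in> P"
  shows "block3_in P m"
  unfolding block3_in_def
  by (rule exI[of _ i], rule exI[of _ j], rule exI[of _ k], rule exI[of _ a], rule exI[of _ b],
      rule exI[of _ c], intro conjI ballI assms)

lemma blocks22_inI:
  assumes "distinct [i, j, k, l]" "distinct [a, b, c, d]"
    and "perm2 m i j a b \<in> P" "perm2 m k l c d \<in> P"
    and "\<And>x y. x \<in> {i, j} \<Longrightarrow> y \<in> {c, d} \<Longrightarrow> m x y \<in> P"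
    and "\<And>x y. x \<in> {k, l} \<Longrightarrow> y \<in> {a, b} \<Longrightarrow> m x y \<in> P"
  shows "blocks22_in P m"
  unfolding blocks22_in_def
  by (rule exI[of _ i], rule exI[of _ j], rule exI[of _ k], rule exI[of _ l], rule exI[of _ a],
      rule exI[of _ b], rule exI[of _ c], rule exI[of _ d], intro conjI ballI assms)

section \<open>Distinct indices in a four-element type\<close>

lemma four_cases:
  assumes "distinct [i, j, k, l :: 4]"
  shows "x = i \<or> x = j \<or> x = k \<or> x = l"
proof -
  have "card {i, j, k, l} = CARD(4)" using assms by simp
  then have "{i, j, k, l} = UNIV" by (metis card_eq_UNIV_imp_eq_UNIV finite finite_code)
  then show ?thesis by blast
qed

lemma distinct_extend1:
  fixes i j k :: 4
  assumes "distinct [i, j, k]"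
  obtains l where "distinct [i, j, k, l]"
proof -
  have "card {i, j, k} < CARD(4)" using assms by simp
  then have "{i, j, k} \<noteq> UNIV" by auto
  then show ?thesis using assms that by fastforce
qed

lemma distinct_extend2:
  fixes i j :: 4
  assumes "i \<noteq> j"
  obtains k l where "distinct [i, j, k, l]"
proof -
  have "card {i, j} < CARD(4)" using assms by simp
  then have "{i, j} \<noteq> UNIV" by auto
  then obtain k where "distinct [i, j, k]" using assms by fastforce
  then show ?thesis using distinct_extend1 that by metis
qed

lemma distinct_extend3:
  fixes i :: 4
  obtains j k l where "distinct [i, j, k, l]"
proof -
  have "i \<noteq> i + 1" by simp
  then show ?thesis using distinct_extend2 that by metis
qed

text \<open>A column where \<open>x\<close> is nonzero forces \<open>y\<close> to be nonzero there,
  and then the two supports agree. On the common support the ratio of \<open>x\<close> and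
  \<open>y\<close> changes sign between any two columns; going round three columns would make it its
  own negative. The case \<open>a = b\<close> covers a support of one column.\<close>

lemma two_rows_support:
  fixes x y :: "'c \<Rightarrow> 'a::idom"
  assumes two: "(2::'a) \<noteq> 0"
    and perms: "\<And>a b. a \<in> S \<Longrightarrow> b \<in> S \<Longrightarrow> a \<noteq> b \<Longrightarrow> x a * y b + x b * y a = 0"
    and "\<exists>a\<in>S. x a \<noteq> 0" "\<exists>a\<in>S. y a \<noteq> 0"
  obtains a b where "a \<in> S" "b \<in> S" "x a \<noteq> 0" "y a \<noteq> 0" "x b \<noteq> 0" "y b \<noteq> 0"
    "\<And>c. c \<in> S \<Longrightarrow> c \<noteq> a \<Longrightarrow> c \<noteq> b \<Longrightarrow> x c = 0 \<and> y c = 0"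
proof -
  obtain a where a: "a \<in> S" "x a \<noteq> 0" using assms(3) by blast
  have ya: "y a \<noteq> 0"
  proof
    assume "y a = 0"
    then have "y b = 0" if "b \<in> S" for b using perms[OF a(1) that] a(2) by (cases "a = b") auto
    then show False using assms(4) by blast
  qed
  have both: "x b = 0 \<longleftrightarrow> y b = 0" if "b \<in> S" for b
    using perms[OF a(1) that] a(2) ya by (cases "a = b") auto
  show ?thesis
  proof (cases "\<exists>b\<in>S. b \<noteq> a \<and> x b \<noteq> 0")
    case True
    then obtain b where b: "b \<in> S" "b \<noteq> a" "x b \<noteq> 0" by blast
    have "x c = 0 \<and> y c = 0" if c: "c \<in> S" "c \<noteq> a" "c \<noteq> b" for c
    proof -
      have "x a * y b + x b * y a = 0" "x a * y c + x c * y a = 0" "x b * y c + x c * y b = 0"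
        using perms a(1) b(1,2) c by simp_all
      then have "2 * (x a * y b * y c) = 0" by Groebner_Basis.algebra
      then show ?thesis using two a(2) b(3) both[OF b(1)] both[OF c(1)] by auto
    qed
    then show ?thesis using that a ya b both by metis
  next
    case False
    then show ?thesis using that[of a a] a ya both by blast
  qed
qed

text \<open>Zero rows and columns are excluded here because they lead to types (1), (3) and (3A),
  which are recognised later in the polynomial ring itself.\<close>

locale permanental =
  fixes m :: "4 \<Rightarrow> 4 \<Rightarrow> 'a::idom"
  assumes two: "(2::'a) \<noteq> 0"
    and perms: "\<And>i j k a b c. distinct [i, j, k] \<Longrightarrow> distinct [a, b, c] \<Longrightarrow> perm3 m i j k a b c = 0"
    and rows: "\<And>i. \<exists>a. m i a \<noteq> 0"
    and cols: "\<And>a. \<exists>i. m i a \<noteq> 0"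
begin

text \<open>The common support of rows \<open>i\<close> and \<open>j\<close> has one or two columns.
  Expanding 3 x 3 permanents along one of these rows then transfers vanishing to the 2 x 2
  permanents of the other two rows. One column leads to a zero block, two columns to a pair of
  diagonal blocks.\<close>

lemma perms_zero_of_two_rows:
  assumes ij: "i \<noteq> j" and pm: "\<And>a b. a \<noteq> b \<Longrightarrow> perm2 m i j a b = 0"
  shows "block3_in {0} m \<or> blocks22_in {0} m"
proof -
  obtain k l where r: "distinct [i, j, k, l]" using distinct_extend2[OF ij] .
  obtain a b where ab: "m i a \<noteq> 0" "m j a \<noteq> 0" "m i b \<noteq> 0" "m j b \<noteq> 0"
    and z: "\<And>c. c \<noteq> a \<Longrightarrow> c \<noteq> b \<Longrightarrow> m i c = 0 \<and> m j c = 0"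
  proof (rule two_rows_support[OF two, of UNIV "m i" "m j"])
    show "m i y * m j y' + m i y' * m j y = 0" if "y \<noteq> y'" for y y'
      using pm[OF that] by (simp only: perm2_def)
  qed (use rows in blast)+
  show ?thesis
  proof (cases "a = b")
    case True
    obtain b c d where s: "distinct [a, b, c, d]" using distinct_extend3 .
    have z': "m i y = 0" "m j y = 0" if "y \<in> {b, c, d}" for y using z[of y] True s that by auto
    have p: "perm2 m k l y y' = 0" if "y \<in> {b, c, d}" "y' \<in> {b, c, d}" "y \<noteq> y'" for y y'
    proof -
      have "distinct [i, k, l]" "distinct [a, y, y']" using r s that by auto
      then have "perm3 m i k l a y y' = 0" by (rule perms)
      moreover have "m i y = 0" "m i y' = 0" using z' that by blast+
      ultimately show ?thesis using ab by (simp add: perm3_def)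
    qed
    have col: "m k y \<noteq> 0 \<or> m l y \<noteq> 0" if "y \<in> {b, c, d}" for y
    proof -
      obtain x where "m x y \<noteq> 0" using cols by blast
      then show ?thesis using four_cases[OF r, of x] z'[OF that] by auto
    qed
    \<comment> \<open>Otherwise the two rows would have a common support of at most two of these
      three columns, and the remaining column of \<open>m\<close> would vanish.\<close>
    have "(\<forall>y\<in>{b, c, d}. m k y = 0) \<or> (\<forall>y\<in>{b, c, d}. m l y = 0)"
    proof (rule ccontr)
      assume *: "\<not> ?thesis"
      obtain u v where uv: "u \<in> {b, c, d}" "v \<in> {b, c, d}"
        "\<And>y. y \<in> {b, c, d} \<Longrightarrow> y \<noteq> u \<Longrightarrow> y \<noteq> v \<Longrightarrow> m k y = 0 \<and> m l y = 0"
      proof (rule two_rows_support[OF two, of "{b, c, d}" "m k" "m l"])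
        show "m k y * m l y' + m k y' * m l y = 0"
          if "y \<in> {b, c, d}" "y' \<in> {b, c, d}" "y \<noteq> y'" for y y'
          using p[OF that] by (simp only: perm2_def)
      qed (use * in blast)+
      obtain y where "y \<in> {b, c, d}" "y \<noteq> u" "y \<noteq> v" using uv(1,2) s by auto
      then show False using uv(3) col by blast
    qed
    moreover have "block3_in {0} m" if x: "x \<in> {k, l}" "\<forall>y\<in>{b, c, d}. m x y = 0" for x
    proof (rule block3_inI)
      show "distinct [i, j, x]" "distinct [b, c, d]" using r s x(1) by auto
      show "m u y \<in> {0}" if "u \<in> {i, j, x}" "y \<in> {b, c, d}" for u y
        using that(1) z'[OF that(2)] x(2)[rule_format, OF that(2)] by blast
    qed
    ultimately have "block3_in {0} m" by blast
    then show ?thesis ..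
  next
    case False
    obtain c d where s: "distinct [a, b, c, d]" using distinct_extend2[OF False] .
    have z': "m i y = 0" "m j y = 0" if "y \<in> {c, d}" for y using z[of y] s that by auto
    have pab: "m i a * m j b + m i b * m j a = 0" using pm[OF False] by (simp add: perm2_def)
    have pcd: "perm2 m k l c d = 0"
      using perms[of i k l a c d] r s ab z' by (simp add: perm3_def)
    \<comment> \<open>A homogeneous linear system for the two permanents. Its determinant is twice a
      nonzero product, because the permanent of its coefficients vanishes.\<close>
    have p: "perm2 m k l a y = 0" "perm2 m k l b y = 0" if y: "y \<in> {c, d}" for y
    proof -
      have "perm3 m i k l a b y = 0" "perm3 m j k l a b y = 0" using perms r s y by auto
      then have e: "m i a * perm2 m k l b y + m i b * perm2 m k l a y = 0"
        "m j a * perm2 m k l b y + m j b * perm2 m k l a y = 0"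
        using z'[OF y] by (simp_all add: perm3_def)
      have "2 * (m i b * m j a * perm2 m k l a y) = 0" using e pab by Groebner_Basis.algebra
      then show "perm2 m k l a y = 0" using ab two by simp
      then show "perm2 m k l b y = 0" using e ab by simp
    qed
    have col: "m k y \<noteq> 0 \<or> m l y \<noteq> 0" if "y \<in> {c, d}" for y
    proof -
      obtain x where "m x y \<noteq> 0" using cols by blast
      then show ?thesis using four_cases[OF r, of x] z'[OF that] by auto
    qed
    \<comment> \<open>The other row is nonzero at \<open>c\<close>, so the vanishing permanents
      extend the zeros of row \<open>x\<close> to the columns \<open>a\<close> and
      \<open>b\<close>.\<close>
    have key: False if "x \<in> {k, l}" "\<forall>y\<in>{c, d}. m x y = 0" for x
    proof -
      have "m x a = 0" "m x b = 0"
        using p[of c] col[of c] that by (auto simp: perm2_def)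
      then have "m x y = 0" for y using that(2) four_cases[OF s, of y] by auto
      then show False using rows[of x] by blast
    qed
    obtain u v where uv: "u \<in> {c, d}" "v \<in> {c, d}" "m k u \<noteq> 0" "m l u \<noteq> 0" "m k v \<noteq> 0" "m l v \<noteq> 0"
      "\<And>y. y \<in> {c, d} \<Longrightarrow> y \<noteq> u \<Longrightarrow> y \<noteq> v \<Longrightarrow> m k y = 0 \<and> m l y = 0"
    proof (rule two_rows_support[OF two, of "{c, d}" "m k" "m l"])
      show "m k y * m l y' + m k y' * m l y = 0" if "y \<in> {c, d}" "y' \<in> {c, d}" "y \<noteq> y'" for y y'
        using that pcd perm2_swap_cols[of m k l c d] unfolding perm2_def by auto
    qed (use key in blast)+
    have nz: "m k y \<noteq> 0 \<and> m l y \<noteq> 0" if "y \<in> {c, d}" for y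
      using uv(3-7) col[OF that] that by blast
    \<comment> \<open>The sign argument on the columns \<open>y\<close>, \<open>c\<close>,
      \<open>d\<close>, the last two being in the support.\<close>
    have zero: "m k y = 0 \<and> m l y = 0" if y: "y \<in> {a, b}" for y
    proof -
      have e: "m k y * m l c + m k c * m l y = 0" "m k y * m l d + m k d * m l y = 0"
        "m k c * m l d + m k d * m l c = 0"
        using p[of c] p[of d] pcd y unfolding perm2_def by auto
      then have "2 * (m k y * m l c * m l d) = 0" by Groebner_Basis.algebra
      then show ?thesis using e(1) nz two by auto
    qed
    have "blocks22_in {0} m"
      using blocks22_inI[OF r s, of m "{0}"] z' zero pcd pm[OF False] by blast
    then show ?thesis ..
  qed
qed

text \<open>Rows \<open>i\<close> and \<open>k\<close> already live on the columns \<open>c\<close>,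
  \<open>d\<close>; it remains to confine rows \<open>j\<close> and \<open>l\<close> to
  \<open>a\<close>, \<open>b\<close>. On \<open>c\<close>, \<open>d\<close> the rows
  \<open>j\<close> and \<open>k\<close> both have vanishing permanent with row \<open>i\<close>,
  hence are proportional to each other, so two terms in the permanents of rows \<open>j\<close>,
  \<open>k\<close>, \<open>l\<close> coincide. This produces the factor 2 in \<open>ea\<close> and
  \<open>eb\<close>.\<close>

lemma matching_zero_corner_row:
  assumes r: "distinct [i, j, k, l]" and s: "distinct [a, b, c, d]"
    and cd: "perm2 m i j c d = 0"
    and z: "m i a = 0" "m i b = 0" and nz: "m j a \<noteq> 0" "m j b \<noteq> 0" "m i c \<noteq> 0" "m i d \<noteq> 0"
    and kz: "m k a = 0" "m k b = 0"
  shows "blocks22_in {0} m"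
proof -
  have E: "m y a * m j b + m y b * m j a = 0" "m y c * m i d + m y d * m i c = 0" if "y \<in> {k, l}" for y
  proof -
    have "perm3 m i j y a b c = 0" "perm3 m i j y a c d = 0" using perms r s that by auto
    then show "m y a * m j b + m y b * m j a = 0" "m y c * m i d + m y d * m i c = 0"
      using z nz cd unfolding perm3_def perm2_def by simp_all Groebner_Basis.algebra+
  qed
  have kc: "m k c \<noteq> 0"
  proof
    assume "m k c = 0"
    then have "m k y = 0" for y using E(2)[of k] nz kz four_cases[OF s, of y] by auto
    then show False using rows[of k] by blast
  qed
  have c': "m i c * m j d + m i d * m j c = 0" using cd by (simp add: perm2_def)
  have pa: "perm3 m j k l a c d = 0" and pb: "perm3 m j k l b c d = 0" using perms r s by auto
  let ?q = "m k c * m l d + m k d * m l c"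
  have "m i c * (m j a * ?q + 2 * m k c * m j d * m l a) = 0"
    using pa kz E(2)[of k] c' unfolding perm3_def perm2_def by simp Groebner_Basis.algebra
  then have ea: "m j a * ?q + 2 * m k c * m j d * m l a = 0" using nz by simp
  have "m i c * (m j b * ?q + 2 * m k c * m j d * m l b) = 0"
    using pb kz E(2)[of k] c' unfolding perm3_def perm2_def by simp Groebner_Basis.algebra
  then have eb: "m j b * ?q + 2 * m k c * m j d * m l b = 0" using nz by simp
  \<comment> \<open>Eliminates \<open>?q\<close> between \<open>ea\<close> and \<open>eb\<close>. In
    the remaining difference the relation \<open>E\<close> for row \<open>l\<close> makes the two
    terms equal, which accounts for the second factor 2.\<close>
  have "2 * (2 * (m k c * m j d * m l a * m j b)) = 0" using ea eb E(1)[of l] by simp Groebner_Basis.algebra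
  then have jl: "m j d * m l a = 0" using two nz kc by (metis mult_eq_0_iff)
  have "m j a * ?q = 0" using ea jl by Groebner_Basis.algebra
  then have q: "?q = 0" using nz by simp
  \<comment> \<open>The sign argument transposed: the three rows \<open>i\<close>, \<open>k\<close>,
    \<open>l\<close> have pairwise vanishing permanents on the two columns \<open>c\<close>,
    \<open>d\<close>.\<close>
  have "2 * (m k c * m l c * m i d) = 0" using q E(2)[of k] E(2)[of l] nz
    by simp Groebner_Basis.algebra
  then have lc: "m l c = 0" using two nz kc by simp
  then have ld: "m l d = 0" using E(2)[of l] nz by simp
  have "m l a \<noteq> 0"
  proof
    assume "m l a = 0"
    then have "m l y = 0" for y using E(1)[of l] nz lc ld four_cases[OF s, of y] by auto
    then show False using rows[of l] by blast
  qed
  then have jd: "m j d = 0" using jl by simp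
  then have jc: "m j c = 0" using c' nz by simp
  have "perm2 m i k c d = 0" "perm2 m j l a b = 0"
    using E(2)[of k] E(1)[of l] by (simp_all add: perm2_def algebra_simps)
  moreover have "distinct [i, k, j, l]" "distinct [c, d, a, b]" using r s by auto
  ultimately show ?thesis using blocks22_inI[of i k j l c d a b m "{0}"] z kz lc ld jc jd by blast
qed

text \<open>On the columns \<open>a\<close>, \<open>b\<close> the rows \<open>j\<close>,
  \<open>k\<close>, \<open>l\<close> have pairwise vanishing permanents, so by the sign argument one
  of them has a zero there. It is not row \<open>j\<close>, and for row \<open>k\<close> or
  \<open>l\<close> a zero in one of the two columns forces a zero in the other.\<close>

lemma matching_zero_row:
  assumes r: "distinct [i, j, k, l]" and s: "distinct [a, b, c, d]"
    and cd: "perm2 m i j c d = 0"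
    and z: "m i a = 0" "m i b = 0" and nz: "m j a \<noteq> 0" "m j b \<noteq> 0" "m i c \<noteq> 0" "m i d \<noteq> 0"
  shows "blocks22_in {0} m"
proof -
  have E: "m y a * m j b + m y b * m j a = 0" if "y \<in> {k, l}" for y
  proof -
    have "perm3 m i j y a b c = 0" using perms r s that by auto
    then show "m y a * m j b + m y b * m j a = 0"
      using z nz cd unfolding perm3_def perm2_def by simp Groebner_Basis.algebra
  qed
  have "perm3 m i k l a b c = 0" using perms r s by auto
  then have "m k a * m l b + m k b * m l a = 0" using z nz by (simp add: perm3_def perm2_def)
  then have "2 * (m k b * m l b * m j a) = 0" using E[of k] E[of l] by simp Groebner_Basis.algebra
  then consider "m k b = 0" | "m l b = 0" using two nz by auto
  then show ?thesis
  proof cases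
    case 1
    then show ?thesis using matching_zero_corner_row[OF r s cd z nz] E[of k] nz by simp
  next
    case 2
    have "distinct [i, j, l, k]" using r by auto
    then show ?thesis using matching_zero_corner_row[of i j l k, OF _ s cd z nz] 2 E[of l] nz by simp
  qed
qed

text \<open>By \<open>nz\<close> neither column \<open>a\<close> nor column \<open>b\<close>
  vanishes on both rows, so the zero factors of the two products must lie in the same row.\<close>

lemma matching_zero_pair:
  assumes r: "distinct [i, j, k, l]" and s: "distinct [a, b, c, d]"
    and cd: "perm2 m i j c d = 0"
    and z: "m i b * m j a = 0" "m i a * m j b = 0"
    and nz: "perm2 m i j a c \<noteq> 0" "perm2 m i j a d \<noteq> 0" "perm2 m i j b c \<noteq> 0" "perm2 m i j b d \<noteq> 0"
  shows "blocks22_in {0} m"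
proof -
  consider "m i a = 0" "m i b = 0" | "m j a = 0" "m j b = 0"
    using z nz unfolding perm2_def by auto
  then show ?thesis
  proof cases
    case 1
    then have "m j a \<noteq> 0" "m j b \<noteq> 0" "m i c \<noteq> 0" "m i d \<noteq> 0" using nz by (auto simp: perm2_def)
    then show ?thesis using matching_zero_row[OF r s cd] 1 by blast
  next
    case 2
    then have "m i a \<noteq> 0" "m i b \<noteq> 0" "m j c \<noteq> 0" "m j d \<noteq> 0" using nz by (auto simp: perm2_def)
    have "distinct [j, i, k, l]" using r by auto
    then show ?thesis using matching_zero_row[OF _ s] \<open>m i a \<noteq> 0\<close> \<open>m i b \<noteq> 0\<close> \<open>m j c \<noteq> 0\<close> \<open>m j d \<noteq> 0\<close> cd 2
      by (simp add: perm2_swap_rows)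
  qed
qed

text \<open>
  With \<open>p\<close> for the permanents of rows \<open>i\<close>, \<open>j\<close>, row \<open>k\<close> being nonzero gives
  \<open>p b c * p a d = p a c * p b d\<close>, whose two sides differ by the product of two determinants.
\<close>

lemma matching:
  assumes r: "distinct [i, j, k, l]" and s: "distinct [a, b, c, d]"
    and ab: "perm2 m i j a b = 0" and cd: "perm2 m i j c d = 0"
    and nz: "perm2 m i j a c \<noteq> 0" "perm2 m i j a d \<noteq> 0" "perm2 m i j b c \<noteq> 0" "perm2 m i j b d \<noteq> 0"
  shows "blocks22_in {0} m"
proof -
  let ?p = "perm2 m i j"
  have P: "perm3 m k i j x y z = 0" if "distinct [x, y, z]" for x y z using perms that r by auto
  have e: "m k a * ?p b c + m k b * ?p a c = 0" "m k a * ?p b d + m k b * ?p a d = 0"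
     "m k c * ?p a d + m k d * ?p a c = 0" "m k c * ?p b d + m k d * ?p b c = 0"
    using P[of a b c] P[of a b d] P[of a c d] P[of b c d] s ab cd
    by (auto simp: perm3_def)
  have det: "?p b c * ?p a d = ?p a c * ?p b d"
  proof (rule ccontr)
    assume *: "\<not> ?thesis"
    have "m k x * (?p b c * ?p a d - ?p a c * ?p b d) = 0" for x
    proof -
      consider "x = a" | "x = b" | "x = c" | "x = d" using four_cases[OF s] by blast
      then show ?thesis
      proof cases
        case 1 show ?thesis unfolding 1 using e(1,2) by Groebner_Basis.algebra
      next
        case 2 show ?thesis unfolding 2 using e(1,2) by Groebner_Basis.algebra
      next
        case 3 show ?thesis unfolding 3 using e(3,4) by Groebner_Basis.algebra
      next
        case 4 show ?thesis unfolding 4 using e(3,4) by Groebner_Basis.algebra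
      qed
    qed
    then show False using * rows[of k] by simp
  qed
  \<comment> \<open>As the permanents on \<open>a\<close>, \<open>b\<close> and on \<open>c\<close>,
    \<open>d\<close> vanish, each of the two determinants is, up to sign, twice a single
    product.\<close>
  have "2 * (2 * ((m i b * m j a) * (m i d * m j c))) = 0"
    using det ab cd unfolding perm2_def by Groebner_Basis.algebra
  then consider "m i b * m j a = 0" | "m i d * m j c = 0"
    using two by (metis mult_eq_0_iff)
  then show ?thesis
  proof cases
    case 1
    with ab have "m i a * m j b = 0" unfolding perm2_def by Groebner_Basis.algebra
    then show ?thesis using matching_zero_pair[OF r s cd 1] nz by blast
  next
    case 2
    with cd have "m i c * m j d = 0" unfolding perm2_def by Groebner_Basis.algebra
    moreover have "distinct [c, d, a, b]" using s by auto
    ultimately show ?thesis using matching_zero_pair[OF r, of c d a b] ab 2 nz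
      by (simp add: perm2_swap_cols[of m i j c] perm2_swap_cols[of m i j d])
  qed
qed

text \<open>A nonzero permanent away from the centre \<open>a\<close> forces rows \<open>k\<close>
  and \<open>l\<close> to vanish at \<open>a\<close>. Then row \<open>i\<close> is nonzero at
  \<open>a\<close>, and expanding along column \<open>a\<close> shows that all 2 x 2 permanents of
  rows \<open>k\<close>, \<open>l\<close> vanish: the pairs of rows exchange their roles.\<close>

lemma star:
  assumes r: "distinct [i, j, k, l]" and st: "\<And>b. b \<noteq> a \<Longrightarrow> perm2 m i j a b = 0"
  shows "block3_in {0} m \<or> blocks22_in {0} m"
proof (cases "\<forall>b c. b \<noteq> c \<longrightarrow> perm2 m i j b c = 0")
  case True
  then show ?thesis using perms_zero_of_two_rows[of i j] r by simp
next
  case False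
  then obtain b c where bc: "b \<noteq> c" "perm2 m i j b c \<noteq> 0" by blast
  then have ba: "b \<noteq> a" "c \<noteq> a" using st perm2_swap_cols by metis+
  have z: "m y a = 0" if "y \<in> {k, l}" for y
  proof -
    have "perm3 m y i j a b c = 0" using perms that r bc ba by auto
    then show ?thesis using bc(2) st[OF ba(1)] st[OF ba(2)] by (simp add: perm3_def)
  qed
  have nz: "m i a \<noteq> 0"
  proof
    assume "m i a = 0"
    moreover obtain x where "m x a \<noteq> 0" using cols by blast
    ultimately have "m j a \<noteq> 0" using four_cases[OF r, of x] z by auto
    with \<open>m i a = 0\<close> have "m i b = 0" if "b \<noteq> a" for b using st[OF that] by (simp add: perm2_def)
    then show False using rows[of i] \<open>m i a = 0\<close> by metis
  qed
  have "perm2 m k l u v = 0" if "u \<noteq> v" for u v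
  proof (cases "u = a \<or> v = a")
    case True
    then show ?thesis using z by (auto simp: perm2_def)
  next
    case False
    then have "perm3 m i k l a u v = 0" using perms r that by auto
    then show ?thesis using nz z by (simp add: perm3_def perm2_def)
  qed
  then show ?thesis using perms_zero_of_two_rows[of k l] r by simp
qed

text \<open>Rows \<open>k\<close> and \<open>l\<close> solve the same linear equations, whose
  coefficients are the permanents of rows \<open>i\<close>, \<open>j\<close>. If all
  \<open>perm2 m i j a b\<close> were nonzero, the sign argument would make a solution with zero
  entry at \<open>a\<close> vanish altogether, so any two solutions would be dependent.\<close>

lemma partner_column:
  assumes r: "distinct [i, j, k, l]" and ind: "m k u * m l v \<noteq> m k v * m l u"
  shows "\<exists>b. b \<noteq> a \<and> perm2 m i j a b = 0"
proof (rule ccontr)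
  assume "\<not> ?thesis"
  then have nz: "\<And>b. b \<noteq> a \<Longrightarrow> perm2 m i j a b \<noteq> 0" by blast
  obtain b c d where s: "distinct [a, b, c, d]" using distinct_extend3 .
  have kernel: "z x = 0" if "z a = 0" and
    "\<And>x y. x \<noteq> y \<Longrightarrow> x \<noteq> a \<Longrightarrow> y \<noteq> a \<Longrightarrow> z x * perm2 m i j a y + z y * perm2 m i j a x = 0"
    for z :: "4 \<Rightarrow> 'a" and x
  proof (rule ccontr)
    assume *: "z x \<noteq> 0"
    then have x: "x \<noteq> a" using that by auto
    obtain y w where yw: "distinct [a, x, y, w]" using x distinct_extend2 by metis
    have "z x * perm2 m i j a y + z y * perm2 m i j a x = 0"
      "z x * perm2 m i j a w + z w * perm2 m i j a x = 0"
      "z y * perm2 m i j a w + z w * perm2 m i j a y = 0"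
      using that(2) yw by auto
    then have "2 * (z x * perm2 m i j a y * perm2 m i j a w) = 0" by Groebner_Basis.algebra
    then show False using two * nz[of y] nz[of w] yw by auto
  qed
  have eq: "m t a * perm2 m i j x y + m t x * perm2 m i j a y + m t y * perm2 m i j a x = 0"
    if "t \<in> {k, l}" "x \<noteq> y" "x \<noteq> a" "y \<noteq> a" for t x y
  proof -
    have "perm3 m t i j a x y = 0" using perms that r by auto
    then show ?thesis by (simp add: perm3_def)
  qed
  \<comment> \<open>The combination of the two rows that cancels the entry at
    \<open>a\<close>.\<close>
  have dep: "m l a * m k x - m k a * m l x = 0" for x
  proof (rule kernel[where z = "\<lambda>x. m l a * m k x - m k a * m l x"], goal_cases)
    case (2 x y)
    have "m k a * perm2 m i j x y + m k x * perm2 m i j a y + m k y * perm2 m i j a x = 0"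
      "m l a * perm2 m i j x y + m l x * perm2 m i j a y + m l y * perm2 m i j a x = 0"
      using eq 2 by auto
    then show ?case by Groebner_Basis.algebra
  qed simp
  have "m k a \<noteq> 0 \<or> m l a \<noteq> 0"
  proof (rule ccontr)
    assume "\<not> ?thesis"
    then have ka: "m k a = 0" by blast
    have "m k x = 0" for x
      by (rule kernel[where z = "m k"]) (use ka eq[of k] in simp_all)
    then show False using rows[of k] by blast
  qed
  moreover have "m k a * (m k u * m l v - m k v * m l u) = 0" "m l a * (m k u * m l v - m k v * m l u) = 0"
    using dep[of u] dep[of v] by Groebner_Basis.algebra+
  ultimately show False using ind by simp
qed

text \<open>The vanishing \<open>perm2 m i j\<close> are the edges of a graph on the four columns.
  By \<open>partner_column\<close> no vertex is isolated, and a graph without isolated vertices on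
  four vertices contains a spanning star or a perfect matching.\<close>

lemma independent_rows:
  assumes r: "distinct [i, j, k, l]" and ind: "m k u * m l v \<noteq> m k v * m l u"
  shows "block3_in {0} m \<or> blocks22_in {0} m"
proof (cases "\<exists>a. \<forall>b. b \<noteq> a \<longrightarrow> perm2 m i j a b = 0")
  case True
  then show ?thesis using star[OF r] by blast
next
  case False
  let ?p = "perm2 m i j"
  have sym: "?p x y = ?p y x" for x y by (rule perm2_swap_cols)
  have p: "\<exists>b. b \<noteq> a \<and> ?p a b = 0" for a using partner_column[OF r ind] .
  have "\<exists>a b c d. distinct [a, b, c, d] \<and> ?p a b = 0 \<and> ?p c d = 0"
  proof -
    fix a0 :: 4
    obtain b0 where ab: "b0 \<noteq> a0" "?p a0 b0 = 0" using p by blast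
    obtain c0 d0 where s: "distinct [a0, b0, c0, d0]" using distinct_extend2 ab(1) by metis
    obtain x where x: "x \<noteq> c0" "?p c0 x = 0" using p by blast
    obtain y where y: "y \<noteq> d0" "?p d0 y = 0" using p by blast
    \<comment> \<open>The columns \<open>c0\<close> and \<open>d0\<close> are joined, or both attach
      to the same end of the edge \<open>a0\<close>, \<open>b0\<close> (a star), or to different
      ends (a matching).\<close>
    consider "x = d0" | "y = c0" | "x = a0" "y = a0" | "x = b0" "y = b0" | "x = a0" "y = b0" | "x = b0" "y = a0"
      using four_cases[OF s, of x] four_cases[OF s, of y] x y by blast
    then show ?thesis
    proof cases
      case 1 with s ab x show ?thesis by metis
    next
      case 2 with s ab y sym show ?thesis by metis
    next
      case 3
      have "?p a0 b = 0" if "b \<noteq> a0" for b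
        using four_cases[OF s, of b] 3 x y ab sym[of a0] that by auto
      then show ?thesis using False by blast
    next
      case 4
      have "?p b0 b = 0" if "b \<noteq> b0" for b
        using four_cases[OF s, of b] 4 x y ab sym[of b0] that by auto
      then show ?thesis using False by blast
    next
      case 5
      have "distinct [c0, a0, d0, b0]" using s by auto
      then show ?thesis using 5 x y by metis
    next
      case 6
      have "distinct [c0, b0, d0, a0]" using s by auto
      then show ?thesis using 6 x y by metis
    qed
  qed
  then obtain a b c d where s: "distinct [a, b, c, d]" and ab: "?p a b = 0" and cd: "?p c d = 0" by blast
  have P: "perm3 m k i j x y z = 0" if "distinct [x, y, z]" for x y z using perms that r by auto
  have no_star: "\<not> (?p x y = 0 \<and> ?p x z = 0 \<and> ?p x w = 0)" if "distinct [x, y, z, w]" for x y z w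
    using False four_cases[OF that] by metis
  \<comment> \<open>Since there is no star, the crossing pairs with vanishing permanent share no
    column. One such pair then makes row \<open>k\<close> vanish through the relations
    \<open>e\<close>.\<close>
  have "?p a c \<noteq> 0 \<and> ?p a d \<noteq> 0 \<and> ?p b c \<noteq> 0 \<and> ?p b d \<noteq> 0"
  proof (rule ccontr)
    assume *: "\<not> ?thesis"
    have e: "m k a * ?p b c + m k b * ?p a c = 0" "m k a * ?p b d + m k b * ?p a d = 0"
      "m k c * ?p a d + m k d * ?p a c = 0" "m k c * ?p b d + m k d * ?p b c = 0"
      using P[of a b c] P[of a b d] P[of a c d] P[of b c d] s ab cd by (auto simp: perm3_def)
    have n: "\<not> (?p a c = 0 \<and> ?p a d = 0)" "\<not> (?p b c = 0 \<and> ?p b d = 0)"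
       "\<not> (?p a c = 0 \<and> ?p b c = 0)" "\<not> (?p a d = 0 \<and> ?p b d = 0)"
      using no_star[of a b c d] no_star[of b a c d] no_star[of c d a b] no_star[of d c a b] s ab cd
      by (auto simp: sym)
    from * consider "?p a c = 0" "?p b c \<noteq> 0" "?p a d \<noteq> 0" | "?p a d = 0" "?p a c \<noteq> 0" "?p b d \<noteq> 0"
      | "?p b c = 0" "?p a c \<noteq> 0" "?p b d \<noteq> 0" | "?p b d = 0" "?p b c \<noteq> 0" "?p a d \<noteq> 0"
      using n by blast
    then have "m k a = 0 \<and> m k b = 0 \<and> m k c = 0 \<and> m k d = 0" by cases (use e in simp_all)
    then have "m k x = 0" for x using four_cases[OF s, of x] by blast
    then show False using rows[of k] by blast
  qed
  then show ?thesis using matching[OF r s ab cd] by blast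
qed

theorem classification:
  "block3_in {0} m \<or> blocks22_in {0} m \<or>
   (\<forall>i j a b. m i a * m j b = m i b * m j a) \<and> (3::'a) = 0"
proof (cases "\<forall>i j a b. m i a * m j b = m i b * m j a")
  case True
  \<comment> \<open>The minor through a zero entry would equate 0 with the product of a nonzero
    entry of its row and one of its column.\<close>
  have nz: "m i a \<noteq> 0" for i a
  proof
    assume *: "m i a = 0"
    obtain b j where "m i b \<noteq> 0" "m j a \<noteq> 0" using rows cols by metis
    then show False using True[rule_format, of i a j b] * by simp
  qed
  obtain i j k l :: 4 where r: "distinct [i, j, k, l]" using distinct_extend3[of 0] .
  \<comment> \<open>Rows and columns share their index type, so the row indices serve as column
    indices too. In rank 1 all six terms equal the diagonal product.\<close>
  have "perm3 m i j k i j k = 0" using perms r by simp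
  then have "m i i * (m j j * m k k + m j k * m k j) + m i j * (m j i * m k k + m j k * m k i) +
      m i k * (m j i * m k j + m j j * m k i) = 0" by (simp add: perm3_def perm2_def)
  moreover have "m i i * m j j = m i j * m j i" "m j j * m k k = m j k * m k j"
    "m i i * m k k = m i k * m k i" "m i j * m j k = m i k * m j j" "m i k * m k j = m i j * m k k"
    using True by metis+
  ultimately have "2 * (3 * (m i i * m j j * m k k)) = 0" by Groebner_Basis.algebra
  then have "(3::'a) = 0" using nz two by (metis mult_eq_0_iff)
  then show ?thesis using True by simp
next
  case False
  then obtain k l u v where kl: "m k u * m l v \<noteq> m k v * m l u" by blast
  then have "k \<noteq> l" by auto
  then obtain i j where "distinct [k, l, i, j]" by (rule distinct_extend2)
  then have "distinct [i, j, k, l]" by auto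
  then show ?thesis using independent_rows kl by blast
qed

end

section \<open>Ideals and evaluation of polynomials\<close>

definition is_ideal :: "'a::comm_ring_1 set \<Rightarrow> bool" where
  "is_ideal I \<longleftrightarrow> 0 \<in> I \<and> (\<forall>x\<in>I. \<forall>y\<in>I. x + y \<in> I) \<and> (\<forall>r. \<forall>x\<in>I. r * x \<in> I)"

lemma is_idealI:
  assumes "0 \<in> I" "\<And>x y. x \<in> I \<Longrightarrow> y \<in> I \<Longrightarrow> x + y \<in> I" "\<And>r x. x \<in> I \<Longrightarrow> r * x \<in> I"
  shows "is_ideal I"
  using assms by (simp add: is_ideal_def)

lemma ideal_0: "is_ideal I \<Longrightarrow> 0 \<in> I"
  and ideal_add: "is_ideal I \<Longrightarrow> x \<in> I \<Longrightarrow> y \<in> I \<Longrightarrow> x + y \<in> I"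
  and ideal_mult: "is_ideal I \<Longrightarrow> x \<in> I \<Longrightarrow> r * x \<in> I"
  and ideal_mult_right: "is_ideal I \<Longrightarrow> x \<in> I \<Longrightarrow> x * r \<in> I"
  by (simp_all add: is_ideal_def mult.commute[of x])

lemma ideal_uminus: "is_ideal I \<Longrightarrow> x \<in> I \<Longrightarrow> - x \<in> I"
  using ideal_mult[of I x "- 1"] by simp

lemma ideal_diff: "is_ideal I \<Longrightarrow> x \<in> I \<Longrightarrow> y \<in> I \<Longrightarrow> x - y \<in> I"
  using ideal_add[of I x "- y"] ideal_uminus[of I y] by simp

lemma ideal_sum: "is_ideal I \<Longrightarrow> (\<And>x. x \<in> A \<Longrightarrow> f x \<in> I) \<Longrightarrow> sum f A \<in> I"
  by (induction A rule: infinite_finite_induct) (auto intro: ideal_0 ideal_add)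

lemma ring_of_type_algebra_simps:
  "carrier ring_of_type_algebra = UNIV"
  "x \<otimes>\<^bsub>ring_of_type_algebra\<^esub> y = x * y"
  "x \<oplus>\<^bsub>ring_of_type_algebra\<^esub> y = x + y"
  "\<zero>\<^bsub>ring_of_type_algebra\<^esub> = 0"
  "\<one>\<^bsub>ring_of_type_algebra\<^esub> = 1"
  by (simp_all add: ring_of_type_algebra_def)

lemma ideal_ring_of_type_algebra_iff:
  "ideal I ring_of_type_algebra \<longleftrightarrow> is_ideal I"
proof
  let ?R = "ring_of_type_algebra :: 'a ring"
  assume "ideal I ?R"
  then interpret ideal I ?R .
  show "is_ideal I"
    using additive_subgroup.zero_closed[OF is_additive_subgroup]
      additive_subgroup.a_closed[OF is_additive_subgroup] I_l_closed
    by (simp add: is_ideal_def ring_of_type_algebra_simps)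
next
  let ?R = "ring_of_type_algebra :: 'a ring"
  assume I: "is_ideal I"
  interpret R: ring ?R by (rule ring_from_type_algebra)
  show "ideal I ?R"
  proof (rule idealI)
    show "subgroup I (add_monoid ?R)"
    proof (rule R.add.subgroupI)
      show "\<ominus>\<^bsub>?R\<^esub> x \<in> I" if "x \<in> I" for x
      proof -
        have "\<ominus>\<^bsub>?R\<^esub> x = - x"
          by (rule R.minus_equality) (simp_all add: ring_of_type_algebra_simps)
        then show ?thesis using ideal_uminus[OF I that] by simp
      qed
    qed (use I in \<open>auto simp: is_ideal_def ring_of_type_algebra_def\<close>)
  qed (use I in \<open>auto simp: ring_of_type_algebra_simps intro: ideal_mult ideal_mult_right R.ring_axioms\<close>)
qed

lemma ideal_gen_eq: "ideal_gen S = \<Inter>{I. is_ideal I \<and> S \<subseteq> I}"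
  by (simp add: ideal_gen_def genideal_def ideal_ring_of_type_algebra_iff)

lemma is_ideal_ideal_gen: "is_ideal (ideal_gen S)"
  unfolding ideal_gen_eq by (rule is_idealI) (auto intro: ideal_0 ideal_add ideal_mult)

lemma ideal_gen_superset: "S \<subseteq> ideal_gen S"
  unfolding ideal_gen_eq by blast

lemma ideal_gen_subset_iff: "is_ideal I \<Longrightarrow> ideal_gen S \<subseteq> I \<longleftrightarrow> S \<subseteq> I"
  unfolding ideal_gen_eq by blast

lemma ideal_gen_mono: "S \<subseteq> T \<Longrightarrow> ideal_gen S \<subseteq> ideal_gen T"
  unfolding ideal_gen_eq by blast

lemma ideal_gen_insert:
  "ideal_gen (insert h S) = {q + h * w | q w. q \<in> ideal_gen S}" (is "?L = ?R")
proof
  let ?I = "ideal_gen S"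
  have "is_ideal ?R"
  proof (rule is_idealI)
    have "0 = 0 + h * 0" by simp
    then show "0 \<in> ?R" using ideal_0[OF is_ideal_ideal_gen, of S] by blast
  next
    fix x y assume "x \<in> ?R" "y \<in> ?R"
    then obtain q w q' w' where "x = q + h * w" "y = q' + h * w'" "q \<in> ?I" "q' \<in> ?I" by blast
    then have "x + y = (q + q') + h * (w + w')" "q + q' \<in> ?I"
      by (auto simp: algebra_simps intro: ideal_add[OF is_ideal_ideal_gen])
    then show "x + y \<in> ?R" by blast
  next
    fix r x assume "x \<in> ?R"
    then obtain q w where "x = q + h * w" "q \<in> ?I" by blast
    then have "r * x = (r * q) + h * (r * w)" "r * q \<in> ?I"
      by (simp_all add: algebra_simps ideal_mult[OF is_ideal_ideal_gen] ideal_mult_right[OF is_ideal_ideal_gen])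
    then show "r * x \<in> ?R" by blast
  qed
  moreover have "insert h S \<subseteq> ?R"
  proof -
    have "h = 0 + h * 1" "s = s + h * 0" for s by simp_all
    then show ?thesis using ideal_gen_superset[of S] ideal_0[OF is_ideal_ideal_gen, of S] by blast
  qed
  ultimately show "?L \<subseteq> ?R" by (simp only: ideal_gen_subset_iff)
next
  have "h \<in> ?L" "ideal_gen S \<subseteq> ?L"
    using ideal_gen_superset[of "insert h S"] ideal_gen_mono[of S "insert h S"] by blast+
  then show "?R \<subseteq> ?L"
    by (auto intro!: ideal_add[OF is_ideal_ideal_gen] ideal_mult_right[OF is_ideal_ideal_gen])
qed

lemma prime_ideal_iff:
  "prime_ideal P \<longleftrightarrow> is_ideal P \<and> 1 \<notin> P \<and> (\<forall>x y. x * y \<in> P \<longrightarrow> x \<in> P \<or> y \<in> P)"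
proof
  let ?R = "ring_of_type_algebra :: 'a ring"
  assume "prime_ideal P"
  then interpret primeideal P ?R by (simp add: prime_ideal_def)
  have i: "is_ideal P" using is_ideal by (simp add: ideal_ring_of_type_algebra_iff)
  have "1 \<notin> P"
  proof
    assume "1 \<in> P"
    then have "x \<in> P" for x using ideal_mult[OF i, of 1 x] by simp
    then show False using I_notcarr by (auto simp: ring_of_type_algebra_def)
  qed
  then show "is_ideal P \<and> 1 \<notin> P \<and> (\<forall>x y. x * y \<in> P \<longrightarrow> x \<in> P \<or> y \<in> P)"
    using i I_prime by (auto simp: ring_of_type_algebra_def)
next
  let ?R = "ring_of_type_algebra :: 'a ring"
  assume *: "is_ideal P \<and> 1 \<notin> P \<and> (\<forall>x y. x * y \<in> P \<longrightarrow> x \<in> P \<or> y \<in> P)"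
  show "prime_ideal P" unfolding prime_ideal_def
    by (rule primeidealI)
      (use * in \<open>auto simp: ring_of_type_algebra_simps ideal_ring_of_type_algebra_iff
         intro: cring_from_type_algebra\<close>)
qed

lemma prime_ideal_ideal: "prime_ideal P \<Longrightarrow> is_ideal P"
  and prime_ideal_one: "prime_ideal P \<Longrightarrow> 1 \<notin> P"
  and prime_ideal_mult_iff: "prime_ideal P \<Longrightarrow> x * y \<in> P \<longleftrightarrow> x \<in> P \<or> y \<in> P"
  by (auto simp: prime_ideal_iff intro: ideal_mult ideal_mult_right)

lemma prime_ideal_kernel:
  fixes h :: "'a::comm_ring_1 \<Rightarrow> 'b::idom"
  assumes "comm_ring_hom h"
  shows "prime_ideal {x. h x = 0}"
proof -
  interpret comm_ring_hom h by fact
  show ?thesis unfolding prime_ideal_iff is_ideal_def by (auto simp: hom_distribs)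
qed

lemma is_ideal_kernel:
  assumes "comm_ring_hom h"
  shows "is_ideal {x. h x = 0}"
proof -
  interpret comm_ring_hom h by fact
  show ?thesis unfolding is_ideal_def by (auto simp: hom_distribs)
qed

section \<open>Polynomials as sums of monomials and their evaluation\<close>

lemma sum_single_keys:
  fixes f :: "'a \<Rightarrow>\<^sub>0 'b::comm_monoid_add"
  shows "(\<Sum>m\<in>Poly_Mapping.keys f. Poly_Mapping.single m (Poly_Mapping.lookup f m)) = f"
  by (rule poly_mapping_eqI) (simp add: lookup_sum lookup_single when_def sum.delta' in_keys_iff)

lemma poly_mapping_additive_induct [case_names single add]:
  fixes f :: "'a \<Rightarrow>\<^sub>0 'b::comm_monoid_add"
  assumes "\<And>m c. P (Poly_Mapping.single m c)" "\<And>f g. P f \<Longrightarrow> P g \<Longrightarrow> P (f + g)"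
  shows "P f"
proof -
  have "P (\<Sum>m\<in>A. Poly_Mapping.single m (Poly_Mapping.lookup f m))" if "finite A" for A
    using that
  proof (induction A)
    case empty
    then show ?case using assms(1)[of undefined 0] by simp
  qed (use assms in simp)
  from this[OF finite_keys[of f]] show ?thesis by (simp only: sum_single_keys)
qed

abbreviation Const :: "'k::comm_ring_1 \<Rightarrow> ('v, 'k) mpoly" where
  "Const \<equiv> Poly_Mapping.single 0"

lemma comm_ring_hom_Const: "comm_ring_hom Const"
  by unfold_locales (simp_all add: single_add mult_single)

lemma prod_single:
  "(\<Prod>v\<in>A. Poly_Mapping.single (f v) (g v)) = Poly_Mapping.single (\<Sum>v\<in>A. f v) (\<Prod>v\<in>A. g v)"
  by (induction A rule: infinite_finite_induct) (simp_all add: mult_single)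

lemma Var_power: "Var v ^ n = Poly_Mapping.single (Poly_Mapping.single v n) 1"
  by (induction n) (simp_all add: Var_def mult_single flip: single_add)

lemma single_eq_prod_Var:
  fixes m :: "'v::finite \<Rightarrow>\<^sub>0 nat"
  shows "Poly_Mapping.single m c = Const c * (\<Prod>v\<in>UNIV. Var v ^ Poly_Mapping.lookup m v)"
proof -
  have "(\<Sum>v\<in>UNIV. Poly_Mapping.single v (Poly_Mapping.lookup m v)) = m"
    by (rule poly_mapping_eqI) (simp add: lookup_sum lookup_single when_def sum.delta')
  then show ?thesis by (simp add: Var_power prod_single mult_single)
qed

lemma mpoly_induct [case_names Const Var add mult]:
  fixes f :: "('v::finite, 'k::comm_ring_1) mpoly"
  assumes "\<And>c. P (Const c)" "\<And>v. P (Var v)" "\<And>f g. P f \<Longrightarrow> P g \<Longrightarrow> P (f + g)"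
    "\<And>f g. P f \<Longrightarrow> P g \<Longrightarrow> P (f * g)"
  shows "P f"
proof (induction f rule: poly_mapping_additive_induct)
  case (single m c)
  have one: "P 1" using assms(1)[of 1] by simp
  have pow: "P (Var v ^ n)" for v n
    by (induction n) (simp_all add: one assms(2,4))
  have "P (\<Prod>v\<in>A. Var v ^ Poly_Mapping.lookup m v)" for A
    by (induction A rule: infinite_finite_induct) (simp_all add: one pow assms(4))
  then show ?case by (subst single_eq_prod_Var) (rule assms(4)[OF assms(1)])
qed (rule assms(3))

definition mono_eval :: "('v::finite \<Rightarrow> 'b::comm_ring_1) \<Rightarrow> ('v \<Rightarrow>\<^sub>0 nat) \<Rightarrow> 'b" where
  "mono_eval g m = (\<Prod>v\<in>UNIV. g v ^ Poly_Mapping.lookup m v)"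

definition mpoly_eval ::
  "('k::comm_ring_1 \<Rightarrow> 'b::comm_ring_1) \<Rightarrow> ('v::finite \<Rightarrow> 'b) \<Rightarrow> ('v, 'k) mpoly \<Rightarrow> 'b" where
  "mpoly_eval h g f = (\<Sum>m\<in>Poly_Mapping.keys f. h (Poly_Mapping.lookup f m) * mono_eval g m)"

lemma mono_eval_0: "mono_eval g 0 = 1"
  and mono_eval_add: "mono_eval g (m + n) = mono_eval g m * mono_eval g n"
  by (simp_all add: mono_eval_def lookup_add power_add prod.distrib)

lemma mono_eval_single: "mono_eval g (Poly_Mapping.single v n) = g v ^ n"
proof -
  have "mono_eval g (Poly_Mapping.single v n) = (\<Prod>w\<in>UNIV. if w = v then g v ^ n else 1)"
    unfolding mono_eval_def by (rule prod.cong) (auto simp: lookup_single when_def)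
  then show ?thesis by simp
qed

context
  fixes h :: "'k::comm_ring_1 \<Rightarrow> 'b::comm_ring_1" and g :: "'v::finite \<Rightarrow> 'b"
  assumes h: "comm_ring_hom h"
begin

interpretation h: comm_ring_hom h by (fact h)

lemma mpoly_eval_superset:
  assumes "finite A" "Poly_Mapping.keys f \<subseteq> A"
  shows "mpoly_eval h g f = (\<Sum>m\<in>A. h (Poly_Mapping.lookup f m) * mono_eval g m)"
  unfolding mpoly_eval_def
  by (rule sum.mono_neutral_left) (use assms in \<open>auto simp: in_keys_iff\<close>)

lemma mpoly_eval_single: "mpoly_eval h g (Poly_Mapping.single m c) = h c * mono_eval g m"
  using mpoly_eval_superset[of "{m}" "Poly_Mapping.single m c"] by simp

lemma mpoly_eval_Const: "mpoly_eval h g (Const c) = h c"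
  by (simp add: mpoly_eval_single mono_eval_0)

lemma mpoly_eval_Var: "mpoly_eval h g (Var v) = g v"
  by (simp add: Var_def mpoly_eval_single mono_eval_single)

lemma mpoly_eval_add: "mpoly_eval h g (p + q) = mpoly_eval h g p + mpoly_eval h g q"
proof -
  let ?A = "Poly_Mapping.keys p \<union> Poly_Mapping.keys q"
  have "mpoly_eval h g f = (\<Sum>m\<in>?A. h (Poly_Mapping.lookup f m) * mono_eval g m)"
    if "f \<in> {p, q, p + q}" for f
    using that keys_add[of p q] by (intro mpoly_eval_superset) auto
  then show ?thesis by (simp add: lookup_add h.hom_add algebra_simps sum.distrib)
qed

lemma mpoly_eval_mult: "mpoly_eval h g (p * q) = mpoly_eval h g p * mpoly_eval h g q"
proof (induction p rule: poly_mapping_additive_induct)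
  case (single m c)
  show ?case
    by (induction q rule: poly_mapping_additive_induct)
      (simp_all add: mult_single mpoly_eval_single mono_eval_add h.hom_mult distrib_left mpoly_eval_add)
qed (simp add: distrib_right mpoly_eval_add)

lemma comm_ring_hom_mpoly_eval: "comm_ring_hom (mpoly_eval h g)"
  using mpoly_eval_Const[of 0] mpoly_eval_Const[of 1]
  by unfold_locales (simp_all add: mpoly_eval_add mpoly_eval_mult)

end

section \<open>Ideals generated by a polynomial linear in one indeterminate\<close>

text \<open>The coefficients are taken in the full polynomial ring, not in the ring without
  \<open>v\<close>; \<open>free_of\<close> singles out the latter as the elements that become
  constant.\<close>

definition as_poly :: "'v \<Rightarrow> ('v::finite, 'k::comm_ring_1) mpoly \<Rightarrow> ('v, 'k) mpoly poly" where
  "as_poly v = mpoly_eval (\<lambda>c. [:Const c:]) (\<lambda>w. if w = v then [:0, 1:] else [:Var w:])"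

definition free_of :: "'v \<Rightarrow> ('v::finite, 'k::comm_ring_1) mpoly \<Rightarrow> bool" where
  "free_of v f \<longleftrightarrow> as_poly v f = [:f:]"

lemma comm_ring_hom_pCons_Const:
  "comm_ring_hom (\<lambda>c. [:Const c:] :: ('v::finite, 'k::comm_ring_1) mpoly poly)"
proof -
  interpret Const: comm_ring_hom "Const :: 'k \<Rightarrow> ('v, 'k) mpoly" by (rule comm_ring_hom_Const)
  show ?thesis
    by unfold_locales (auto simp: Const.hom_add Const.hom_mult one_pCons)
qed

interpretation as_poly: comm_ring_hom "as_poly v"
  unfolding as_poly_def by (intro comm_ring_hom_mpoly_eval comm_ring_hom_pCons_Const)

lemma as_poly_Const: "as_poly v (Const c) = [:Const c:]"
  and as_poly_Var: "as_poly v (Var w) = (if w = v then [:0, 1:] else [:Var w:])"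
  by (simp_all add: as_poly_def mpoly_eval_Const mpoly_eval_Var comm_ring_hom_pCons_Const)

lemma free_of_Const: "free_of v (Const c)"
  and free_of_Var: "w \<noteq> v \<Longrightarrow> free_of v (Var w)"
  and free_of_add: "free_of v f \<Longrightarrow> free_of v g \<Longrightarrow> free_of v (f + g)"
  and free_of_mult: "free_of v f \<Longrightarrow> free_of v g \<Longrightarrow> free_of v (f * g)"
  by (simp_all add: free_of_def as_poly_Const as_poly_Var as_poly.hom_add as_poly.hom_mult)

lemma free_of_1: "free_of v 1"
  using free_of_Const[of v 1] by simp

lemma free_of_power: "free_of v f \<Longrightarrow> free_of v (f ^ n)"
  by (induction n) (simp_all add: free_of_1 free_of_mult)

lemma free_of_uminus: "free_of v f \<Longrightarrow> free_of v (- f)"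
  by (simp add: free_of_def as_poly.hom_uminus)

text \<open>The polynomials all of whose coefficients in \<open>v\<close> lie in the ideal again
  form an ideal, and it contains the generators because they are constant in
  \<open>v\<close>.\<close>

lemma coeff_as_poly_in_ideal:
  assumes G: "\<And>g. g \<in> G \<Longrightarrow> free_of v g" and f: "f \<in> ideal_gen G"
  shows "Polynomial.coeff (as_poly v f) i \<in> ideal_gen G"
proof -
  let ?I = "ideal_gen G" and ?J = "{f. \<forall>i. Polynomial.coeff (as_poly v f) i \<in> ideal_gen G}"
  have "is_ideal ?J"
    by (rule is_idealI)
      (auto simp: as_poly.hom_add as_poly.hom_mult coeff_mult ideal_0[OF is_ideal_ideal_gen]
         intro!: ideal_add[OF is_ideal_ideal_gen] ideal_sum[OF is_ideal_ideal_gen]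
           ideal_mult[OF is_ideal_ideal_gen])
  moreover have "G \<subseteq> ?J"
  proof (safe)
    fix g i assume g: "g \<in> G"
    then have "as_poly v g = [:g:]" using G by (simp add: free_of_def)
    then show "Polynomial.coeff (as_poly v g) i \<in> ?I"
      using ideal_gen_superset[of G] g ideal_0[OF is_ideal_ideal_gen, of G]
      by (cases i) auto
  qed
  ultimately have "?I \<subseteq> ?J" by (simp only: ideal_gen_subset_iff)
  then show ?thesis using f by blast
qed

text \<open>Modulo \<open>Var v * a + b\<close> the product \<open>a * Var v\<close> is
  \<open>- b\<close>. The property is stable under sums and products, so induction on the
  construction of \<open>f\<close> replaces a division by degrees.\<close>

lemma pseudo_division:
  fixes a b :: "('v::finite, 'k::comm_ring_1) mpoly"
  assumes a: "free_of v a" and b: "free_of v b"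
  shows "\<exists>n r w. free_of v r \<and> a ^ n * f = r + (Var v * a + b) * w"
proof (induction f rule: mpoly_induct)
  case (Const c)
  have "a ^ 0 * Const c = Const c + (Var v * a + b) * 0" by simp
  then show ?case using free_of_Const by blast
next
  case (Var w)
  show ?case
  proof (cases "w = v")
    case True
    then have "a ^ 1 * Var w = - b + (Var v * a + b) * 1" by (simp add: algebra_simps)
    then show ?thesis using free_of_uminus[OF b] by blast
  next
    case False
    have "a ^ 0 * Var w = Var w + (Var v * a + b) * 0" by simp
    then show ?thesis using free_of_Var[OF False] by blast
  qed
next
  case (add f g)
  then obtain n r w n' r' w' where *: "free_of v r" "a ^ n * f = r + (Var v * a + b) * w"
    "free_of v r'" "a ^ n' * g = r' + (Var v * a + b) * w'" by blast
  have "a ^ (n + n') * (f + g) = a ^ n' * (a ^ n * f) + a ^ n * (a ^ n' * g)"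
    by (simp add: power_add algebra_simps)
  also have "\<dots> = (a ^ n' * r + a ^ n * r') + (Var v * a + b) * (a ^ n' * w + a ^ n * w')"
    unfolding * by (simp add: algebra_simps)
  finally have "a ^ (n + n') * (f + g) = \<dots>" .
  moreover have "free_of v (a ^ n' * r + a ^ n * r')"
    by (intro free_of_add free_of_mult free_of_power a *(1,3))
  ultimately show ?case by blast
next
  case (mult f g)
  then obtain n r w n' r' w' where *: "free_of v r" "a ^ n * f = r + (Var v * a + b) * w"
    "free_of v r'" "a ^ n' * g = r' + (Var v * a + b) * w'" by blast
  have "a ^ (n + n') * (f * g) = (a ^ n * f) * (a ^ n' * g)"
    by (simp add: power_add algebra_simps)
  also have "\<dots> = r * r' + (Var v * a + b) * (w * r' + r * w' + (Var v * a + b) * w * w')"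
    unfolding * by (simp add: algebra_simps)
  finally show ?case using free_of_mult[OF *(1,3)] by blast
qed

text \<open>
  Modulo the prime \<open>Q\<close> generated by \<open>G\<close>, the leading coefficient of a multiple of \<open>X a + b\<close> in
  \<open>X = Var v\<close> is a multiple of \<open>a\<close>, so the multiple is free of \<open>X\<close> only if it vanishes.
\<close>

lemma free_of_in_ideal_insert:
  assumes G: "\<And>g. g \<in> G \<Longrightarrow> free_of v g" and a: "free_of v a" and b: "free_of v b"
    and prime: "prime_ideal (ideal_gen G)" and aG: "a \<notin> ideal_gen G"
    and u: "free_of v u" "u \<in> ideal_gen (insert (Var v * a + b) G)"
  shows "u \<in> ideal_gen G"
proof -
  let ?Q = "ideal_gen G" and ?h = "Var v * a + b"
  obtain q w where q: "q \<in> ?Q" "u = q + ?h * w" using u(2) unfolding ideal_gen_insert by blast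
  have Q: "is_ideal ?Q" by (rule is_ideal_ideal_gen)
  define c where "c i = Polynomial.coeff (as_poly v w) i" for i
  have "as_poly v ?h = [:b, a:]"
    using a b by (simp add: as_poly.hom_add as_poly.hom_mult as_poly_Var free_of_def)
  then have "[:u:] = as_poly v q + [:b, a:] * as_poly v w"
    using u(1) q(2) by (simp add: free_of_def as_poly.hom_add as_poly.hom_mult)
  then have coeffs: "Polynomial.coeff [:u:] i = Polynomial.coeff (as_poly v q) i + b * c i +
      (case i of 0 \<Rightarrow> 0 | Suc j \<Rightarrow> a * c j)" for i
    by (simp add: c_def coeff_pCons split: nat.split)
  have qi: "Polynomial.coeff (as_poly v q) i \<in> ?Q" for i
    using coeff_as_poly_in_ideal[OF G q(1)] by blast
  have c_in: "c i \<in> ?Q" for i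
  \<comment> \<open>Descending induction on \<open>i\<close>: the coefficient at
    \<open>Suc i\<close> expresses \<open>a * c i\<close> through \<open>c (Suc i)\<close> modulo
    the prime, and \<open>a\<close> can be cancelled.\<close>
  proof (induction "Polynomial.degree (as_poly v w) - i" arbitrary: i rule: less_induct)
    case less
    show ?case
    proof (cases "i > Polynomial.degree (as_poly v w)")
      case True
      then have "c i = 0" unfolding c_def by (rule coeff_eq_0)
      then show ?thesis using ideal_0[OF Q] by simp
    next
      case False
      have "c (Suc i) \<in> ?Q"
      proof (cases "Suc i > Polynomial.degree (as_poly v w)")
        case True
        then have "c (Suc i) = 0" unfolding c_def by (rule coeff_eq_0)
        then show ?thesis using ideal_0[OF Q] by simp
      qed (use less False in auto)
      moreover have "0 = Polynomial.coeff (as_poly v q) (Suc i) + b * c (Suc i) + a * c i"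
        using coeffs[of "Suc i"] by simp
      then have "a * c i = - (Polynomial.coeff (as_poly v q) (Suc i) + b * c (Suc i))"
        by (simp add: algebra_simps eq_neg_iff_add_eq_0)
      ultimately have "a * c i \<in> ?Q"
        using ideal_uminus[OF Q] ideal_add[OF Q qi] ideal_mult[OF Q] by metis
      then show ?thesis using aG prime_ideal_mult_iff[OF prime] by blast
    qed
  qed
  have "u = Polynomial.coeff (as_poly v q) 0 + b * c 0" using coeffs[of 0] by simp
  then show ?thesis using ideal_add[OF Q qi] ideal_mult[OF Q c_in] by simp
qed

text \<open>Once \<open>a\<close> is inverted, the new generator merely eliminates \<open>v\<close>,
  and the quotient is a domain because \<open>G\<close> generates a prime. The conditions on
  \<open>insert a G\<close> and \<open>b\<close> make \<open>a\<close> cancellable modulo the new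
  ideal, so primality descends from the localisation.\<close>

lemma prime_ideal_insert_linear:
  assumes G: "\<And>g. g \<in> G \<Longrightarrow> free_of v g" and a: "free_of v a" and b: "free_of v b"
    and prime: "prime_ideal (ideal_gen G)" and aG: "a \<notin> ideal_gen G"
    and prime': "prime_ideal (ideal_gen (insert a G))" and ba: "b \<notin> ideal_gen (insert a G)"
  shows "prime_ideal (ideal_gen (insert (Var v * a + b) G))"
proof -
  let ?Q = "ideal_gen G" and ?h = "Var v * a + b"
  let ?P = "ideal_gen (insert ?h G)" and ?A = "ideal_gen (insert a G)"
  have Q: "is_ideal ?Q" and P: "is_ideal ?P" and A: "is_ideal ?A" by (rule is_ideal_ideal_gen)+
  have hP: "?h \<in> ?P" using ideal_gen_superset[of "insert ?h G"] by simp
  have QP: "?Q \<subseteq> ?P" and QA: "?Q \<subseteq> ?A" by (rule ideal_gen_mono, blast)+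
  have aA: "a \<in> ?A" using ideal_gen_superset[of "insert a G"] by simp
  have free: "u \<in> ?Q" if "free_of v u" "u \<in> ?P" for u
    using free_of_in_ideal_insert[OF G a b prime aG that] .
  have cancel: "f \<in> ?P" if af: "a * f \<in> ?P" for f
  proof -
    obtain q w where q: "q \<in> ?Q" "a * f = q + ?h * w" using af unfolding ideal_gen_insert by blast
    \<comment> \<open>Modulo \<open>a\<close> and \<open>G\<close> only \<open>b * w\<close>
      survives. As \<open>b\<close> lies outside that prime, \<open>w\<close> lies inside and can be
      rewritten through \<open>a\<close>.\<close>
    have "b * w = a * (f - Var v * w) - q" using q(2) by (simp add: algebra_simps)
    then have "b * w \<in> ?A" using ideal_diff[OF A ideal_mult_right[OF A aA]] q(1) QA by auto
    then have "w \<in> ?A" using ba prime_ideal_mult_iff[OF prime'] by blast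
    then obtain q' w' where q': "q' \<in> ?Q" "w = q' + a * w'" unfolding ideal_gen_insert by blast
    have "a * (f - ?h * w') = q + ?h * q'" using q(2) q'(2) by (simp add: algebra_simps)
    then have "a * (f - ?h * w') \<in> ?Q" using ideal_add[OF Q q(1) ideal_mult[OF Q q'(1)]] by simp
    then have "f - ?h * w' \<in> ?P" using aG prime_ideal_mult_iff[OF prime] QP by blast
    then have "(f - ?h * w') + ?h * w' \<in> ?P" using ideal_add[OF P] ideal_mult_right[OF P hP] by blast
    then show ?thesis by simp
  qed
  have cancel_power: "f \<in> ?P" if "a ^ n * f \<in> ?P" for n f
    using that by (induction n) (auto simp: mult.assoc dest: cancel)
  have "f \<in> ?P \<or> g \<in> ?P" if fg: "f * g \<in> ?P" for f g
  proof -
    obtain n r w where f: "free_of v r" "a ^ n * f = r + ?h * w"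
      using pseudo_division[OF a b] by blast
    obtain n' r' w' where g: "free_of v r'" "a ^ n' * g = r' + ?h * w'"
      using pseudo_division[OF a b] by blast
    have "r * r' = a ^ n * a ^ n' * (f * g) - ?h * (w * (a ^ n' * g) + r * w')"
    proof -
      have "a ^ n * a ^ n' * (f * g) = (a ^ n * f) * (a ^ n' * g)" by (simp add: algebra_simps)
      also have "\<dots> = r * r' + ?h * (w * (a ^ n' * g) + r * w')"
        unfolding f(2) g(2) by (simp add: algebra_simps)
      finally show ?thesis by simp
    qed
    then have "r * r' \<in> ?P"
      using ideal_diff[OF P ideal_mult[OF P fg] ideal_mult_right[OF P hP]] by metis
    then have "r * r' \<in> ?Q" using free free_of_mult f(1) g(1) by blast
    then have "r \<in> ?P \<or> r' \<in> ?P" using prime_ideal_mult_iff[OF prime] QP by blast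
    then have "a ^ n * f \<in> ?P \<or> a ^ n' * g \<in> ?P"
      unfolding f(2) g(2) using ideal_add[OF P] ideal_mult_right[OF P hP] by blast
    then show ?thesis using cancel_power by blast
  qed
  moreover have "1 \<notin> ?P" using free[OF free_of_1] prime_ideal_one[OF prime] by blast
  ultimately show ?thesis unfolding prime_ideal_iff using P by blast
qed

section \<open>Ideals generated by sets of indeterminates\<close>

definition kill_vars :: "'v set \<Rightarrow> ('v::finite, 'k::comm_ring_1) mpoly \<Rightarrow> ('v, 'k) mpoly" where
  "kill_vars S = mpoly_eval Const (\<lambda>v. if v \<in> S then 0 else Var v)"

lemma ideal_gen_Var_eq_kernel: "ideal_gen (Var ` S) = {f. kill_vars S f = 0}"
proof
  let ?I = "ideal_gen (Var ` S)"
  interpret s: comm_ring_hom "kill_vars S"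
    unfolding kill_vars_def by (intro comm_ring_hom_mpoly_eval comm_ring_hom_Const)
  have I: "is_ideal ?I" by (rule is_ideal_ideal_gen)
  have "is_ideal {f. kill_vars S f = 0}" by (intro is_ideal_kernel) unfold_locales
  moreover have "Var ` S \<subseteq> {f. kill_vars S f = 0}"
    by (auto simp: kill_vars_def mpoly_eval_Var comm_ring_hom_Const)
  ultimately show "?I \<subseteq> {f. kill_vars S f = 0}" using ideal_gen_subset_iff by blast
  have diff: "f - kill_vars S f \<in> ?I" for f
  proof (induction f rule: mpoly_induct)
    case (Const c)
    then show ?case
      by (simp add: kill_vars_def mpoly_eval_Const comm_ring_hom_Const ideal_0[OF I])
  next
    case (Var v)
    then show ?case using ideal_gen_superset[of "Var ` S"]
      by (auto simp: kill_vars_def mpoly_eval_Var comm_ring_hom_Const ideal_0[OF I])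
  next
    case (add f g)
    have "f + g - kill_vars S (f + g) = (f - kill_vars S f) + (g - kill_vars S g)"
      by (simp add: s.hom_add)
    then show ?case using ideal_add[OF I add] by (simp only:)
  next
    case (mult f g)
    have "f * g - kill_vars S (f * g) = (f - kill_vars S f) * g + kill_vars S f * (g - kill_vars S g)"
      by (simp add: s.hom_mult algebra_simps)
    then show ?case using ideal_add[OF I ideal_mult_right[OF I mult(1)] ideal_mult[OF I mult(2)]] by (simp only:)
  qed
  have "f \<in> ?I" if "kill_vars S f = 0" for f using diff[of f] that by simp
  then show "{f. kill_vars S f = 0} \<subseteq> ?I" by blast
qed

text \<open>The linear order on the indeterminates induces one on the monomials, which is what makes
  the polynomial ring an instance of \<open>idom\<close>; the target of \<open>kill_vars\<close> is
  therefore a domain.\<close>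

lemma prime_ideal_Vars:
  "prime_ideal (ideal_gen (Var ` S :: ('v::{finite,linorder}, 'k::idom) mpoly set))"
  unfolding ideal_gen_Var_eq_kernel kill_vars_def
  by (intro prime_ideal_kernel comm_ring_hom_mpoly_eval comm_ring_hom_Const)

lemma Var_nonzero: "Var v \<noteq> (0 :: ('v, 'k::comm_ring_1) mpoly)"
proof
  assume "Var v = (0 :: ('v, 'k) mpoly)"
  from arg_cong[OF this, of "\<lambda>f. Poly_Mapping.lookup f (Poly_Mapping.single v 1)"]
  show False by (simp add: Var_def)
qed

lemma Var_in_ideal_Vars_iff:
  "Var v \<in> ideal_gen (Var ` S :: ('v::finite, 'k::comm_ring_1) mpoly set) \<longleftrightarrow> v \<in> S"
proof -
  have "kill_vars S (Var v) = (if v \<in> S then 0 else Var v :: ('v, 'k) mpoly)"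
    unfolding kill_vars_def by (rule mpoly_eval_Var[OF comm_ring_hom_Const])
  then show ?thesis
    unfolding ideal_gen_Var_eq_kernel using Var_nonzero[of v] by auto
qed

section \<open>The ideal of the two-by-two minors\<close>

text \<open>
  The Segre map \<open>x\<^sub>i\<^sub>j \<mapsto> s\<^sub>i t\<^sub>j\<close>; the indeterminates \<open>s\<^sub>i\<close>, \<open>t\<^sub>j\<close> of the target are named
  \<open>(i, 0)\<close>, \<open>(j, 1)\<close>. On exponents it records the row and column sums.
\<close>

definition segre :: "(4 \<times> 4, 'k::comm_ring_1) mpoly \<Rightarrow> (4 \<times> 4, 'k) mpoly" where
  "segre = mpoly_eval Const (\<lambda>v. Var (fst v, 0) * Var (snd v, 1))"

definition margins :: "(4 \<times> 4 \<Rightarrow>\<^sub>0 nat) \<Rightarrow> (4 \<times> 4 \<Rightarrow>\<^sub>0 nat)" where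
  "margins m = (\<Sum>v\<in>UNIV. Poly_Mapping.single (fst v, 0) (Poly_Mapping.lookup m v) +
     Poly_Mapping.single (snd v, 1) (Poly_Mapping.lookup m v))"

definition minors2 :: "(4 \<times> 4, 'k::comm_ring_1) mpoly set" where
  "minors2 = {Var (i, a) * Var (j, b) - Var (i, b) * Var (j, a) | i j a b. True}"

interpretation segre: comm_ring_hom segre
  unfolding segre_def by (intro comm_ring_hom_mpoly_eval comm_ring_hom_Const)

lemma segre_Var: "segre (Var v) = Var (fst v, 0) * Var (snd v, 1)"
  by (simp add: segre_def mpoly_eval_Var comm_ring_hom_Const)

lemma segre_single:
  fixes c :: "'k::comm_ring_1"
  shows "segre (Poly_Mapping.single m c) = Poly_Mapping.single (margins m) c"
proof -
  have "mono_eval (\<lambda>v. Var (fst v, 0) * Var (snd v, 1)) m =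
      (Poly_Mapping.single (margins m) 1 :: (4 \<times> 4, 'k) mpoly)"
    by (simp add: mono_eval_def margins_def power_mult_distrib Var_power mult_single prod_single)
  then show ?thesis
    unfolding segre_def mpoly_eval_single[OF comm_ring_hom_Const] by (simp add: mult_single)
qed

lemma margins_add: "margins (m + n) = margins m + margins n"
  by (simp add: margins_def lookup_add single_add sum.distrib ac_simps)

lemma margins_single:
  "margins (Poly_Mapping.single v n) = Poly_Mapping.single (fst v, 0) n + Poly_Mapping.single (snd v, 1) n"
proof -
  have "margins (Poly_Mapping.single v n) = (\<Sum>w\<in>UNIV. if w = v
      then Poly_Mapping.single (fst v, 0) n + Poly_Mapping.single (snd v, 1) n else 0)"
    unfolding margins_def by (rule sum.cong) (auto simp: lookup_single when_def)
  then show ?thesis by simp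
qed

lemma lookup_margins_row:
  "Poly_Mapping.lookup (margins m) (i, 0) \<noteq> 0 \<longleftrightarrow> (\<exists>j. Poly_Mapping.lookup m (i, j) \<noteq> 0)"
  by (auto simp: margins_def lookup_sum lookup_add lookup_single when_def)

lemma lookup_margins_col:
  "Poly_Mapping.lookup (margins m) (j, 1) \<noteq> 0 \<longleftrightarrow> (\<exists>i. Poly_Mapping.lookup m (i, j) \<noteq> 0)"
  by (auto simp: margins_def lookup_sum lookup_add lookup_single when_def)

lemma split_off_single:
  fixes m :: "'v \<Rightarrow>\<^sub>0 nat"
  assumes "Poly_Mapping.lookup m v \<noteq> 0"
  obtains m' where "m = m' + Poly_Mapping.single v 1"
proof
  show "m = (m - Poly_Mapping.single v 1) + Poly_Mapping.single v 1"
    using assms by (intro poly_mapping_eqI) (auto simp: lookup_add lookup_minus lookup_single when_def)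
qed

lemma single_add_Var:
  "Poly_Mapping.single (m + Poly_Mapping.single v 1) 1 = Poly_Mapping.single m 1 * Var v"
  by (simp add: Var_def mult_single)

text \<open>Induction on the degree. If both monomials contain the indeterminate at
  \<open>(i, j)\<close>, it is cancelled. Otherwise equal margins provide factors of
  \<open>m\<close> in row \<open>i\<close> and in column \<open>j\<close>, and exchanging their
  columns brings in \<open>(i, j)\<close> at the price of a 2 x 2 minor.\<close>

lemma straightening:
  assumes "margins m = margins m'"
  shows "Poly_Mapping.single m 1 - Poly_Mapping.single m' 1 \<in>
    ideal_gen (minors2 :: (4 \<times> 4, 'k::comm_ring_1) mpoly set)"
  using assms
proof (induction "\<Sum>v\<in>UNIV. Poly_Mapping.lookup m' v" arbitrary: m m')
  case 0
  then have m': "Poly_Mapping.lookup m' v = 0" for v by (cases v) simp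
  then have "Poly_Mapping.lookup m (i, j) = 0" for i j
    using lookup_margins_row[of m i] lookup_margins_row[of m' i] 0(2) by metis
  then have "m = m'" using m' by (intro poly_mapping_eqI) (metis surj_pair)
  then show ?case using ideal_0[OF is_ideal_ideal_gen] by simp
next
  case (Suc n)
  let ?I = "ideal_gen (minors2 :: (4 \<times> 4, 'k) mpoly set)"
  let ?X = "\<lambda>m. Poly_Mapping.single m 1 :: (4 \<times> 4, 'k) mpoly"
  have I: "is_ideal ?I" by (rule is_ideal_ideal_gen)
  have "\<exists>v. Poly_Mapping.lookup m' v \<noteq> 0" using Suc(2) by (metis sum.neutral nat.distinct(1))
  then obtain i j where ij: "Poly_Mapping.lookup m' (i, j) \<noteq> 0" by (metis surj_pair)
  then obtain n' where n': "m' = n' + Poly_Mapping.single (i, j) 1" by (rule split_off_single)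
  have n: "n = (\<Sum>v\<in>UNIV. Poly_Mapping.lookup n' v)"
  proof -
    have "(\<Sum>v\<in>UNIV. Poly_Mapping.lookup m' v) = (\<Sum>v\<in>UNIV. Poly_Mapping.lookup n' v) + 1"
      unfolding n' by (simp add: lookup_add sum.distrib lookup_single when_def)
    then show ?thesis using Suc(2) by simp
  qed
  have common: "?X p - ?X m' \<in> ?I"
    if p: "Poly_Mapping.lookup p (i, j) \<noteq> 0" "margins p = margins m'" for p
  proof -
    obtain q where q: "p = q + Poly_Mapping.single (i, j) 1" using p(1) by (rule split_off_single)
    then have "margins q = margins n'" using p(2) n' by (simp add: margins_add)
    then have "?X q - ?X n' \<in> ?I" using Suc(1)[OF n] by blast
    then have "(?X q - ?X n') * Var (i, j) \<in> ?I" by (rule ideal_mult_right[OF I])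
    then show ?thesis unfolding q n' single_add_Var by (simp add: left_diff_distrib)
  qed
  show ?case
  proof (cases "Poly_Mapping.lookup m (i, j) = 0")
    case False
    then show ?thesis using common Suc(3) by blast
  next
    case True
    obtain b where b: "Poly_Mapping.lookup m (i, b) \<noteq> 0"
      using lookup_margins_row[of m i] lookup_margins_row[of m' i] Suc(3) ij by auto
    obtain k where k: "Poly_Mapping.lookup m (k, j) \<noteq> 0"
      using lookup_margins_col[of m j] lookup_margins_col[of m' j] Suc(3) ij by auto
    obtain q where q: "m = q + Poly_Mapping.single (i, b) 1" using b by (rule split_off_single)
    \<comment> \<open>Here \<open>b\<close> differs from \<open>j\<close>, since
      \<open>(i, j)\<close> does not occur in \<open>m\<close>; removing \<open>(i, b)\<close> thus
      leaves the exponent at \<open>(k, j)\<close> unchanged.\<close>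
    have "Poly_Mapping.lookup q (k, j) \<noteq> 0"
      using k b True by (auto simp: q lookup_add lookup_single when_def split: if_splits)
    then obtain r where r: "q = r + Poly_Mapping.single (k, j) 1" by (rule split_off_single)
    define p where "p = r + Poly_Mapping.single (k, b) 1 + Poly_Mapping.single (i, j) 1"
    have "margins p = margins m" by (simp add: p_def q r margins_add margins_single ac_simps)
    moreover have "Poly_Mapping.lookup p (i, j) \<noteq> 0" by (simp add: p_def lookup_add)
    ultimately have 1: "?X p - ?X m' \<in> ?I" using common Suc(3) by simp
    have "Var (i, b) * Var (k, j) - Var (i, j) * Var (k, b) \<in> ?I"
      using ideal_gen_superset[of minors2] unfolding minors2_def by blast
    then have "?X r * (Var (i, b) * Var (k, j) - Var (i, j) * Var (k, b)) \<in> ?I"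
      by (rule ideal_mult[OF I])
    moreover have "?X m - ?X p = ?X r * (Var (i, b) * Var (k, j) - Var (i, j) * Var (k, b))"
      unfolding q r p_def single_add_Var by (simp add: algebra_simps)
    ultimately have "?X m - ?X p \<in> ?I" by simp
    from ideal_add[OF I this 1] show ?thesis by simp
  qed
qed

text \<open>The Segre map sends monomials to monomials, so for \<open>f\<close> in the kernel the
  coefficients within each class of equal margins sum to 0. Subtracting from each monomial a fixed
  representative of its class then changes nothing in total, and every difference is in the ideal by
  \<open>straightening\<close>.\<close>

lemma ideal_gen_minors2_eq_kernel:
  "ideal_gen minors2 = {f :: (4 \<times> 4, 'k::comm_ring_1) mpoly. segre f = 0}"
proof
  let ?I = "ideal_gen minors2 :: (4 \<times> 4, 'k) mpoly set"
  have "is_ideal {f :: (4 \<times> 4, 'k) mpoly. segre f = 0}" by (intro is_ideal_kernel) unfold_locales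
  moreover have "minors2 \<subseteq> {f :: (4 \<times> 4, 'k) mpoly. segre f = 0}"
    by (auto simp: minors2_def segre.hom_minus segre.hom_mult segre_Var ac_simps)
  ultimately show "?I \<subseteq> {f. segre f = 0}" using ideal_gen_subset_iff by blast
  have I: "is_ideal ?I" by (rule is_ideal_ideal_gen)
  show "{f. segre f = 0} \<subseteq> ?I"
  proof
    fix f :: "(4 \<times> 4, 'k) mpoly" assume "f \<in> {f. segre f = 0}"
    then have f0: "segre f = 0" by simp
    let ?K = "Poly_Mapping.keys f" and ?c = "Poly_Mapping.lookup f"
    define \<rho> where "\<rho> p = (SOME m. margins m = p)" for p
    have \<rho>: "margins (\<rho> (margins m)) = margins m" for m
      unfolding \<rho>_def by (rule someI) (rule refl)
    have class_sum: "(\<Sum>m\<in>{m \<in> ?K. margins m = p}. ?c m) = 0" for p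
    proof -
      have "segre f = (\<Sum>m\<in>?K. segre (Poly_Mapping.single m (?c m)))"
        by (subst (1) sum_single_keys[symmetric]) (rule segre.hom_sum)
      then have "0 = (\<Sum>m\<in>?K. Poly_Mapping.lookup (Poly_Mapping.single (margins m) (?c m)) p)"
        using f0 by (simp add: segre_single flip: lookup_sum)
      also have "\<dots> = (\<Sum>m\<in>?K. if margins m = p then ?c m else 0)"
        by (simp add: lookup_single when_def)
      also have "\<dots> = (\<Sum>m\<in>{m \<in> ?K. margins m = p}. ?c m)"
        by (rule sum.inter_filter[symmetric]) simp
      finally show ?thesis by simp
    qed
    have "(\<Sum>m\<in>?K. Const (?c m) * Poly_Mapping.single (\<rho> (margins m)) 1) =
      (\<Sum>p\<in>margins ` ?K. \<Sum>m\<in>{m \<in> ?K. margins m = p}.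
        Const (?c m) * Poly_Mapping.single (\<rho> (margins m)) 1)"
      by (rule sum.image_gen) simp
    also have "\<dots> = (\<Sum>p\<in>margins ` ?K. 0)"
    proof (rule sum.cong)
      fix p assume "p \<in> margins ` ?K"
      interpret Const: comm_ring_hom "Const :: 'k \<Rightarrow> (4 \<times> 4, 'k) mpoly" by (rule comm_ring_hom_Const)
      have "(\<Sum>m\<in>{m \<in> ?K. margins m = p}. Const (?c m) * Poly_Mapping.single (\<rho> (margins m)) 1) =
        (\<Sum>m\<in>{m \<in> ?K. margins m = p}. Const (?c m)) * Poly_Mapping.single (\<rho> p) 1"
        unfolding sum_distrib_right by (rule sum.cong) auto
      then show "(\<Sum>m\<in>{m \<in> ?K. margins m = p}. Const (?c m) * Poly_Mapping.single (\<rho> (margins m)) 1) = 0"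
        by (simp add: class_sum flip: Const.hom_sum)
    qed simp
    finally have "f = (\<Sum>m\<in>?K. Poly_Mapping.single m (?c m)) -
      (\<Sum>m\<in>?K. Const (?c m) * Poly_Mapping.single (\<rho> (margins m)) 1)"
      by (simp add: sum_single_keys)
    also have "\<dots> = (\<Sum>m\<in>?K. Const (?c m) * (Poly_Mapping.single m 1 - Poly_Mapping.single (\<rho> (margins m)) 1))"
      by (simp add: right_diff_distrib sum_subtractf mult_single)
    also have "\<dots> \<in> ?I"
      by (intro ideal_sum[OF I] ideal_mult[OF I] straightening \<rho>[symmetric])
    finally show "f \<in> ?I" .
  qed
qed

lemma prime_ideal_minors2: "prime_ideal (ideal_gen minors2 :: (4 \<times> 4, 'k::idom) mpoly set)"
  unfolding ideal_gen_minors2_eq_kernel by (intro prime_ideal_kernel) unfold_locales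

lemma Var_notin_minors2: "Var v \<notin> (ideal_gen minors2 :: (4 \<times> 4, 'k::idom) mpoly set)"
  unfolding ideal_gen_minors2_eq_kernel by (simp add: segre_Var Var_nonzero)

section \<open>Submatrices of the generic matrix\<close>

declare pick.simps [simp del]

abbreviation entry :: "4 \<Rightarrow> 4 \<Rightarrow> (4 \<times> 4, 'k::comm_ring_1) mpoly" where
  "entry i a \<equiv> Var (i, a)"

text \<open>Bridges the index type of the indeterminates and the sets of natural numbers required by
  \<open>submatrix\<close>. Every index set below 4 has this form.\<close>

definition nats :: "4 set \<Rightarrow> nat set" where
  "nats A = {n. n < 4 \<and> of_nat n \<in> A}"

lemma inj_on_of_nat_4: "inj_on (of_nat :: nat \<Rightarrow> 4) {..<4}"
proof (rule inj_onI)
  fix m n :: nat assume *: "m \<in> {..<4}" "n \<in> {..<4}" "(of_nat m :: 4) = of_nat n"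
  have "m = 0 \<or> m = 1 \<or> m = 2 \<or> m = 3" "n = 0 \<or> n = 1 \<or> n = 2 \<or> n = 3" using * by auto
  then show "m = n" using *(3) by auto
qed

lemma of_nat_image_4: "(of_nat :: nat \<Rightarrow> 4) ` {..<4} = UNIV"
proof -
  have "card ((of_nat :: nat \<Rightarrow> 4) ` {..<4}) = CARD(4)"
    using card_image[OF inj_on_of_nat_4] by simp
  then show ?thesis by (metis card_eq_UNIV_imp_eq_UNIV finite finite_code)
qed

lemma nats_subset: "nats A \<subseteq> {..<4}"
  by (auto simp: nats_def)

lemma of_nat_image_nats: "of_nat ` nats A = A"
proof
  show "A \<subseteq> of_nat ` nats A"
  proof
    fix a assume "a \<in> A"
    moreover obtain n where "n < 4" "a = of_nat n" using of_nat_image_4 by blast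
    ultimately show "a \<in> of_nat ` nats A" by (auto simp: nats_def)
  qed
qed (auto simp: nats_def)

lemma inj_on_of_nat_nats: "inj_on (of_nat :: nat \<Rightarrow> 4) (nats A)"
  using inj_on_of_nat_4 nats_subset by (rule inj_on_subset)

lemma card_nats: "card (nats A) = card A"
  using card_image[OF inj_on_of_nat_nats, of A] by (simp add: of_nat_image_nats)

lemma nats_UNIV: "nats UNIV = {..<4}"
  by (auto simp: nats_def)

lemma nats_Int: "nats A \<inter> nats B = nats (A \<inter> B)"
  by (auto simp: nats_def)

lemma nats_empty: "nats {} = {}"
  by (simp add: nats_def)

lemma nats_of_nat_image: "I \<subseteq> {..<4} \<Longrightarrow> nats (of_nat ` I) = I"
  using inj_on_of_nat_4 by (auto simp: nats_def inj_on_def subset_iff)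

lemma generic_mat_index:
  "m < 4 \<Longrightarrow> n < 4 \<Longrightarrow> generic_mat $$ (m, n) = entry (of_nat m) (of_nat n)"
  by (simp add: generic_mat_def generic_names_def)

lemma generic_mat_image:
  assumes "S \<subseteq> {..<4} \<times> {..<4}"
  shows "($$) generic_mat ` S = Var ` (map_prod of_nat of_nat ` S)"
  unfolding image_image using assms
  by (intro image_cong) (auto simp: generic_mat_index)

lemma map_prod_of_nat_nats: "map_prod of_nat of_nat ` (nats A \<times> nats B) = A \<times> B"
  by (simp add: map_prod_surj_on of_nat_image_nats)

lemma map_prod_of_nat_diff:
  assumes "S \<subseteq> {..<4} \<times> {..<4}" "T \<subseteq> {..<4} \<times> {..<4}"
  shows "(map_prod of_nat of_nat ` (S - T) :: (4 \<times> 4) set) =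
    map_prod of_nat of_nat ` S - map_prod of_nat of_nat ` T"
  by (rule inj_on_image_set_diff[OF map_prod_inj_on[OF inj_on_of_nat_4 inj_on_of_nat_4]]) (use assms in auto)

lemma pick_nats:
  assumes "r < card A"
  shows "pick (nats A) r \<in> nats A"
  using assms by (intro pick_in_set) (simp add: card_nats)

lemma of_nat_pick_nats:
  assumes "r < card A"
  shows "(of_nat (pick (nats A) r) :: 4) \<in> A"
  using pick_nats[OF assms] of_nat_image_nats by blast

lemma of_nat_pick_nats_inj:
  assumes "r < card A" "s < card A" "r \<noteq> s"
  shows "(of_nat (pick (nats A) r) :: 4) \<noteq> of_nat (pick (nats A) s)"
proof -
  have "pick (nats A) r \<noteq> pick (nats A) s"
    using assms pick_mono[of r "nats A" s] pick_mono[of s "nats A" r]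
    by (cases "r < s") (auto simp: card_nats)
  then show ?thesis
    using inj_on_of_nat_nats[of A] pick_nats[OF assms(1)] pick_nats[OF assms(2)]
    by (auto simp: inj_on_def)
qed

lemma dims_submatrix_generic:
  "dim_row (submatrix generic_mat (nats A) (nats B)) = card A"
  "dim_col (submatrix generic_mat (nats A) (nats B)) = card B"
proof -
  have "{i. i < 4 \<and> i \<in> nats C} = nats C" for C by (auto simp: nats_def)
  then show "dim_row (submatrix generic_mat (nats A) (nats B)) = card A"
    "dim_col (submatrix generic_mat (nats A) (nats B)) = card B"
    by (simp_all add: dim_submatrix generic_mat_def generic_names_def card_nats)
qed

lemma submatrix_generic_index:
  assumes "r < card A" "s < card B"
  shows "submatrix generic_mat (nats A) (nats B) $$ (r, s) =
    entry (of_nat (pick (nats A) r)) (of_nat (pick (nats B) s))"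
proof -
  have "{i. i < 4 \<and> i \<in> nats C} = nats C" for C by (auto simp: nats_def)
  then have "submatrix generic_mat (nats A) (nats B) $$ (r, s) =
      generic_mat $$ (pick (nats A) r, pick (nats B) s)"
    using assms by (intro submatrix_index) (simp_all add: generic_mat_def generic_names_def card_nats)
  also have "\<dots> = entry (of_nat (pick (nats A) r)) (of_nat (pick (nats B) s))"
    using pick_nats[OF assms(1)] pick_nats[OF assms(2)] by (intro generic_mat_index) (auto simp: nats_def)
  finally show ?thesis .
qed

section \<open>Small permanents and determinants in closed form\<close>

lemma permanent_2:
  assumes "dim_row A = 2" "dim_col A = 2"
  shows "permanent A = perm2 (\<lambda>i j. A $$ (i, j)) 0 1 0 1"
proof -
  have f: "finite {1::nat}" "0 \<notin> {1::nat}" by auto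
  have e: "{0..<2} = {0, 1::nat}" by auto
  show ?thesis
    unfolding permanent_def assms e sum_over_permutations_insert[OF f] permutes_sing
    by (simp add: perm2_def Transposition.transpose_def)
qed

lemma permanent_3:
  assumes "dim_row A = 3" "dim_col A = 3"
  shows "permanent A = perm3 (\<lambda>i j. A $$ (i, j)) 0 1 2 0 1 2"
proof -
  have f: "finite {1, 2::nat}" "0 \<notin> {1, 2::nat}" "finite {2::nat}" "1 \<notin> {2::nat}" by auto
  have e: "{0..<3} = {0, 1, 2::nat}" by auto
  show ?thesis
    unfolding permanent_def assms e sum_over_permutations_insert[OF f(1,2)]
      sum_over_permutations_insert[OF f(3,4)] permutes_sing
    by (simp add: perm3_def perm2_def Transposition.transpose_def algebra_simps)
qed

lemma det_2_by_2:
  assumes "dim_row A = 2" "dim_col A = 2"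
  shows "det A = A $$ (0, 0) * A $$ (1, 1) - A $$ (0, 1) * A $$ (1, 0)"
proof -
  have f: "finite {1::nat}" "0 \<notin> {1::nat}" by auto
  have e: "{0..<2} = {0, 1::nat}" by auto
  show ?thesis
    unfolding det_def assms e sum_over_permutations_insert[OF f] permutes_sing
    by (simp add: sign_swap_id sign_id)
qed

lemma perm2_perm:
  assumes "i' \<in> {i, j}" "j' \<in> {i, j}" "i' \<noteq> j'" "a' \<in> {a, b}" "b' \<in> {a, b}" "a' \<noteq> b'"
  shows "perm2 m i' j' a' b' = perm2 m i j a b"
proof -
  have "i' = i \<and> j' = j \<or> i' = j \<and> j' = i" "a' = a \<and> b' = b \<or> a' = b \<and> b' = a" using assms by blast+
  then show ?thesis by (elim disjE conjE) (simp_all add: perm2_def algebra_simps)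
qed

lemma perm3_perm_rows:
  assumes "i' \<in> {i, j, k}" "j' \<in> {i, j, k}" "k' \<in> {i, j, k}" "distinct [i', j', k']"
  shows "perm3 m i' j' k' a b c = perm3 m i j k a b c"
proof -
  have "i' \<noteq> j'" "i' \<noteq> k'" "j' \<noteq> k'" using assms(4) by simp_all
  then consider "i' = i" "j' = j" "k' = k" | "i' = i" "j' = k" "k' = j" | "i' = j" "j' = i" "k' = k"
    | "i' = j" "j' = k" "k' = i" | "i' = k" "j' = i" "k' = j" | "i' = k" "j' = j" "k' = i"
    using assms(1-3) by blast
  then show ?thesis by cases (simp_all add: perm3_def perm2_def algebra_simps)
qed

text \<open>Needed because \<open>pick\<close> enumerates an index set in increasing order, while
  the indices of interest come in any order. Columns are reduced to rows by transposition.\<close>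

lemma perm3_perm:
  assumes "i' \<in> {i, j, k}" "j' \<in> {i, j, k}" "k' \<in> {i, j, k}" "distinct [i', j', k']"
    and "a' \<in> {a, b, c}" "b' \<in> {a, b, c}" "c' \<in> {a, b, c}" "distinct [a', b', c']"
  shows "perm3 m i' j' k' a' b' c' = perm3 m i j k a b c"
  using perm3_perm_rows[OF assms(1-4), of m a' b' c']
    perm3_perm_rows[OF assms(5-8), of "\<lambda>a i. m i a" i j k]
  unfolding perm3_transpose[of m] by (rule trans)

lemma permanent_submatrix_2:
  assumes "i \<noteq> j" "a \<noteq> b"
  shows "permanent (submatrix generic_mat (nats {i, j}) (nats {a, b})) = perm2 entry i j a b"
proof -
  have c: "card {i, j} = 2" "card {a, b} = 2" using assms by auto
  let ?r = "\<lambda>n. of_nat (pick (nats {i, j}) n) :: 4" and ?s = "\<lambda>n. of_nat (pick (nats {a, b}) n) :: 4"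
  have "permanent (submatrix generic_mat (nats {i, j}) (nats {a, b})) = perm2 entry (?r 0) (?r 1) (?s 0) (?s 1)"
    by (subst permanent_2) (simp_all add: dims_submatrix_generic c perm2_def submatrix_generic_index)
  also have "\<dots> = perm2 entry i j a b"
    by (rule perm2_perm) (use c in \<open>simp_all add: of_nat_pick_nats of_nat_pick_nats_inj del: insert_iff\<close>)
  finally show ?thesis .
qed

lemma permanent_submatrix_3:
  assumes "distinct [i, j, k]" "distinct [a, b, c]"
  shows "permanent (submatrix generic_mat (nats {i, j, k}) (nats {a, b, c})) = perm3 entry i j k a b c"
proof -
  have c: "card {i, j, k} = 3" "card {a, b, c} = 3" using assms by auto
  let ?r = "\<lambda>n. of_nat (pick (nats {i, j, k}) n) :: 4" and ?s = "\<lambda>n. of_nat (pick (nats {a, b, c}) n) :: 4"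
  have "permanent (submatrix generic_mat (nats {i, j, k}) (nats {a, b, c})) =
      perm3 entry (?r 0) (?r 1) (?r 2) (?s 0) (?s 1) (?s 2)"
    by (subst permanent_3) (simp_all add: dims_submatrix_generic c perm3_def perm2_def submatrix_generic_index)
  also have "\<dots> = perm3 entry i j k a b c"
    by (rule perm3_perm, simp_all add: of_nat_pick_nats c del: insert_iff)
      (simp_all add: of_nat_pick_nats_inj c)
  finally show ?thesis .
qed

text \<open>Sorting the indices can change the sign of a determinant, hence two possible
  values.\<close>

lemma det_submatrix_2:
  assumes "i \<noteq> j" "a \<noteq> b"
  shows "det (submatrix generic_mat (nats {i, j}) (nats {a, b})) \<in>
    {entry i a * entry j b - entry i b * entry j a, entry i b * entry j a - entry i a * entry j b}"
proof -
  have c: "card {i, j} = 2" "card {a, b} = 2" using assms by auto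
  let ?r = "\<lambda>n. of_nat (pick (nats {i, j}) n) :: 4" and ?s = "\<lambda>n. of_nat (pick (nats {a, b}) n) :: 4"
  have "det (submatrix generic_mat (nats {i, j}) (nats {a, b})) =
      entry (?r 0) (?s 0) * entry (?r 1) (?s 1) - entry (?r 0) (?s 1) * entry (?r 1) (?s 0)"
    by (subst det_2_by_2) (simp_all add: dims_submatrix_generic c submatrix_generic_index)
  moreover have "?r n \<in> {i, j}" "?s n \<in> {a, b}" if "n < 2" for n
    using that c by (simp_all add: of_nat_pick_nats del: insert_iff)
  then have "?r 0 \<in> {i, j}" "?r 1 \<in> {i, j}" "?s 0 \<in> {a, b}" "?s 1 \<in> {a, b}" by auto
  moreover have "?r 0 \<noteq> ?r 1" "?s 0 \<noteq> ?s 1"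
    using c by (simp_all add: of_nat_pick_nats_inj)
  ultimately show ?thesis by auto
qed

lemma permanental_ideal_3_subset_iff:
  assumes "is_ideal P"
  shows "permanental_ideal 3 \<subseteq> P \<longleftrightarrow>
    (\<forall>i j k a b c. distinct [i, j, k] \<longrightarrow> distinct [a, b, c] \<longrightarrow> perm3 entry i j k a b c \<in> P)"
proof (intro iffI allI impI)
  fix i j k a b c :: 4
  assume *: "permanental_ideal 3 \<subseteq> P" and d: "distinct [i, j, k]" "distinct [a, b, c]"
  have "card (nats {i, j, k}) = 3" "card (nats {a, b, c}) = 3" using d by (simp_all add: card_nats)
  then have "permanent (submatrix generic_mat (nats {i, j, k}) (nats {a, b, c})) \<in>
      {permanent (submatrix generic_mat I J) | I J.
       I \<subseteq> {..<4} \<and> J \<subseteq> {..<4} \<and> card I = 3 \<and> card J = 3}" using nats_subset by blast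
  then show "perm3 entry i j k a b c \<in> P"
    using * unfolding permanental_ideal_def ideal_gen_subset_iff[OF assms] permanent_submatrix_3[OF d] by blast
next
  assume *: "\<forall>i j k a b c. distinct [i, j, k] \<longrightarrow> distinct [a, b, c] \<longrightarrow> perm3 entry i j k a b c \<in> P"
  have "permanent (submatrix generic_mat I J) \<in> P"
    if IJ: "I \<subseteq> {..<4}" "J \<subseteq> {..<4}" "card I = 3" "card J = 3" for I J
  proof -
    have ex: "\<exists>i j k :: 4. distinct [i, j, k] \<and> L = nats {i, j, k}" if L: "L \<subseteq> {..<4}" "card L = 3" for L
    proof -
      have "card (of_nat ` L :: 4 set) = 3"
        using L card_image[OF inj_on_subset[OF inj_on_of_nat_4 L(1)]] by simp
      then obtain i j k :: 4 where "of_nat ` L = {i, j, k}" "distinct [i, j, k]"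
        unfolding card_3_iff by auto
      then show ?thesis using nats_of_nat_image[OF L(1)] by metis
    qed
    obtain i j k :: 4 where 1: "distinct [i, j, k]" "I = nats {i, j, k}" using ex IJ by blast
    obtain a b c :: 4 where 2: "distinct [a, b, c]" "J = nats {a, b, c}" using ex IJ by blast
    show ?thesis unfolding 1(2) 2(2) permanent_submatrix_3[OF 1(1) 2(1)] using * 1(1) 2(1) by blast
  qed
  then show "permanental_ideal 3 \<subseteq> P"
    unfolding permanental_ideal_def ideal_gen_subset_iff[OF assms] by blast
qed

lemma determinantal_ideal_2_eq: "determinantal_ideal 2 = ideal_gen minors2"
proof
  have M: "is_ideal (ideal_gen minors2 :: (4 \<times> 4, 'a) mpoly set)" by (rule is_ideal_ideal_gen)
  have "det (submatrix generic_mat I J) \<in> (ideal_gen minors2 :: (4 \<times> 4, 'a) mpoly set)"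
    if IJ: "I \<subseteq> {..<4}" "J \<subseteq> {..<4}" "card I = 2" "card J = 2" for I J
  proof -
    have ex: "\<exists>i j :: 4. i \<noteq> j \<and> L = nats {i, j}" if L: "L \<subseteq> {..<4}" "card L = 2" for L
    proof -
      have "card (of_nat ` L :: 4 set) = 2"
        using L card_image[OF inj_on_subset[OF inj_on_of_nat_4 L(1)]] by simp
      then obtain i j :: 4 where "of_nat ` L = {i, j}" "i \<noteq> j" unfolding card_2_iff by auto
      then show ?thesis using nats_of_nat_image[OF L(1)] by metis
    qed
    obtain i j :: 4 where 1: "i \<noteq> j" "I = nats {i, j}" using ex IJ by blast
    obtain a b :: 4 where 2: "a \<noteq> b" "J = nats {a, b}" using ex IJ by blast
    have "entry i a * entry j b - entry i b * entry j a \<in> (minors2 :: (4 \<times> 4, 'a) mpoly set)"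
      "entry i b * entry j a - entry i a * entry j b \<in> (minors2 :: (4 \<times> 4, 'a) mpoly set)"
      unfolding minors2_def by blast+
    moreover have "det (submatrix generic_mat I J) \<in>
        {entry i a * entry j b - entry i b * entry j a,
         entry i b * entry j a - entry i a * entry j b :: (4 \<times> 4, 'a) mpoly}"
      unfolding 1(2) 2(2) by (rule det_submatrix_2[OF 1(1) 2(1)])
    ultimately have "det (submatrix generic_mat I J) \<in> (minors2 :: (4 \<times> 4, 'a) mpoly set)" by auto
    then show ?thesis using ideal_gen_superset by blast
  qed
  then show "determinantal_ideal 2 \<subseteq> (ideal_gen minors2 :: (4 \<times> 4, 'a) mpoly set)"
    unfolding determinantal_ideal_def ideal_gen_subset_iff[OF M] by blast
  let ?D = "determinantal_ideal 2 :: (4 \<times> 4, 'a) mpoly set"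
  have D: "is_ideal ?D" unfolding determinantal_ideal_def by (rule is_ideal_ideal_gen)
  have "entry i a * entry j b - entry i b * entry j a \<in> ?D" for i j a b
  proof (cases "i = j \<or> a = b")
    case True
    then have "entry i a * entry j b - entry i b * entry j a = (0 :: (4 \<times> 4, 'a) mpoly)" by (auto simp: mult.commute)
    then show ?thesis using ideal_0[OF D] by simp
  next
    case False
    then have ne: "i \<noteq> j" "a \<noteq> b" by auto
    have "card (nats {i, j}) = 2" "card (nats {a, b}) = 2" using ne by (simp_all add: card_nats)
    then have "det (submatrix generic_mat (nats {i, j}) (nats {a, b})) \<in> ?D"
      unfolding determinantal_ideal_def using nats_subset
      by (intro subsetD[OF ideal_gen_superset]) blast
    moreover have "det (submatrix generic_mat (nats {i, j}) (nats {a, b})) \<in>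
        {entry i a * entry j b - entry i b * entry j a,
         entry i b * entry j a - entry i a * entry j b :: (4 \<times> 4, 'a) mpoly}"
      by (rule det_submatrix_2[OF ne])
    ultimately show ?thesis using ideal_uminus[OF D, of "entry i b * entry j a - entry i a * entry j b"]
      by auto
  qed
  then show "ideal_gen minors2 \<subseteq> ?D" unfolding ideal_gen_subset_iff[OF D] minors2_def by blast
qed

section \<open>Primality of the listed ideals\<close>

lemma notin_ideal_gen:
  assumes "comm_ring_hom h" "\<And>g. g \<in> G \<Longrightarrow> h g = 0" "h f \<noteq> 0"
  shows "f \<notin> ideal_gen G"
proof -
  have "ideal_gen G \<subseteq> {f. h f = 0}"
    using assms(2) by (subst ideal_gen_subset_iff[OF is_ideal_kernel[OF assms(1)]]) blast
  then show ?thesis using assms(3) by blast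
qed

text \<open>Evaluation at a 0/1 point, which certifies that a polynomial is not in an ideal: its
  generators vanish at the point and the polynomial does not.\<close>

definition at_ones :: "'v set \<Rightarrow> ('v::finite, 'k::comm_ring_1) mpoly \<Rightarrow> 'k" where
  "at_ones U = mpoly_eval (\<lambda>c. c) (\<lambda>v. if v \<in> U then 1 else 0)"

lemma comm_ring_hom_ident: "comm_ring_hom (\<lambda>c::'k::comm_ring_1. c)"
  by unfold_locales simp_all

interpretation at_ones: comm_ring_hom "at_ones U"
  unfolding at_ones_def by (intro comm_ring_hom_mpoly_eval comm_ring_hom_ident)

lemma comm_ring_hom_at_ones: "comm_ring_hom (at_ones U)" ..

lemma at_ones_Var: "at_ones U (Var v) = (if v \<in> U then 1 else 0)"
  unfolding at_ones_def by (rule mpoly_eval_Var[OF comm_ring_hom_ident])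

lemmas at_ones_simps = at_ones_Var at_ones.hom_add at_ones.hom_mult

text \<open>The binomial is linear in \<open>Var p\<close> with coefficient \<open>Var q\<close>, so
  the criterion only involves ideals generated by indeterminates.\<close>

lemma prime_ideal_Vars_perm2:
  fixes S :: "'v::{finite,linorder} set"
  assumes dist: "distinct [p, q, r, s]" and S: "S \<inter> {p, q, r, s} = {}"
  shows "prime_ideal (ideal_gen (insert (Var p * Var q + Var r * Var s) (Var ` S)) :: ('v, 'k::idom) mpoly set)"
proof (rule prime_ideal_insert_linear)
  let ?I = "ideal_gen (insert (Var q) (Var ` S)) :: ('v, 'k) mpoly set"
  have I: "?I = ideal_gen (Var ` insert q S)" by simp
  show prime: "prime_ideal ?I" unfolding I by (rule prime_ideal_Vars)
  have "Var r \<notin> ?I" "Var s \<notin> ?I" unfolding I Var_in_ideal_Vars_iff using dist S by auto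
  then show "Var r * Var s \<notin> ?I" using prime_ideal_mult_iff[OF prime] by blast
  show "Var q \<notin> (ideal_gen (Var ` S) :: ('v, 'k) mpoly set)"
    unfolding Var_in_ideal_Vars_iff using S by auto
  show "free_of p g" if "g \<in> Var ` S" for g :: "('v, 'k) mpoly"
    using that S by (auto intro: free_of_Var)
  show "free_of p (Var q :: ('v, 'k) mpoly)" "free_of p (Var r * Var s :: ('v, 'k) mpoly)"
    using dist by (auto intro!: free_of_Var free_of_mult)
qed (rule prime_ideal_Vars)

lemma Var_notin_Vars_perm2:
  fixes S :: "'v::{finite,linorder} set"
  assumes "distinct [p, q, r, s]" "v \<notin> S" "v \<notin> {p, q, r, s}"
  shows "Var v \<notin> (ideal_gen (insert (Var p * Var q + Var r * Var s) (Var ` S)) :: ('v, 'k::idom) mpoly set)"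
  by (rule notin_ideal_gen[OF comm_ring_hom_at_ones[of "{v}"]])
    (use assms in \<open>auto simp: at_ones_simps\<close>)

text \<open>The second binomial is linear in \<open>Var p'\<close>. Its coefficient
  \<open>Var q'\<close> simply joins the set \<open>S\<close>, which reduces every condition to a
  single binomial.\<close>

lemma prime_ideal_Vars_two_perm2:
  fixes S :: "'v::{finite,linorder} set"
  assumes dist: "distinct [p, q, r, s, p', q', r', s']" and S: "S \<inter> {p, q, r, s, p', q', r', s'} = {}"
  shows "prime_ideal (ideal_gen (insert (Var p' * Var q' + Var r' * Var s')
    (insert (Var p * Var q + Var r * Var s) (Var ` S))) :: ('v, 'k::idom) mpoly set)"
proof (rule prime_ideal_insert_linear)
  let ?h = "Var p * Var q + Var r * Var s :: ('v, 'k) mpoly"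
  have d: "distinct [p, q, r, s]" using dist by simp
  show "prime_ideal (ideal_gen (insert ?h (Var ` S)))"
    by (rule prime_ideal_Vars_perm2[OF d]) (use S in auto)
  show "Var q' \<notin> ideal_gen (insert ?h (Var ` S))"
    by (rule Var_notin_Vars_perm2[OF d]) (use dist S in auto)
  have I: "insert (Var q') (insert ?h (Var ` S)) = insert ?h (Var ` insert q' S)" by auto
  show prime: "prime_ideal (ideal_gen (insert (Var q') (insert ?h (Var ` S))))"
    unfolding I by (rule prime_ideal_Vars_perm2[OF d]) (use dist S in auto)
  have "Var v \<notin> ideal_gen (insert (Var q') (insert ?h (Var ` S)))" if "v \<in> {r', s'}" for v
    unfolding I by (rule Var_notin_Vars_perm2[OF d]) (use that dist S in auto)
  then show "Var r' * Var s' \<notin> ideal_gen (insert (Var q') (insert ?h (Var ` S)))"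
    using prime_ideal_mult_iff[OF prime] by blast
  show "free_of p' g" if "g \<in> insert ?h (Var ` S)" for g
    using that S dist by (auto intro!: free_of_Var free_of_mult free_of_add)
  show "free_of p' (Var q' :: ('v, 'k) mpoly)" "free_of p' (Var r' * Var s' :: ('v, 'k) mpoly)"
    using dist by (auto intro!: free_of_Var free_of_mult)
qed

lemma prime_ideal_Vars_perm3:
  fixes S :: "('r::{finite,linorder} \<times> 'c::{finite,linorder}) set"
  defines "m \<equiv> (\<lambda>i a. Var (i, a) :: ('r \<times> 'c, 'k::idom) mpoly)"
  assumes d: "distinct [i, j, k]" "distinct [a, b, c]" and S: "S \<inter> {i, j, k} \<times> {a, b, c} = {}"
  shows "prime_ideal (ideal_gen (insert (perm3 m i j k a b c) (Var ` S)))"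
proof -
  let ?A = "perm2 m j k b c" and ?B = "m i b * perm2 m j k a c + m i c * perm2 m j k a b"
  have A: "?A = Var (j, b) * Var (k, c) + Var (j, c) * Var (k, b)" by (simp add: m_def perm2_def)
  have "prime_ideal (ideal_gen (insert (Var (i, a) * ?A + ?B) (Var ` S)))"
  proof (rule prime_ideal_insert_linear)
    show "prime_ideal (ideal_gen (insert ?A (Var ` S)))"
      unfolding A by (rule prime_ideal_Vars_perm2) (use d S in auto)
    show "?A \<notin> ideal_gen (Var ` S)"
      by (rule notin_ideal_gen[OF comm_ring_hom_at_ones[of "{(j, b), (k, c)}"]])
        (use d S in \<open>auto simp: A at_ones_simps\<close>)
    \<comment> \<open>At the chosen point both products of \<open>?A\<close> vanish, while exactly
      one product of \<open>?B\<close>, that of the three marked entries, is 1.\<close>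
    show "?B \<notin> ideal_gen (insert ?A (Var ` S))"
      by (rule notin_ideal_gen[OF comm_ring_hom_at_ones[of "{(i, b), (j, a), (k, c)}"]])
        (use d S in \<open>auto simp: m_def perm2_def at_ones_simps\<close>)
    show "free_of (i, a) g" if "g \<in> Var ` S" for g :: "('r \<times> 'c, 'k) mpoly"
      using that S by (auto intro!: free_of_Var)
    show "free_of (i, a) ?A" "free_of (i, a) ?B"
      using d by (auto simp: m_def perm2_def intro!: free_of_Var free_of_mult free_of_add)
  qed (rule prime_ideal_Vars)
  then show ?thesis by (simp add: perm3_def m_def add.assoc)
qed

lemma perm3_in_ideal_perm2:
  assumes P: "is_ideal P" and d: "distinct [i, j, k]" "distinct [a, b, c]"
    and xy: "x \<noteq> y" "x \<in> {i, j, k}" "y \<in> {i, j, k}"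
    and p: "\<And>u v. u \<noteq> v \<Longrightarrow> perm2 m x y u v \<in> P"
  shows "perm3 m i j k a b c \<in> P"
proof -
  obtain z where z: "z \<in> {i, j, k}" "distinct [z, x, y]" using d(1) xy by auto
  have "perm3 m z x y a b c \<in> P"
    unfolding perm3_def using p d(2) by (auto intro!: ideal_add[OF P] ideal_mult[OF P])
  then show ?thesis using perm3_perm_rows[of z i j k x y m a b c] xy z by simp
qed

lemma perm3_in_ideal_zero_row:
  assumes P: "is_ideal P" and x: "x \<in> {i, j, k}" and z: "\<And>y. y \<in> {a, b, c} \<Longrightarrow> m x y \<in> P"
  shows "perm3 m i j k a b c \<in> P"
proof -
  have "perm2 m x u v w \<in> P" "perm2 m u x v w \<in> P" if "v \<in> {a, b, c}" "w \<in> {a, b, c}" for u v w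
    unfolding perm2_def using z that by (intro ideal_add[OF P]; simp add: ideal_mult[OF P] ideal_mult_right[OF P])+
  then show ?thesis
    unfolding perm3_def using x z
    by (elim insertE emptyE) (auto intro!: ideal_add[OF P] intro: ideal_mult[OF P] ideal_mult_right[OF P])
qed

section \<open>Recognising the type of a minimal prime from its elements\<close>

lemma minimal_primes_eq:
  assumes "P \<in> minimal_primes I" "prime_ideal Q" "I \<subseteq> Q" "Q \<subseteq> P"
  shows "P = Q"
  using assms by (auto simp: minimal_primes_def)

lemma generic_mat_image_nats: "($$) generic_mat ` (nats A \<times> nats B) = Var ` (A \<times> B)"
  using nats_subset[of A] nats_subset[of B]
  by (subst generic_mat_image) (auto simp: map_prod_of_nat_nats)

lemma generic_mat_image_Compl:
  "($$) generic_mat ` ({..<4} \<times> {..<4} - (nats A \<times> nats B \<union> nats A' \<times> nats B')) =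
    Var ` (UNIV - (A \<times> B \<union> A' \<times> B'))"
proof -
  have "({..<4} \<times> {..<4} :: (nat \<times> nat) set) = nats UNIV \<times> nats UNIV" by (simp add: nats_UNIV)
  then have U: "map_prod of_nat of_nat ` ({..<4} \<times> {..<4}) = (UNIV :: (4 \<times> 4) set)"
    by (simp only: map_prod_of_nat_nats UNIV_Times_UNIV)
  have "nats A \<times> nats B \<union> nats A' \<times> nats B' \<subseteq> {..<4} \<times> {..<4}"
    using nats_subset by blast
  then have "map_prod of_nat of_nat ` ({..<4} \<times> {..<4} - (nats A \<times> nats B \<union> nats A' \<times> nats B')) =
      UNIV - (A \<times> B \<union> A' \<times> B')"
    by (subst map_prod_of_nat_diff) (simp_all only: U image_Un map_prod_of_nat_nats subset_refl)
  then show ?thesis by (subst generic_mat_image) (simp_all only: Diff_subset)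
qed

lemma perm2_in_ideal_zero_col:
  assumes "is_ideal P" "w \<in> {u, v}" "m i w \<in> P" "m j w \<in> P"
  shows "perm2 m i j u v \<in> P"
  using assms(2-) unfolding perm2_def
  by (elim insertE emptyE) (simp_all add: ideal_add[OF assms(1)] ideal_mult[OF assms(1)] ideal_mult_right[OF assms(1)])

lemma card_four:
  fixes C :: "4 set"
  assumes "distinct [u, v, w, z]"
  shows "card C = of_bool (u \<in> C) + of_bool (v \<in> C) + of_bool (w \<in> C) + of_bool (z \<in> C)"
proof -
  have U: "{u, v, w, z} = UNIV" using four_cases[OF assms] by blast
  have "card C = (\<Sum>x\<in>{u, v, w, z}. of_bool (x \<in> C))" unfolding U by simp
  also have "\<dots> = of_bool (u \<in> C) + of_bool (v \<in> C) + of_bool (w \<in> C) + of_bool (z \<in> C)"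
    using assms by (simp del: sum_of_bool_eq)
  finally show ?thesis .
qed

text \<open>Only two indices in total are missing from \<open>A\<close> and \<open>B\<close>, and
  each of them spoils at most one of the three positions.\<close>

lemma pigeonhole_6:
  fixes A B :: "4 set"
  assumes "card A + card B = 6" "distinct [i, j, k]" "distinct [a, b, c]"
  shows "i \<in> A \<and> a \<in> B \<or> j \<in> A \<and> b \<in> B \<or> k \<in> A \<and> c \<in> B"
proof -
  obtain l where l: "distinct [i, j, k, l]" by (rule distinct_extend1[OF assms(2)])
  obtain d where d: "distinct [a, b, c, d]" by (rule distinct_extend1[OF assms(3)])
  show ?thesis
    using assms(1) unfolding card_four[OF l, of A] card_four[OF d, of B]
    by (auto simp: of_bool_def split: if_splits)
qed

context
  fixes P :: "(4 \<times> 4, 'k::idom) mpoly set"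
  assumes min: "P \<in> minimal_primes (permanental_ideal 3)"
begin

lemma min_prime: "prime_ideal P"
  and min_ideal: "is_ideal P"
  and min_perm3: "distinct [i, j, k] \<Longrightarrow> distinct [a, b, c] \<Longrightarrow> perm3 entry i j k a b c \<in> P"
proof -
  show "prime_ideal P" using min by (simp add: minimal_primes_def)
  then show I: "is_ideal P" by (rule prime_ideal_ideal)
  show "distinct [i, j, k] \<Longrightarrow> distinct [a, b, c] \<Longrightarrow> perm3 entry i j k a b c \<in> P"
    using min permanental_ideal_3_subset_iff[OF I] by (simp add: minimal_primes_def)
qed

text \<open>Minimality turns the containment of the generators in \<open>P\<close> into an equality;
  this is what primality of the listed ideals is for.\<close>

lemma min_eq_ideal_gen:
  assumes "prime_ideal (ideal_gen G)" "G \<subseteq> P"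
    and "\<And>i j k a b c. distinct [i, j, k] \<Longrightarrow> distinct [a, b, c] \<Longrightarrow> perm3 entry i j k a b c \<in> ideal_gen G"
  shows "P = ideal_gen G"
proof (rule minimal_primes_eq[OF min assms(1)])
  show "permanental_ideal 3 \<subseteq> ideal_gen G"
    using assms(3) permanental_ideal_3_subset_iff[OF is_ideal_ideal_gen] by blast
  show "ideal_gen G \<subseteq> P" using assms(2) ideal_gen_subset_iff[OF min_ideal] by blast
qed

text \<open>By \<open>pigeonhole_6\<close> every single term of a 3 x 3 permanent has a factor in
  the zero block.\<close>

lemma is_type_1I:
  assumes c: "card A + card B = 6" and z: "\<And>i a. i \<in> A \<Longrightarrow> a \<in> B \<Longrightarrow> entry i a \<in> P"
  shows "is_type_1 P"
proof -
  let ?T = "ideal_gen (Var ` (A \<times> B)) :: (4 \<times> 4, 'k) mpoly set"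
  have T: "is_ideal ?T" by (rule is_ideal_ideal_gen)
  have "P = ?T"
  proof (rule min_eq_ideal_gen[OF prime_ideal_Vars])
    fix i j k a b c :: 4 assume d: "distinct [i, j, k]" "distinct [a, b, c]"
    have in_T: "entry i a \<in> ?T" if "i \<in> A" "a \<in> B" for i a
      unfolding Var_in_ideal_Vars_iff using that by simp
    have summand: "entry i a * (entry j b * entry k c) \<in> ?T"
      if "distinct [i, j, k]" "distinct [a, b, c]" for i j k a b c
      using pigeonhole_6[OF c that] in_T
      by (auto intro: ideal_mult[OF T] ideal_mult_right[OF T])
    show "perm3 entry i j k a b c \<in> ?T"
      unfolding perm3_def perm2_def distrib_left using d
      by (intro ideal_add[OF T] summand) auto
  qed (use z in auto)
  then have "P = ideal_gen (($$) generic_mat ` (nats A \<times> nats B))"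
    by (simp only: generic_mat_image_nats)
  moreover have "card (nats A) + card (nats B) = 6" using c by (simp add: card_nats)
  ultimately show ?thesis unfolding is_type_1_def using nats_subset by blast
qed

text \<open>Every 3 x 3 submatrix meets the zero row or the zero column, except for the one whose
  permanent is adjoined as a generator.\<close>

lemma is_type_3I:
  assumes row: "\<And>a. entry r a \<in> P" and col: "\<And>i. entry i s \<in> P"
  shows "is_type_3 P"
proof -
  obtain i j k where r: "distinct [r, i, j, k]" by (rule distinct_extend3)
  obtain a b c where s: "distinct [s, a, b, c]" by (rule distinct_extend3)
  have ri: "distinct [i, j, k]" and sa: "distinct [a, b, c]" using r s by auto
  have rows: "x \<in> {i, j, k} \<longleftrightarrow> x \<noteq> r" for x using r four_cases[OF r, of x] by auto
  have cols: "x \<in> {a, b, c} \<longleftrightarrow> x \<noteq> s" for x using s four_cases[OF s, of x] by auto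
  let ?S = "UNIV - {i, j, k} \<times> {a, b, c}"
  let ?T = "ideal_gen (insert (perm3 entry i j k a b c) (Var ` ?S)) :: (4 \<times> 4, 'k) mpoly set"
  have T: "is_ideal ?T" by (rule is_ideal_ideal_gen)
  have inT: "insert (perm3 entry i j k a b c) (Var ` ?S) \<subseteq> ?T" by (rule ideal_gen_superset)
  have "P = ?T"
  proof (rule min_eq_ideal_gen)
    show "prime_ideal ?T" by (rule prime_ideal_Vars_perm3) (use ri sa in auto)
    have "entry x y \<in> P" if "(x, y) \<in> ?S" for x y
    proof -
      have "x = r \<or> y = s" using that rows[of x] cols[of y] by blast
      then show ?thesis using row col by blast
    qed
    then have "Var v \<in> P" if "v \<in> ?S" for v using that by (cases v) blast
    then show "insert (perm3 entry i j k a b c) (Var ` ?S) \<subseteq> P"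
      using min_perm3[OF ri sa] by blast
    fix i' j' k' a' b' c' :: 4 assume d: "distinct [i', j', k']" "distinct [a', b', c']"
    have zr: "entry r u \<in> ?T" and zs: "entry u s \<in> ?T" for u
      using inT rows[of r] cols[of s] by blast+
    show "perm3 entry i' j' k' a' b' c' \<in> ?T"
    proof (cases "r \<in> {i', j', k'} \<or> s \<in> {a', b', c'}")
      case True
      then show ?thesis
      proof
        assume "r \<in> {i', j', k'}"
        then show ?thesis using zr by (rule perm3_in_ideal_zero_row[OF T])
      next
        assume "s \<in> {a', b', c'}"
        then have "perm3 (\<lambda>a i. entry i a) a' b' c' i' j' k' \<in> ?T"
          using zs by (rule perm3_in_ideal_zero_row[OF T])
        then show ?thesis by (simp only: perm3_transpose[of entry])
      qed
    next
      case False
      then have "i' \<in> {i, j, k}" "j' \<in> {i, j, k}" "k' \<in> {i, j, k}"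
        "a' \<in> {a, b, c}" "b' \<in> {a, b, c}" "c' \<in> {a, b, c}" unfolding rows cols by blast+
      then have "perm3 entry i' j' k' a' b' c' = (perm3 entry i j k a b c :: (4 \<times> 4, 'k) mpoly)"
        using d by (intro perm3_perm)
      then show ?thesis using inT by auto
    qed
  qed
  then have "P = ideal_gen ({permanent (submatrix generic_mat (nats {i, j, k}) (nats {a, b, c}))} \<union>
      ($$) generic_mat ` ({..<4} \<times> {..<4} - nats {i, j, k} \<times> nats {a, b, c}))"
    by (simp only: permanent_submatrix_3[OF ri sa] insert_is_Un[symmetric]
        generic_mat_image_Compl[of "{i, j, k}" "{a, b, c}" "{}" "{}",
          unfolded nats_empty Sigma_empty1 Un_empty_right])
  moreover have "card (nats {i, j, k}) = 3" "card (nats {a, b, c}) = 3"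
    using ri sa by (simp_all add: card_nats)
  ultimately show ?thesis
    unfolding is_type_3_def using nats_subset
    by (intro exI[of _ "nats {i, j, k}"] exI[of _ "nats {a, b, c}"] conjI)
qed

text \<open>Three of the four rows always include \<open>i\<close>, \<open>j\<close> or
  \<open>k\<close>, \<open>l\<close>. Expanding along the third row leaves 2 x 2 permanents of that
  pair, each of which is a generator up to order or has a column of zeros.\<close>

lemma is_type_22I:
  assumes "blocks22_in P entry"
  shows "is_type_22 P"
proof -
  obtain i j k l a b c d where r: "distinct [i, j, k, l]" and s: "distinct [a, b, c, d]"
    and p: "perm2 entry i j a b \<in> P" "perm2 entry k l c d \<in> P"
    and z: "\<forall>x\<in>{i, j}. \<forall>y\<in>{c, d}. entry x y \<in> P" "\<forall>x\<in>{k, l}. \<forall>y\<in>{a, b}. entry x y \<in> P"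
    using assms unfolding blocks22_in_def by blast
  have ri: "i \<noteq> j" "k \<noteq> l" and sa: "a \<noteq> b" "c \<noteq> d" using r s by auto
  have rows: "x \<in> {k, l} \<longleftrightarrow> x \<notin> {i, j}" for x using r four_cases[OF r, of x] by auto
  have cols: "x \<in> {c, d} \<longleftrightarrow> x \<notin> {a, b}" for x using s four_cases[OF s, of x] by auto
  let ?S = "UNIV - ({i, j} \<times> {a, b} \<union> {k, l} \<times> {c, d})"
  let ?G = "insert (perm2 entry k l c d) (insert (perm2 entry i j a b) (Var ` ?S)) :: (4 \<times> 4, 'k) mpoly set"
  let ?T = "ideal_gen ?G"
  have T: "is_ideal ?T" by (rule is_ideal_ideal_gen)
  have inT: "?G \<subseteq> ?T" by (rule ideal_gen_superset)
  have zT: "entry x y \<in> ?T" if "(x, y) \<in> ?S" for x y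
    using inT that by blast
  have pairs: "perm2 entry i j u v \<in> ?T" "perm2 entry k l u v \<in> ?T" if uv: "u \<noteq> v" for u v
  proof -
    show "perm2 entry i j u v \<in> ?T"
    proof (cases "u \<in> {a, b} \<and> v \<in> {a, b}")
      case True
      then have "perm2 entry i j u v = (perm2 entry i j a b :: (4 \<times> 4, 'k) mpoly)"
        using uv ri by (intro perm2_perm) auto
      then show ?thesis using inT by auto
    next
      case False
      then obtain w where w: "w \<in> {u, v}" "w \<in> {c, d}" using cols by blast
      then have "(i, w) \<in> ?S" "(j, w) \<in> ?S" using rows cols by auto
      then have "entry i w \<in> ?T" "entry j w \<in> ?T" using zT by blast+
      then show ?thesis by (rule perm2_in_ideal_zero_col[OF T w(1)])
    qed
    show "perm2 entry k l u v \<in> ?T"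
    proof (cases "u \<in> {c, d} \<and> v \<in> {c, d}")
      case True
      then have "perm2 entry k l u v = (perm2 entry k l c d :: (4 \<times> 4, 'k) mpoly)"
        using uv ri by (intro perm2_perm) auto
      then show ?thesis using inT by auto
    next
      case False
      then obtain w where w: "w \<in> {u, v}" "w \<in> {a, b}" using cols by blast
      then have "(k, w) \<in> ?S" "(l, w) \<in> ?S" using rows cols by auto
      then have "entry k w \<in> ?T" "entry l w \<in> ?T" using zT by blast+
      then show ?thesis by (rule perm2_in_ideal_zero_col[OF T w(1)])
    qed
  qed
  have "P = ?T"
  proof (rule min_eq_ideal_gen)
    show "prime_ideal ?T"
      unfolding perm2_def by (rule prime_ideal_Vars_two_perm2) (use r s in auto)
    have "entry x y \<in> P" if "(x, y) \<in> ?S" for x y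
    proof (cases "x \<in> {i, j}")
      case True
      then show ?thesis using that z(1) cols[of y] by blast
    next
      case False
      then show ?thesis using that z(2) cols[of y] rows[of x] by blast
    qed
    then have "Var v \<in> P" if "v \<in> ?S" for v using that by (cases v) blast
    then show "?G \<subseteq> P" using p by blast
    fix i' j' k' a' b' c' :: 4 assume d: "distinct [i', j', k']" "distinct [a', b', c']"
    obtain l' where l': "distinct [i', j', k', l']" by (rule distinct_extend1[OF d(1)])
    have "x \<in> {i', j', k'} \<longleftrightarrow> x \<noteq> l'" for x using l' four_cases[OF l', of x] by auto
    then have "i \<in> {i', j', k'} \<and> j \<in> {i', j', k'} \<or> k \<in> {i', j', k'} \<and> l \<in> {i', j', k'}"
      using r by auto
    then show "perm3 entry i' j' k' a' b' c' \<in> ?T"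
      using perm3_in_ideal_perm2[OF T d, of i j entry] perm3_in_ideal_perm2[OF T d, of k l entry]
        ri pairs by blast
  qed
  also have "?G = insert (perm2 entry i j a b) (insert (perm2 entry k l c d) (Var ` ?S))"
    by (rule insert_commute)
  finally have P: "P = ideal_gen ({permanent (submatrix generic_mat (nats {i, j}) (nats {a, b})),
        permanent (submatrix generic_mat (nats {k, l}) (nats {c, d}))} \<union>
      ($$) generic_mat ` ({..<4} \<times> {..<4} - (nats {i, j} \<times> nats {a, b} \<union> nats {k, l} \<times> nats {c, d})))"
    by (simp only: permanent_submatrix_2 ri sa generic_mat_image_Compl Un_insert_left Un_empty_left
        not_False_eq_True simp_thms)
  have "{i, j} \<inter> {k, l} = {}" "{a, b} \<inter> {c, d} = {}" using r s by auto
  then have "nats {i, j} \<inter> nats {k, l} = {}" "nats {a, b} \<inter> nats {c, d} = {}"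
    by (simp_all only: nats_Int nats_empty)
  moreover have "card (nats {i, j}) = 2" "card (nats {k, l}) = 2" "card (nats {a, b}) = 2" "card (nats {c, d}) = 2"
    using ri sa by (simp_all add: card_nats)
  ultimately show ?thesis
    unfolding is_type_22_def using P nats_subset
    by (intro exI[of _ "nats {i, j}"] exI[of _ "nats {a, b}"] exI[of _ "nats {k, l}"]
        exI[of _ "nats {c, d}"] conjI)
qed

end

section \<open>The ideal of type (3A)\<close>

lemma partial_superset:
  assumes "finite A" "Poly_Mapping.keys f \<subseteq> A"
  shows "partial v f = (\<Sum>m\<in>A. Poly_Mapping.single (m - Poly_Mapping.single v 1)
    (of_nat (Poly_Mapping.lookup m v) * Poly_Mapping.lookup f m))"
  unfolding partial_def by (rule sum.mono_neutral_left) (use assms in \<open>auto simp: in_keys_iff\<close>)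

lemma partial_single:
  "partial v (Poly_Mapping.single m c) =
    Poly_Mapping.single (m - Poly_Mapping.single v 1) (of_nat (Poly_Mapping.lookup m v) * c)"
  using partial_superset[of "{m}" "Poly_Mapping.single m c" v] by simp

lemma partial_add: "partial v (f + g) = partial v f + partial v g"
proof -
  let ?A = "Poly_Mapping.keys f \<union> Poly_Mapping.keys g"
  have "partial v h = (\<Sum>m\<in>?A. Poly_Mapping.single (m - Poly_Mapping.single v 1)
      (of_nat (Poly_Mapping.lookup m v) * Poly_Mapping.lookup h m))" if "h \<in> {f, g, f + g}" for h
    using that keys_add[of f g] by (intro partial_superset) auto
  then show ?thesis by (simp add: lookup_add distrib_left single_add sum.distrib)
qed

lemma partial_mult_single:
  "partial v (Poly_Mapping.single m c * Poly_Mapping.single n d) =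
    partial v (Poly_Mapping.single m c) * Poly_Mapping.single n d +
    Poly_Mapping.single m c * partial v (Poly_Mapping.single n d)"
proof -
  let ?s = "Poly_Mapping.single v (1::nat)"
  \<comment> \<open>Subtraction of exponents is truncated at 0, but in the truncated case the
    coefficient is 0 as well.\<close>
  have drop: "Poly_Mapping.single (p - ?s + q) (of_nat (Poly_Mapping.lookup p v) * e) =
      Poly_Mapping.single (p + q - ?s) (of_nat (Poly_Mapping.lookup p v) * e)" for p q and e :: 'b
  proof (cases "Poly_Mapping.lookup p v = 0")
    case False
    then have "p - ?s + q = p + q - ?s"
      by (intro poly_mapping_eqI) (auto simp: lookup_add lookup_minus lookup_single when_def)
    then show ?thesis by simp
  qed simp
  show ?thesis
    using drop[of m n "c * d"] drop[of n m "c * d"]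
    by (simp add: mult_single partial_single lookup_add algebra_simps single_add)
qed

lemma partial_mult: "partial v (f * g) = partial v f * g + f * partial v g"
proof (induction f rule: poly_mapping_additive_induct)
  case (single m c)
  show ?case
    by (induction g rule: poly_mapping_additive_induct)
      (simp_all add: partial_mult_single distrib_left partial_add)
qed (simp add: distrib_right partial_add)

lemma partial_Var: "partial v (Var w) = (if w = v then 1 else 0)"
  by (simp add: Var_def partial_single lookup_single when_def)

text \<open>Cramer's rule modulo an ideal: multiplying \<open>A *\<^sub>v v\<close> by the adjugate
  gives the multiple of \<open>v\<close> by the determinant.\<close>

lemma ideal_det_mult_kernel:
  fixes A :: "'a::comm_ring_1 mat" and v :: "'a vec"
  assumes P: "is_ideal P" and A: "A \<in> carrier_mat n n" and v: "v \<in> carrier_vec n"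
    and Av: "\<And>i. i < n \<Longrightarrow> (A *\<^sub>v v) $ i \<in> P" and i: "i < n"
  shows "det A * v $ i \<in> P"
proof -
  have adj: "adj_mat A \<in> carrier_mat n n" "adj_mat A * A = det A \<cdot>\<^sub>m 1\<^sub>m n" using adj_mat[OF A] by auto
  have "adj_mat A *\<^sub>v (A *\<^sub>v v) = (adj_mat A * A) *\<^sub>v v"
    by (rule assoc_mult_mat_vec[symmetric, OF adj(1) A v])
  also have "\<dots> = det A \<cdot>\<^sub>v v" unfolding adj(2) using v by (intro eq_vecI) auto
  finally have "det A * v $ i = (adj_mat A *\<^sub>v (A *\<^sub>v v)) $ i" using i v by simp
  also have "\<dots> = (\<Sum>k = 0..<n. adj_mat A $$ (i, k) * (A *\<^sub>v v) $ k)"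
    using i A adj(1) by (auto simp: scalar_prod_def intro!: sum.cong)
  also have "\<dots> \<in> P"
    using Av by (intro ideal_sum[OF P] ideal_mult[OF P]) auto
  finally show ?thesis .
qed

lemma pick_less_distinct:
  assumes "r < card I" "s < card I" "r \<noteq> s"
  shows "pick I r \<noteq> pick I s"
  using assms pick_mono[of r I s] pick_mono[of s I r] by (cases "r < s") auto

lemma lessThan_4_extend2:
  fixes p q :: nat
  assumes "p < 4" "q < 4" "p \<noteq> q"
  obtains b c where "distinct [p, q, b, c]" "{p, q, b, c} = {..<4}"
proof -
  have "card ({..<4} - {p, q}) = 2" using assms by simp
  then obtain b c where "{..<4} - {p, q} = {b, c}" "b \<noteq> c" unfolding card_2_iff by auto
  then have "distinct [p, q, b, c]" "{p, q, b, c} = {..<4}" using assms by auto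
  then show ?thesis by (rule that)
qed

lemma perm3_expand_col:
  "perm3 m i j k a b c = perm2 m j k b c * m i a + perm2 m i k b c * m j a + perm2 m i j b c * m k a"
  by (simp add: perm3_def perm2_def algebra_simps)

lemma sum_three: "(\<Sum>m\<in>{0..<3::nat}. f m) = f 0 + f 1 + f 2"
  by (simp add: eval_nat_numeral)

section \<open>Membership of the generators of \<open>J3\<close> in a prime\<close>

context
  fixes V :: "'v::finite mat" and P :: "('v, 'k::idom) mpoly set"
  assumes V: "V \<in> carrier_mat 3 4"
    and inj: "\<And>r p r' p'. r < 3 \<Longrightarrow> p < 4 \<Longrightarrow> r' < 3 \<Longrightarrow> p' < 4 \<Longrightarrow>
      V $$ (r, p) = V $$ (r', p') \<Longrightarrow> r = r' \<and> p = p'"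
begin

abbreviation y :: "nat \<Rightarrow> nat \<Rightarrow> ('v, 'k) mpoly" where
  "y r p \<equiv> Var (V $$ (r, p))"

lemma J3_P_eq:
  assumes r: "distinct [i, j, k]" "{i, j, k} = {..<3}"
    and c: "distinct [a, b, c, q]" "{a, b, c, q} = {..<4}"
  shows "J3_P V q = perm3 y i j k a b c"
proof -
  let ?C = "{..<4} - {q}"
  have C: "?C = {a, b, c}" using c by auto
  have dims: "card {i. i < 3 \<and> i \<in> {..<3::nat}} = 3" "card {j. j < 4 \<and> j \<in> ?C} = 3"
  proof -
    have "{i. i < 3 \<and> i \<in> {..<3::nat}} = {..<3}" "{j. j < 4 \<and> j \<in> ?C} = ?C" by auto
    then show "card {i. i < 3 \<and> i \<in> {..<3::nat}} = 3" "card {j. j < 4 \<and> j \<in> ?C} = 3"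
      unfolding C using c by simp_all
  qed
  have cards: "card {..<3::nat} = 3" "card ?C = 3" unfolding C using c by simp_all
  have rC: "pick {..<3} r \<in> {..<3}" "pick ?C r \<in> ?C" if "r < 3" for r
    using that cards by (auto intro!: pick_in_set simp del: Diff_iff lessThan_iff)
  have index: "submatrix (map_mat Var V) {..<3} ?C $$ (r, s) = y (pick {..<3} r) (pick ?C s)"
    if "r < 3" "s < 3" for r s
  proof -
    have "submatrix (map_mat Var V) {..<3} ?C $$ (r, s) = map_mat Var V $$ (pick {..<3} r, pick ?C s)"
      using that V dims by (intro submatrix_index) auto
    also have "\<dots> = y (pick {..<3} r) (pick ?C s)"
      using rC(1)[OF that(1)] rC(2)[OF that(2)] V by (intro index_map_mat) auto
    finally show ?thesis .
  qed
  have "J3_P V q = perm3 y (pick {..<3} 0) (pick {..<3} 1) (pick {..<3} 2) (pick ?C 0) (pick ?C 1) (pick ?C 2)"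
    unfolding J3_P_def using V dims
    by (subst permanent_3) (simp_all add: dim_submatrix perm3_def perm2_def index)
  also have "\<dots> = perm3 y i j k a b c"
  proof (rule perm3_perm)
    show "distinct [pick {..<3} 0, pick {..<3} 1, pick {..<3::nat} 2]"
      "distinct [pick ?C 0, pick ?C 1, pick ?C 2]"
      using cards by (simp_all add: pick_less_distinct)
  qed (use rC r(2) C in \<open>simp_all only: numeral_less_iff, simp_all\<close>)
  finally show ?thesis .
qed

lemma y_eq_iff:
  "r < 3 \<Longrightarrow> p < 4 \<Longrightarrow> r' < 3 \<Longrightarrow> p' < 4 \<Longrightarrow> V $$ (r, p) = V $$ (r', p') \<longleftrightarrow> r = r' \<and> p = p'"
  using inj by blast

text \<open>Since the names are distinct, differentiating the expansion along row \<open>r\<close>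
  affects only the factor \<open>y r p\<close>, whose cofactor remains.\<close>

lemma J3_B_eq:
  assumes r: "distinct [r, j, k]" "{r, j, k} = {..<3}"
    and c: "distinct [p, b, c, q]" "{p, b, c, q} = {..<4}"
  shows "J3_B V r p q = perm2 y j k b c"
proof -
  have lt: "r < 3" "j < 3" "k < 3" "p < 4" "b < 4" "c < 4" using r(2) c(2) by auto
  have one: "partial (V $$ (r, p)) (y r p) = 1" by (simp add: partial_Var)
  have zero: "partial (V $$ (r, p)) (y r' p') = 0" if "r' < 3" "p' < 4" "r' \<noteq> r \<or> p' \<noteq> p" for r' p'
    using y_eq_iff[OF that(1,2) lt(1,4)] that(3) by (auto simp: partial_Var)
  have zeros: "partial (V $$ (r, p)) (y x z) = 0" if "x \<in> {j, k}" "z \<in> {p, b, c}" for x z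
    using that lt r(1) by (intro zero) auto
  have zeros': "partial (V $$ (r, p)) (y r z) = 0" if "z \<in> {b, c}" for z
    using that lt c(1) by (intro zero) auto
  have "partial (V $$ (r, p)) (perm3 y r j k p b c) = perm2 y j k b c"
    unfolding perm3_def perm2_def partial_add partial_mult
    by (simp add: one zeros zeros')
  then show ?thesis unfolding J3_B_def J3_P_eq[OF r c] .
qed

lemma J3_B_diagonal:
  assumes r: "r < 3" and q: "q < 4"
  shows "J3_B V r q q = (0 :: ('v, 'k) mpoly)"
proof -
  have "card ({..<4} - {q}) = 3" using q by simp
  then obtain a b c where C: "{..<4} - {q} = {a, b, c}" "distinct [a, b, c]" unfolding card_3_iff by auto
  then have c: "distinct [a, b, c, q]" "{a, b, c, q} = {..<4}" using q by auto
  have lt: "a < 4" "b < 4" "c < 4" using c(2) by auto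
  have "J3_P V q = perm3 y 0 1 2 a b c" by (rule J3_P_eq[OF _ _ c]) auto
  then show ?thesis using c(1) lt r q
    by (simp add: J3_B_def perm3_def perm2_def partial_add partial_mult partial_Var y_eq_iff)
qed

lemma J3_subset_prime:
  assumes P: "prime_ideal P" and PP: "\<And>q. q < 4 \<Longrightarrow> J3_P V q \<in> P"
    and rows: "\<And>r. r < 3 \<Longrightarrow> \<exists>p<4. y r p \<notin> P" and cols: "\<And>p. p < 4 \<Longrightarrow> \<exists>r<3. y r p \<notin> P"
  shows "J3 V \<subseteq> P"
proof -
  have I: "is_ideal P" using P by (rule prime_ideal_ideal)
  have "J3_g V r \<in> P" if r: "r < 3" for r
  proof -
    let ?A = "mat 4 4 (\<lambda>(p, q). J3_B V r p q)" and ?v = "vec 4 (y r)"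
    have "card ({..<3} - {r}) = 2" using r by simp
    then obtain j k where "{..<3} - {r} = {j, k}" "j \<noteq> k" unfolding card_2_iff by auto
    then have jk: "distinct [r, j, k]" "{r, j, k} = {..<3}" using r by auto
    have Av: "(?A *\<^sub>v ?v) $ p \<in> P" if p: "p < 4" for p
    proof -
      have "card ({..<4} - {p}) = 3" using p by simp
      then obtain a b c where C: "{..<4} - {p} = {a, b, c}" "distinct [a, b, c]" unfolding card_3_iff by auto
      then have c: "distinct [p, a, b, c]" "{p, a, b, c} = {..<4}" using p by auto
      have "(?A *\<^sub>v ?v) $ p = (\<Sum>q\<in>{..<4}. J3_B V r p q * y r q)"
        using p by (simp add: scalar_prod_def lessThan_atLeast0)
      also have "\<dots> = (\<Sum>q\<in>{p, a, b, c}. J3_B V r p q * y r q)" unfolding c(2) ..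
      also have "\<dots> = J3_B V r p a * y r a + J3_B V r p b * y r b + J3_B V r p c * y r c"
        using c(1) J3_B_diagonal[OF r p] by simp
      also have "J3_B V r p a = perm2 y j k b c" by (rule J3_B_eq[OF jk]) (use c in auto)
      also have "J3_B V r p b = perm2 y j k a c" by (rule J3_B_eq[OF jk]) (use c in auto)
      also have "J3_B V r p c = perm2 y j k a b" by (rule J3_B_eq[OF jk]) (use c in auto)
      \<comment> \<open>The expansion along row \<open>r\<close> of the permanent that omits column
        \<open>p\<close>; the vanishing diagonal entry is exactly the omitted column.\<close>
      also have "perm2 y j k b c * y r a + perm2 y j k a c * y r b + perm2 y j k a b * y r c =
          perm3 y r j k a b c" by (simp add: perm3_def mult.commute)
      also have "\<dots> = J3_P V p" by (rule J3_P_eq[OF jk, symmetric]) (use c in auto)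
      finally show ?thesis using PP[OF p] by simp
    qed
    obtain p where p: "p < 4" "y r p \<notin> P" using rows[OF r] by blast
    have "det ?A * ?v $ p \<in> P"
      by (rule ideal_det_mult_kernel[OF I _ _ Av p(1)]) auto
    then have "det ?A * y r p \<in> P" using p(1) by simp
    then show ?thesis unfolding J3_g_def using prime_ideal_mult_iff[OF P] p(2) by blast
  qed
  moreover have "J3_f V p \<in> P" if p: "p < 4" for p
  proof -
    let ?C = "{..<4} - {p}"
    let ?A = "submatrix (mat 3 4 (\<lambda>(r, q). J3_B V r q p :: ('v, 'k) mpoly)) {..<3} ?C"
    let ?r = "\<lambda>n. pick {..<3::nat} n" and ?c = "\<lambda>n. pick ?C n"
    let ?v = "vec 3 (\<lambda>n. y (?r n) p)"
    have dims: "card {i. i < 3 \<and> i \<in> {..<3::nat}} = 3" "card {j. j < 4 \<and> j \<in> ?C} = 3"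
    proof -
      have *: "{i. i < 3 \<and> i \<in> {..<3::nat}} = {..<3}" "{j. j < 4 \<and> j \<in> ?C} = ?C" by auto
      show "card {i. i < 3 \<and> i \<in> {..<3::nat}} = 3" unfolding * by simp
      show "card {j. j < 4 \<and> j \<in> ?C} = 3" unfolding * using p by simp
    qed
    have cards: "card {..<3::nat} = 3" "card ?C = 3" using p by simp_all
    have rC: "?r n \<in> {..<3}" "?c n \<in> ?C" if "n < 3" for n
      using that cards by (auto intro!: pick_in_set simp del: Diff_iff lessThan_iff)
    have A: "?A \<in> carrier_mat 3 3"
      by (rule carrier_matI) (simp_all only: dim_submatrix dim_row_mat dim_col_mat dims)
    have index: "?A $$ (m, n) = J3_B V (?r m) (?c n) p" if "m < 3" "n < 3" for m n
    proof -
      have "?A $$ (m, n) = mat 3 4 (\<lambda>(r, q). J3_B V r q p) $$ (?r m, ?c n)"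
        using that by (intro submatrix_index) (simp_all only: dim_row_mat dim_col_mat dims)
      also have "\<dots> = J3_B V (?r m) (?c n) p"
        using rC(1)[OF that(1)] rC(2)[OF that(2)] by (subst index_mat) auto
      finally show ?thesis .
    qed
    have rdist: "distinct [?r 0, ?r 1, ?r 2]" using cards by (simp add: pick_less_distinct)
    have rset: "{?r 0, ?r 1, ?r 2} = {..<3}"
    proof (rule card_subset_eq)
      show "{?r 0, ?r 1, ?r 2} \<subseteq> {..<3}" using rC(1)[of 0] rC(1)[of 1] rC(1)[of 2] by simp
      show "card {?r 0, ?r 1, ?r 2} = card {..<3::nat}" using rdist by simp
    qed simp
    have "{?r 1, ?r 0, ?r 2} = {?r 0, ?r 1, ?r 2}" "{?r 2, ?r 0, ?r 1} = {?r 0, ?r 1, ?r 2}" by blast+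
    then have rset1: "{?r 1, ?r 0, ?r 2} = {..<3}" and rset2: "{?r 2, ?r 0, ?r 1} = {..<3}"
      unfolding rset .
    have rdist1: "distinct [?r 1, ?r 0, ?r 2]" and rdist2: "distinct [?r 2, ?r 0, ?r 1]"
      using rdist by auto
    \<comment> \<open>The matrix of \<open>J3_f\<close> is transposed so that its row index is
      summed against column \<open>p\<close> of the names. The result is the expansion along column
      \<open>p\<close> of the permanent omitting another column.\<close>
    have Av: "(transpose_mat ?A *\<^sub>v ?v) $ n \<in> P" if n: "n < 3" for n
    proof -
      let ?q = "?c n"
      have q: "?q < 4" "?q \<noteq> p" using rC(2)[OF n] by auto
      obtain b c where c: "distinct [p, ?q, b, c]" "{p, ?q, b, c} = {..<4}"
        using lessThan_4_extend2[OF p q(1) q(2)[symmetric]] by blast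
      have "{?q, b, c, p} = {p, ?q, b, c}" "{p, b, c, ?q} = {p, ?q, b, c}" by blast+
      then have c': "distinct [?q, b, c, p]" "{?q, b, c, p} = {..<4}"
        and c'': "distinct [p, b, c, ?q]" "{p, b, c, ?q} = {..<4}" using c by simp_all
      have "(transpose_mat ?A *\<^sub>v ?v) $ n = (\<Sum>m\<in>{0..<3}. ?A $$ (m, n) * y (?r m) p)"
        using n A by (simp add: scalar_prod_def)
      also have "\<dots> = (\<Sum>m\<in>{0..<3}. J3_B V (?r m) ?q p * y (?r m) p)"
        by (rule sum.cong) (use n in \<open>simp_all add: index\<close>)
      also have "\<dots> = J3_B V (?r 0) ?q p * y (?r 0) p + J3_B V (?r 1) ?q p * y (?r 1) p +
          J3_B V (?r 2) ?q p * y (?r 2) p"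
        by (rule sum_three)
      also have "J3_B V (?r 0) ?q p = perm2 y (?r 1) (?r 2) b c"
        by (rule J3_B_eq[OF rdist rset c'])
      also have "J3_B V (?r 1) ?q p = perm2 y (?r 0) (?r 2) b c"
        by (rule J3_B_eq[OF rdist1 rset1 c'])
      also have "J3_B V (?r 2) ?q p = perm2 y (?r 0) (?r 1) b c"
        by (rule J3_B_eq[OF rdist2 rset2 c'])
      also have "perm2 y (?r 1) (?r 2) b c * y (?r 0) p + perm2 y (?r 0) (?r 2) b c * y (?r 1) p +
          perm2 y (?r 0) (?r 1) b c * y (?r 2) p = perm3 y (?r 0) (?r 1) (?r 2) p b c"
        by (rule perm3_expand_col[symmetric])
      also have "\<dots> = J3_P V ?q" by (rule J3_P_eq[OF rdist rset c'', symmetric])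
      also have "\<dots> \<in> P" by (rule PP[OF q(1)])
      finally show ?thesis .
    qed
    have *: "det ?A \<in> P \<or> y (?r n) p \<in> P" if n: "n < 3" for n
    proof -
      have "det (transpose_mat ?A) * ?v $ n \<in> P"
        by (rule ideal_det_mult_kernel[OF I _ _ Av n]) (use A in auto)
      then have "det ?A * y (?r n) p \<in> P" unfolding det_transpose[OF A] using n by simp
      then show ?thesis using prime_ideal_mult_iff[OF P] by blast
    qed
    obtain r where r: "r < 3" "y r p \<notin> P" using cols[OF p] by blast
    then have "r \<in> {?r 0, ?r 1, ?r 2}" unfolding rset by simp
    then consider "r = ?r 0" | "r = ?r 1" | "r = ?r 2" by blast
    then have "det ?A \<in> P" by cases (use *[of 0] *[of 1] *[of 2] r(2) in simp_all)
    then show ?thesis unfolding J3_f_def .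
  qed
  ultimately show ?thesis
    unfolding J3_def ideal_gen_subset_iff[OF I] using PP by auto
qed

end

section \<open>Residues modulo a prime\<close>

text \<open>Zero rows and columns are outcomes of their own, so no nonvanishing hypothesis is left.
  Every clause is a membership in \<open>P\<close>, which lets the predicate be pulled back along a
  quotient map.\<close>

definition classified :: "'a::comm_ring_1 set \<Rightarrow> (4 \<Rightarrow> 4 \<Rightarrow> 'a) \<Rightarrow> bool" where
  "classified P m \<longleftrightarrow> (\<exists>i. \<forall>a. m i a \<in> P) \<or> (\<exists>a. \<forall>i. m i a \<in> P) \<or> block3_in P m \<or> blocks22_in P m \<or>
     (\<forall>i j a b. m i a * m j b - m i b * m j a \<in> P) \<and> 3 \<in> P"

definition perms3_in :: "'a::comm_ring_1 set \<Rightarrow> (4 \<Rightarrow> 4 \<Rightarrow> 'a) \<Rightarrow> bool" where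
  "perms3_in P m \<longleftrightarrow>
     (\<forall>i j k a b c. distinct [i, j, k] \<longrightarrow> distinct [a, b, c] \<longrightarrow> perm3 m i j k a b c \<in> P)"

lemma classified_idom:
  fixes m :: "4 \<Rightarrow> 4 \<Rightarrow> 'a::idom"
  assumes "(2::'a) \<noteq> 0" "perms3_in {0} m"
  shows "classified {0} m"
proof (cases "(\<exists>i. \<forall>a. m i a = 0) \<or> (\<exists>a. \<forall>i. m i a = 0)")
  case True
  then show ?thesis by (auto simp: classified_def)
next
  case False
  interpret permanental m
    by unfold_locales (use assms False in \<open>auto simp: perms3_in_def\<close>)
  show ?thesis using classification by (auto simp: classified_def)
qed

text \<open>
  To work in the domain \<open>R/P\<close>, which depends on the prime \<open>P\<close> and hence is not a type, we pick a
  prime for which the classification fails, if there is one, and derive a contradiction in the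
  quotient by that prime.
\<close>

definition unclassified_prime :: "'a::comm_ring_1 set \<Rightarrow> bool" where
  "unclassified_prime P \<longleftrightarrow>
     prime_ideal P \<and> 2 \<notin> P \<and> (\<exists>m. perms3_in P m \<and> \<not> classified P m)"

text \<open>The default \<open>{0}\<close> is prime in a domain, so the quotient is a domain in
  either case.\<close>

definition chosen_prime :: "'a::idom set" where
  "chosen_prime = (if \<exists>P :: 'a set. unclassified_prime P then SOME P. unclassified_prime P else {0})"

lemma prime_chosen_prime: "prime_ideal (chosen_prime :: 'a::idom set)"
proof (cases "\<exists>P :: 'a set. unclassified_prime P")
  case True
  then have "unclassified_prime (chosen_prime :: 'a set)"
    using someI_ex[OF True] by (simp add: chosen_prime_def)
  then show ?thesis by (simp add: unclassified_prime_def)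
next
  case False
  then show ?thesis by (simp add: chosen_prime_def prime_ideal_iff is_ideal_def)
qed

lemmas ideal_chosen_prime = prime_ideal_ideal[OF prime_chosen_prime]

quotient_type (overloaded) 'a residue = "'a::idom" / "\<lambda>x y. x - y \<in> chosen_prime"
proof (rule equivpI)
  show "reflp (\<lambda>x y :: 'a. x - y \<in> chosen_prime)"
    by (simp add: reflp_def ideal_0[OF ideal_chosen_prime])
  show "symp (\<lambda>x y :: 'a. x - y \<in> chosen_prime)"
    using ideal_uminus[OF ideal_chosen_prime] by (fastforce simp: symp_def)
  show "transp (\<lambda>x y :: 'a. x - y \<in> chosen_prime)"
    using ideal_add[OF ideal_chosen_prime] by (fastforce simp: transp_def)
qed

instantiation residue :: (idom) comm_ring_1
begin

lift_definition zero_residue :: "'a residue" is 0 .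
lift_definition one_residue :: "'a residue" is 1 .

lift_definition plus_residue :: "'a residue \<Rightarrow> 'a residue \<Rightarrow> 'a residue" is "(+)"
proof -
  fix x x' y y' :: 'a
  assume "x - x' \<in> chosen_prime" "y - y' \<in> chosen_prime"
  from ideal_add[OF ideal_chosen_prime this]
  show "x + y - (x' + y') \<in> chosen_prime" by (simp add: algebra_simps)
qed

lift_definition uminus_residue :: "'a residue \<Rightarrow> 'a residue" is uminus
proof -
  fix x x' :: 'a
  assume "x - x' \<in> chosen_prime"
  from ideal_uminus[OF ideal_chosen_prime this]
  show "- x - - x' \<in> chosen_prime" by (simp add: algebra_simps)
qed

lift_definition minus_residue :: "'a residue \<Rightarrow> 'a residue \<Rightarrow> 'a residue" is "(-)"
proof -
  fix x x' y y' :: 'a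
  assume "x - x' \<in> chosen_prime" "y - y' \<in> chosen_prime"
  from ideal_diff[OF ideal_chosen_prime this]
  show "x - y - (x' - y') \<in> chosen_prime" by (simp add: algebra_simps)
qed

lift_definition times_residue :: "'a residue \<Rightarrow> 'a residue \<Rightarrow> 'a residue" is "(*)"
proof -
  fix x x' y y' :: 'a
  assume "x - x' \<in> chosen_prime" "y - y' \<in> chosen_prime"
  then have "(x - x') * y + x' * (y - y') \<in> chosen_prime"
    using ideal_add[OF ideal_chosen_prime] ideal_mult[OF ideal_chosen_prime]
      ideal_mult_right[OF ideal_chosen_prime] by blast
  then show "x * y - x' * y' \<in> chosen_prime" by (simp add: algebra_simps)
qed

instance
proof
  fix a b c :: "'a residue"
  show "a * b * c = a * (b * c)" "a * b = b * a" "1 * a = a" "a + b + c = a + (b + c)"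
    "a + b = b + a" "0 + a = a" "- a + a = 0" "a - b = a + - b" "(a + b) * c = a * c + b * c"
    by (transfer, simp add: algebra_simps ideal_0[OF ideal_chosen_prime])+
  show "(0 :: 'a residue) \<noteq> 1"
    by transfer
      (use prime_ideal_one[OF prime_chosen_prime] ideal_uminus[OF ideal_chosen_prime, of "- 1"] in auto)
qed

end

instance residue :: (idom) idom
proof
  fix a b :: "'a residue"
  show "a \<noteq> 0 \<Longrightarrow> b \<noteq> 0 \<Longrightarrow> a * b \<noteq> 0"
    by transfer (simp add: prime_ideal_mult_iff[OF prime_chosen_prime])
qed

lemma abs_residue_hom: "comm_ring_hom abs_residue"
  by unfold_locales
    (simp_all only: zero_residue.abs_eq one_residue.abs_eq plus_residue.abs_eq times_residue.abs_eq)

interpretation abs_residue: comm_ring_hom abs_residue by (rule abs_residue_hom)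

lemma abs_residue_eq_0_iff: "abs_residue x = 0 \<longleftrightarrow> x \<in> chosen_prime"
  unfolding zero_residue.abs_eq residue.abs_eq_iff by simp

theorem classification_mod_prime:
  fixes m :: "4 \<Rightarrow> 4 \<Rightarrow> 'a::idom"
  assumes "prime_ideal P" "2 \<notin> P" "perms3_in P m"
  shows "classified P m"
proof (rule ccontr)
  assume "\<not> classified P m"
  then have ex: "\<exists>P :: 'a set. unclassified_prime P" using assms unfolding unclassified_prime_def by blast
  then have "unclassified_prime (chosen_prime :: 'a set)"
    using someI_ex[OF ex] by (simp add: chosen_prime_def)
  \<comment> \<open>From here on the chosen prime and a matrix failing for it replace the given
    ones.\<close>
  then obtain m :: "4 \<Rightarrow> 4 \<Rightarrow> 'a" where two: "(2 :: 'a) \<notin> chosen_prime"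
    and m: "perms3_in chosen_prime m" "\<not> classified chosen_prime m"
    unfolding unclassified_prime_def by blast
  let ?m = "\<lambda>i a. abs_residue (m i a)"
  have "(2 :: 'a residue) = abs_residue 2" by (simp add: abs_residue.hom_numeral)
  then have "(2 :: 'a residue) \<noteq> 0" using two abs_residue_eq_0_iff by metis
  moreover have "perm3 ?m i j k a b c = abs_residue (perm3 m i j k a b c)" for i j k a b c
    by (simp add: perm3_def perm2_def abs_residue.hom_add abs_residue.hom_mult)
  then have "perms3_in {0} ?m" using m(1) by (simp add: perms3_in_def abs_residue_eq_0_iff)
  ultimately have "classified {0} ?m" by (rule classified_idom)
  moreover have "perm2 ?m i j a b = abs_residue (perm2 m i j a b)" for i j a b
    by (simp add: perm2_def abs_residue.hom_add abs_residue.hom_mult)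
  moreover have "(3 :: 'a residue) = abs_residue 3" by (simp add: abs_residue.hom_numeral)
  ultimately have "classified chosen_prime m"
    unfolding classified_def block3_in_def blocks22_in_def
    by (simp only: singleton_iff abs_residue.hom_mult[symmetric] abs_residue.hom_minus[symmetric]
        abs_residue_eq_0_iff)
  then show False using m(2) by blast
qed

section \<open>Minimal primes\<close>

lemma of_nat_pick_nats_bij:
  assumes "card A = n"
  shows "bij_betw (\<lambda>r. of_nat (pick (nats A) r) :: 4) {..<n} A"
proof -
  let ?f = "\<lambda>r. of_nat (pick (nats A) r) :: 4"
  have inj: "inj_on ?f {..<n}"
    using of_nat_pick_nats_inj[of _ A] assms by (intro inj_onI) (metis lessThan_iff)
  have sub: "?f ` {..<n} \<subseteq> A" using of_nat_pick_nats[of _ A] assms by auto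
  have "card (?f ` {..<n}) = card A" using card_image[OF inj] assms by simp
  then have "?f ` {..<n} = A" using sub card_subset_eq[OF finite[of A] sub] by blast
  then show ?thesis using inj by (simp add: bij_betw_def)
qed

text \<open>The map \<open>f\<close> from positions to names is \<open>Pair\<close> when row
  \<open>i\<close> vanishes and its flip when a column does, so both cases are treated at once. The
  enumeration \<open>\<rho>\<close> runs through the lines other than \<open>i\<close>.\<close>

lemma J3_subset_of_perms:
  fixes f :: "4 \<Rightarrow> 4 \<Rightarrow> 4 \<times> 4" and P :: "(4 \<times> 4, 'k::idom) mpoly set"
  assumes P: "prime_ideal P" and f: "\<And>x a x' a'. f x a = f x' a' \<Longrightarrow> x = x' \<and> a = a'"
    and perms: "\<And>i j k a b c. distinct [i, j, k] \<Longrightarrow> distinct [a, b, c] \<Longrightarrow>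
      perm3 (\<lambda>x a. Var (f x a)) i j k a b c \<in> P"
    and rows: "\<And>x. x \<noteq> i \<Longrightarrow> \<exists>a. Var (f x a) \<notin> P" and cols: "\<And>a. \<exists>x. x \<noteq> i \<and> Var (f x a) \<notin> P"
    and V: "V \<in> carrier_mat 3 4" "\<And>r p. r < 3 \<Longrightarrow> p < 4 \<Longrightarrow> V $$ (r, p) = f (\<rho> r) (\<kappa> p)"
    and \<rho>: "bij_betw \<rho> {..<3} (- {i})" and \<kappa>: "bij_betw \<kappa> {..<4} UNIV"
  shows "J3 V \<subseteq> P"
proof (rule J3_subset_prime[OF V(1) _ P])
  have \<rho>_eq: "\<rho> r = \<rho> r' \<longleftrightarrow> r = r'" if "r < 3" "r' < 3" for r r'
    using \<rho> that by (auto simp: bij_betw_def inj_on_def)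
  have \<kappa>_eq: "\<kappa> p = \<kappa> p' \<longleftrightarrow> p = p'" if "p < 4" "p' < 4" for p p'
    using \<kappa> that by (auto simp: bij_betw_def inj_on_def)
  show inj: "r = r' \<and> p = p'"
    if "r < 3" "p < 4" "r' < 3" "p' < 4" "V $$ (r, p) = V $$ (r', p')" for r p r' p'
    using f[of "\<rho> r" "\<kappa> p" "\<rho> r'" "\<kappa> p'"] that by (simp add: V(2) \<rho>_eq \<kappa>_eq)
  show "J3_P V q \<in> P" if q: "q < 4" for q
  proof -
    have "card ({..<4} - {q}) = 3" using q by simp
    then obtain a b c where C: "{..<4} - {q} = {a, b, c}" "distinct [a, b, c]" unfolding card_3_iff by auto
    then have c: "distinct [a, b, c, q]" "{a, b, c, q} = {..<4}" using q by auto
    then have lt: "a < 4" "b < 4" "c < 4" by auto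
    have "J3_P V q = (perm3 (\<lambda>r p. Var (V $$ (r, p))) 0 1 2 a b c :: (4 \<times> 4, 'k) mpoly)"
      by (rule J3_P_eq[OF V(1) inj _ _ c]) auto
    also have "\<dots> = perm3 (\<lambda>x a. Var (f x a)) (\<rho> 0) (\<rho> 1) (\<rho> 2) (\<kappa> a) (\<kappa> b) (\<kappa> c)"
      using lt by (simp add: perm3_def perm2_def V(2))
    also have "\<dots> \<in> P"
      by (rule perms) (use lt c in \<open>simp_all add: \<rho>_eq \<kappa>_eq\<close>)
    finally show ?thesis .
  qed
  show "\<exists>p<4. Var (V $$ (r, p)) \<notin> P" if r: "r < 3" for r
  proof -
    have "\<rho> r \<noteq> i" using \<rho> r by (auto simp: bij_betw_def)
    then obtain a where "Var (f (\<rho> r) a) \<notin> P" using rows by blast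
    moreover obtain p where "p < 4" "a = \<kappa> p" using \<kappa> by (auto simp: bij_betw_def)
    ultimately show ?thesis using V(2)[OF r] by auto
  qed
  show "\<exists>r<3. Var (V $$ (r, p)) \<notin> P" if p: "p < 4" for p
  proof -
    obtain x where "x \<noteq> i" "Var (f x (\<kappa> p)) \<notin> P" using cols by blast
    moreover have "x \<in> \<rho> ` {..<3}" using \<rho> \<open>x \<noteq> i\<close> by (auto simp: bij_betw_def)
    ultimately show ?thesis using V(2)[OF _ p] by auto
  qed
qed

lemma card_Compl_singleton: "card (- {i :: 4}) = 3"
  by (simp add: Compl_eq_Diff_UNIV)

lemma Diff_nats_Compl: "nats UNIV - nats (- A) = nats A"
  by (auto simp: nats_def)

lemma submatrix_generic_names:
  "submatrix generic_names (nats A) (nats B) \<in> carrier_mat (card A) (card B)"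
  "r < card A \<Longrightarrow> p < card B \<Longrightarrow> submatrix generic_names (nats A) (nats B) $$ (r, p) =
    (of_nat (pick (nats A) r), of_nat (pick (nats B) p))"
proof -
  have e: "{i. i < 4 \<and> i \<in> nats C} = nats C" for C by (auto simp: nats_def)
  have d: "dim_row generic_names = 4" "dim_col generic_names = 4" by (simp_all add: generic_names_def)
  show "submatrix generic_names (nats A) (nats B) \<in> carrier_mat (card A) (card B)"
    by (rule carrier_matI) (simp_all only: dim_submatrix d e card_nats)
  assume lt: "r < card A" "p < card B"
  then have "submatrix generic_names (nats A) (nats B) $$ (r, p) =
      generic_names $$ (pick (nats A) r, pick (nats B) p)"
    by (intro submatrix_index) (simp_all only: d e card_nats)
  also have "\<dots> = (of_nat (pick (nats A) r), of_nat (pick (nats B) p))"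
    using pick_nats[OF lt(1)] pick_nats[OF lt(2)] unfolding generic_names_def
    by (subst index_mat) (auto simp: nats_def)
  finally show "submatrix generic_names (nats A) (nats B) $$ (r, p) =
    (of_nat (pick (nats A) r), of_nat (pick (nats B) p))" .
qed

text \<open>Membership of \<open>J3\<close> needs an entry outside \<open>P\<close> in each row and
  column of the remaining 3 x 4 matrix. If that fails, a second zero row gives type (1), as 2 + 4 =
  6, and a zero column extends over row \<open>i\<close> and gives type (3).\<close>

lemma zero_row_listed:
  fixes P :: "(4 \<times> 4, 'k::idom) mpoly set"
  assumes min: "P \<in> minimal_primes (permanental_ideal 3)" and row: "\<And>a. entry i a \<in> P"
  shows "has_listed_type P"
proof (cases "(\<exists>j. j \<noteq> i \<and> (\<forall>a. entry j a \<in> P)) \<or> (\<exists>a. \<forall>x. x \<noteq> i \<longrightarrow> entry x a \<in> P)")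
  case True
  then show ?thesis
  proof
    assume "\<exists>j. j \<noteq> i \<and> (\<forall>a. entry j a \<in> P)"
    then obtain j where j: "j \<noteq> i" "\<And>a. entry j a \<in> P" by blast
    have "is_type_1 P"
      by (rule is_type_1I[OF min, of "{i, j}" UNIV]) (use j row in auto)
    then show ?thesis by (simp add: has_listed_type_def)
  next
    assume "\<exists>a. \<forall>x. x \<noteq> i \<longrightarrow> entry x a \<in> P"
    then obtain a where "entry x a \<in> P" for x using row by metis
    then have "is_type_3 P" using row by (intro is_type_3I[OF min])
    then show ?thesis by (simp add: has_listed_type_def)
  qed
next
  case False
  note c = card_Compl_singleton[of i]
  have "J3 (submatrix generic_names (nats (- {i})) (nats UNIV)) \<subseteq> P"
  proof (rule J3_subset_of_perms[where f = Pair and i = i])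
    show "prime_ideal P" by (rule min_prime[OF min])
    show "perm3 (\<lambda>x a. entry x a) i j k a b c \<in> P"
      if "distinct [i, j, k]" "distinct [a, b, c]" for i j k a b c
      by (rule min_perm3[OF min that])
    show "submatrix generic_names (nats (- {i})) (nats UNIV) \<in> carrier_mat 3 4"
      using submatrix_generic_names(1)[of "- {i}" UNIV] c by simp
    show "submatrix generic_names (nats (- {i})) (nats UNIV) $$ (r, p) =
        (of_nat (pick (nats (- {i})) r), of_nat (pick (nats UNIV) p))" if "r < 3" "p < 4" for r p
      using submatrix_generic_names(2)[of r "- {i}" p UNIV] c that by simp
    show "bij_betw (\<lambda>r. of_nat (pick (nats (- {i})) r)) {..<3} (- {i})"
      by (rule of_nat_pick_nats_bij[OF c])
    show "bij_betw (\<lambda>p. of_nat (pick (nats UNIV) p) :: 4) {..<4} UNIV"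
      by (rule of_nat_pick_nats_bij) simp
  qed (use False in blast)+
  moreover have "($$) generic_mat ` (({..<4} - nats (- {i})) \<times> {..<4}) \<subseteq> P"
    unfolding nats_UNIV[symmetric] Diff_nats_Compl generic_mat_image_nats using row by blast
  ultimately have "is_type_3A P"
    unfolding is_type_3A_def using min_prime[OF min] nats_subset[of "- {i}"] c
    by (intro conjI disjI1 exI[of _ "nats (- {i})"]) (simp_all add: card_nats nats_UNIV)
  then show ?thesis by (simp add: has_listed_type_def)
qed

lemma zero_col_listed:
  fixes P :: "(4 \<times> 4, 'k::idom) mpoly set"
  assumes min: "P \<in> minimal_primes (permanental_ideal 3)" and col: "\<And>x. entry x s \<in> P"
  shows "has_listed_type P"
proof (cases "(\<exists>a. a \<noteq> s \<and> (\<forall>x. entry x a \<in> P)) \<or> (\<exists>x. \<forall>a. a \<noteq> s \<longrightarrow> entry x a \<in> P)")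
  case True
  then show ?thesis
  proof
    assume "\<exists>a. a \<noteq> s \<and> (\<forall>x. entry x a \<in> P)"
    then obtain a where a: "a \<noteq> s" "\<And>x. entry x a \<in> P" by blast
    have "is_type_1 P"
      by (rule is_type_1I[OF min, of UNIV "{s, a}"]) (use a col in auto)
    then show ?thesis by (simp add: has_listed_type_def)
  next
    assume "\<exists>x. \<forall>a. a \<noteq> s \<longrightarrow> entry x a \<in> P"
    then obtain x where "entry x a \<in> P" for a using col by metis
    then have "is_type_3 P" using col by (intro is_type_3I[OF min])
    then show ?thesis by (simp add: has_listed_type_def)
  qed
next
  case False
  note c = card_Compl_singleton[of s]
  have "J3 (transpose_mat (submatrix generic_names (nats UNIV) (nats (- {s})))) \<subseteq> P"
  proof (rule J3_subset_of_perms[where f = "\<lambda>a x. (x, a)" and i = s])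
    show "prime_ideal P" by (rule min_prime[OF min])
    show "perm3 (\<lambda>a x. entry x a) i j k a b c \<in> P"
      if "distinct [i, j, k]" "distinct [a, b, c]" for i j k a b c
      using min_perm3[OF min that(2,1)] by (simp only: perm3_transpose[of entry])
    show "transpose_mat (submatrix generic_names (nats UNIV) (nats (- {s}))) \<in> carrier_mat 3 4"
      using submatrix_generic_names(1)[of UNIV "- {s}"] c by simp
    show "transpose_mat (submatrix generic_names (nats UNIV) (nats (- {s}))) $$ (r, p) =
        (of_nat (pick (nats UNIV) p), of_nat (pick (nats (- {s})) r))" if "r < 3" "p < 4" for r p
      using submatrix_generic_names(1)[of UNIV "- {s}"] submatrix_generic_names(2)[of p UNIV r "- {s}"] c that
      by (subst index_transpose_mat) auto
    show "bij_betw (\<lambda>r. of_nat (pick (nats (- {s})) r)) {..<3} (- {s})"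
      by (rule of_nat_pick_nats_bij[OF c])
    show "bij_betw (\<lambda>p. of_nat (pick (nats UNIV) p) :: 4) {..<4} UNIV"
      by (rule of_nat_pick_nats_bij) simp
  qed (use False in blast)+
  moreover have "($$) generic_mat ` ({..<4} \<times> ({..<4} - nats (- {s}))) \<subseteq> P"
    unfolding nats_UNIV[symmetric] Diff_nats_Compl generic_mat_image_nats using col by blast
  ultimately have "is_type_3A P"
    unfolding is_type_3A_def using min_prime[OF min] nats_subset[of "- {s}"] c
    by (intro conjI disjI2 exI[of _ "nats (- {s})"]) (simp_all add: card_nats nats_UNIV)
  then show ?thesis by (simp add: has_listed_type_def)
qed

lemma minimal_prime_listed:
  fixes P :: "(4 \<times> 4, 'k::idom) mpoly set"
  assumes min: "P \<in> minimal_primes (permanental_ideal 3)" and two: "2 \<notin> P"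
  shows "has_listed_type P \<or> minors2 \<subseteq> P \<and> 3 \<in> P"
proof -
  have "perms3_in P entry" unfolding perms3_in_def using min_perm3[OF min] by blast
  then have "classified P entry" by (rule classification_mod_prime[OF min_prime[OF min] two])
  then consider (row) i where "\<And>a. entry i a \<in> P" | (col) a where "\<And>i. entry i a \<in> P"
    | (block) "block3_in P entry" | (blocks) "blocks22_in P entry"
    | (minors) "\<And>i j a b. entry i a * entry j b - entry i b * entry j a \<in> P" "3 \<in> P"
    unfolding classified_def by blast
  then show ?thesis
  proof cases
    case row
    then show ?thesis using zero_row_listed[OF min] by blast
  next
    case col
    then show ?thesis using zero_col_listed[OF min] by blast
  next
    case block
    then obtain i j k a b c where *: "distinct [i, j, k]" "distinct [a, b, c]"
      "\<forall>x\<in>{i, j, k}. \<forall>y\<in>{a, b, c}. entry x y \<in> P" unfolding block3_in_def by blast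
    have "is_type_1 P"
      by (rule is_type_1I[OF min, of "{i, j, k}" "{a, b, c}"]) (use * in \<open>simp, blast\<close>)
    then show ?thesis by (simp add: has_listed_type_def)
  next
    case blocks
    then show ?thesis using is_type_22I[OF min] by (simp add: has_listed_type_def)
  next
    case minors
    then show ?thesis unfolding minors2_def by blast
  qed
qed

section \<open>The determinantal ideal in characteristic 3\<close>

lemma Var_in_of_generic_mat_image:
  assumes "($$) generic_mat ` S \<subseteq> P" "S \<subseteq> {..<4} \<times> {..<4}" "S \<noteq> {}"
  shows "\<exists>v. Var v \<in> P"
proof -
  obtain m n where mn: "(m, n) \<in> S" using assms(3) by auto
  then have "generic_mat $$ (m, n) \<in> P" "m < 4" "n < 4" using assms(1,2) by auto
  then show ?thesis using generic_mat_index by metis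
qed

lemma Diff_nonempty_if_card_less:
  assumes "finite B" "card B < card A"
  shows "A - B \<noteq> {}"
  using assms card_mono[of B A] by auto

text \<open>This keeps the determinantal ideal, which contains no indeterminate, off the list. For
  types (2), (3) and (2,2) an entry is found by counting positions: 12 against 4, 16 against 9, 16
  against at most 8.\<close>

lemma listed_Var_in:
  assumes "has_listed_type (P :: (4 \<times> 4, 'k::comm_ring_1) mpoly set)"
  shows "\<exists>v. Var v \<in> P"
proof -
  have card4: "card I \<le> 4" if "I \<subseteq> {..<4::nat}" for I
    using card_mono[OF _ that] by simp
  have fin: "finite I" if "I \<subseteq> {..<4::nat}" for I using that finite_subset by blast
  consider "is_type_1 P" | "is_type_2 P" | "is_type_3 P" | "is_type_3A P" | "is_type_22 P"
    using assms unfolding has_listed_type_def by blast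
  then show ?thesis
  proof cases
    case 1
    then obtain I J where IJ: "I \<subseteq> {..<4}" "J \<subseteq> {..<4}" "card I + card J = 6"
      and P: "P = ideal_gen (($$) generic_mat ` (I \<times> J))" unfolding is_type_1_def by blast
    have "I \<times> J \<noteq> {}" using IJ(3) card4[OF IJ(1)] card4[OF IJ(2)] by auto
    moreover have "($$) generic_mat ` (I \<times> J) \<subseteq> P" unfolding P by (rule ideal_gen_superset)
    moreover have "I \<times> J \<subseteq> {..<4} \<times> {..<4}" using IJ(1,2) by blast
    ultimately show ?thesis using Var_in_of_generic_mat_image by metis
  next
    case 2
    then obtain I J I' J' where IJ: "I \<subseteq> {..<4}" "J \<subseteq> {..<4}" "card I + card J = 7"
      "card I' = 2" "card J' = 2"
      and P: "P = ideal_gen ({permanent (submatrix generic_mat I' J')} \<union>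
         ($$) generic_mat ` (I \<times> J - I' \<times> J'))" unfolding is_type_2_def by blast
    have "card I = 3 \<and> card J = 4 \<or> card I = 4 \<and> card J = 3"
      using IJ(3) card4[OF IJ(1)] card4[OF IJ(2)] by linarith
    then have "card (I \<times> J) = 12" by (auto simp: card_cartesian_product)
    moreover have "finite I'" "finite J'" using IJ(4,5) by (simp_all add: card_ge_0_finite)
    ultimately have "I \<times> J - I' \<times> J' \<noteq> {}"
      using IJ(4,5) by (intro Diff_nonempty_if_card_less) (simp_all add: card_cartesian_product)
    moreover have "($$) generic_mat ` (I \<times> J - I' \<times> J') \<subseteq> P"
      unfolding P by (rule order_trans[OF Un_upper2 ideal_gen_superset])
    moreover have "I \<times> J - I' \<times> J' \<subseteq> {..<4} \<times> {..<4}" using IJ(1,2) by blast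
    ultimately show ?thesis using Var_in_of_generic_mat_image by metis
  next
    case 3
    then obtain I J where IJ: "card I = 3" "card J = 3"
      and P: "P = ideal_gen ({permanent (submatrix generic_mat I J)} \<union>
         ($$) generic_mat ` ({..<4} \<times> {..<4} - I \<times> J))" unfolding is_type_3_def by blast
    have "finite I" "finite J" using IJ by (simp_all add: card_ge_0_finite)
    then have "{..<4} \<times> {..<4} - I \<times> J \<noteq> {}"
      using IJ by (intro Diff_nonempty_if_card_less) (simp_all add: card_cartesian_product)
    moreover have "($$) generic_mat ` ({..<4} \<times> {..<4} - I \<times> J) \<subseteq> P"
      unfolding P by (rule order_trans[OF Un_upper2 ideal_gen_superset])
    ultimately show ?thesis using Var_in_of_generic_mat_image[OF _ Diff_subset] by metis
  next
    case 4
    have four: "{..<4::nat} \<noteq> {}" by (simp add: lessThan_empty_iff)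
    have ne: "{..<4} - I \<noteq> {}" if "I \<subseteq> {..<4::nat}" "card I = 3" for I
      using that fin[OF that(1)] by (intro Diff_nonempty_if_card_less) simp_all
    from 4 consider I where "I \<subseteq> {..<4}" "card I = 3" "($$) generic_mat ` (({..<4} - I) \<times> {..<4}) \<subseteq> P"
      | J where "J \<subseteq> {..<4}" "card J = 3" "($$) generic_mat ` ({..<4} \<times> ({..<4} - J)) \<subseteq> P"
      unfolding is_type_3A_def Un_subset_iff by blast
    then show ?thesis
    proof cases
      case (1 I)
      have "({..<4} - I) \<times> {..<4::nat} \<noteq> {}" using ne[OF 1(1,2)] four by (simp only: Times_empty) blast
      then show ?thesis by (rule Var_in_of_generic_mat_image[OF 1(3), rotated]) blast
    next
      case (2 J)
      have "{..<4::nat} \<times> ({..<4} - J) \<noteq> {}" using ne[OF 2(1,2)] four by (simp only: Times_empty) blast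
      then show ?thesis by (rule Var_in_of_generic_mat_image[OF 2(3), rotated]) blast
    qed
  next
    case 5
    then obtain I J I' J' where IJ: "card I = 2" "card J = 2" "card I' = 2" "card J' = 2"
      and P: "P = ideal_gen ({permanent (submatrix generic_mat I J), permanent (submatrix generic_mat I' J')} \<union>
         ($$) generic_mat ` ({..<4} \<times> {..<4} - (I \<times> J \<union> I' \<times> J')))" unfolding is_type_22_def by blast
    have f: "finite I" "finite J" "finite I'" "finite J'" using IJ by (simp_all add: card_ge_0_finite)
    have "card (I \<times> J \<union> I' \<times> J') \<le> 4 + 4"
      using card_Un_le[of "I \<times> J" "I' \<times> J'"] IJ by (simp add: card_cartesian_product)
    then have "{..<4} \<times> {..<4} - (I \<times> J \<union> I' \<times> J') \<noteq> {}"
      using f by (intro Diff_nonempty_if_card_less) (simp_all add: card_cartesian_product)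
    moreover have "($$) generic_mat ` ({..<4} \<times> {..<4} - (I \<times> J \<union> I' \<times> J')) \<subseteq> P"
      unfolding P by (rule order_trans[OF Un_upper2 ideal_gen_superset])
    ultimately show ?thesis using Var_in_of_generic_mat_image[OF _ Diff_subset] by metis
  qed
qed

lemma numeral_notin_prime:
  assumes P: "prime_ideal (P :: ('v, 'k::field) mpoly set)" and n: "(numeral n :: 'k) \<noteq> 0"
  shows "numeral n \<notin> P"
proof
  assume "numeral n \<in> P"
  then have "numeral n * Const (inverse (numeral n)) \<in> P"
    by (rule ideal_mult_right[OF prime_ideal_ideal[OF P]])
  moreover have "(numeral n :: ('v, 'k) mpoly) * Const (inverse (numeral n)) = 1"
    using n by (simp add: mult_single flip: single_numeral)
  ultimately show False using prime_ideal_one[OF P] by simp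
qed

lemma numeral_eq_0_iff_CHAR:
  "(numeral n :: 'k::field) = 0 \<longleftrightarrow> CHAR('k) dvd numeral n"
  using of_nat_eq_0_iff_char_dvd[of "numeral n", where 'a = 'k] by simp

text \<open>The Segre map sends all six terms of a 3 x 3 permanent to the same monomial, and 6 is 0
  in characteristic 3.\<close>

lemma permanental_ideal_3_subset_minors2:
  assumes "(3 :: 'k::idom) = 0"
  shows "permanental_ideal 3 \<subseteq> (ideal_gen minors2 :: (4 \<times> 4, 'k) mpoly set)"
proof -
  have "(3 :: (4 \<times> 4, 'k) mpoly) = Const 3" by simp
  then have three: "(3 :: (4 \<times> 4, 'k) mpoly) = 0" using assms by simp
  have "segre (perm3 entry i j k a b c) = (0 :: (4 \<times> 4, 'k) mpoly)" for i j k a b c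
  proof -
    have "segre (perm3 entry i j k a b c) = (3 :: (4 \<times> 4, 'k) mpoly) *
        (2 * (entry i 0 * entry j 0 * entry k 0 * (entry a 1 * entry b 1 * entry c 1)))"
      by (simp add: perm3_def perm2_def segre.hom_add segre.hom_mult segre_Var algebra_simps)
    then show ?thesis unfolding three by simp
  qed
  then have "perm3 entry i j k a b c \<in> (ideal_gen minors2 :: (4 \<times> 4, 'k) mpoly set)" for i j k a b c
    unfolding ideal_gen_minors2_eq_kernel by blast
  then show ?thesis using permanental_ideal_3_subset_iff[OF is_ideal_ideal_gen] by blast
qed

text \<open>A prime inside the determinantal ideal contains no indeterminate, which rules out every
  outcome of the classification except the one that puts all minors into it.\<close>

lemma minors2_minimal_prime:
  assumes three: "(3 :: 'k::field) = 0"
  shows "ideal_gen minors2 \<in> minimal_primes (permanental_ideal 3 :: (4 \<times> 4, 'k) mpoly set)"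
proof -
  let ?D = "ideal_gen minors2 :: (4 \<times> 4, 'k) mpoly set"
  have "(2 :: 'k) \<noteq> 0"
  proof
    assume "(2 :: 'k) = 0"
    then have "(3 :: 'k) - 2 = 0" using three by simp
    then show False by simp
  qed
  have "Q = ?D" if Q: "prime_ideal Q" "permanental_ideal 3 \<subseteq> Q" "Q \<subseteq> ?D" for Q
  proof -
    have I: "is_ideal Q" using Q(1) by (rule prime_ideal_ideal)
    have "2 \<notin> Q" using \<open>(2 :: 'k) \<noteq> 0\<close> by (rule numeral_notin_prime[OF Q(1)])
    moreover have "perms3_in Q entry"
      using Q(2) permanental_ideal_3_subset_iff[OF I] unfolding perms3_in_def by blast
    ultimately have "classified Q entry" by (rule classification_mod_prime[OF Q(1)])
    moreover have "Var v \<notin> Q" for v using Q(3) Var_notin_minors2 by blast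
    ultimately have "minors2 \<subseteq> Q"
      unfolding classified_def block3_in_def blocks22_in_def minors2_def by blast
    then have "?D \<subseteq> Q" using ideal_gen_subset_iff[OF I] by blast
    then show ?thesis using Q(3) by blast
  qed
  then show ?thesis
    using prime_ideal_minors2 permanental_ideal_3_subset_minors2[OF three]
    by (auto simp: minimal_primes_def)
qed

theorem theorem14:
  shows "(CHAR('k::field) > 3 \<longrightarrow>
           (\<forall>P \<in> minimal_primes (permanental_ideal 3 :: (4 \<times> 4, 'k) mpoly set). has_listed_type P)) \<and>
         (CHAR('k) = 3 \<longrightarrow>
           {P \<in> minimal_primes (permanental_ideal 3 :: (4 \<times> 4, 'k) mpoly set). \<not> has_listed_type P} =
             {determinantal_ideal 2})"
proof (intro conjI impI ballI)
  fix P :: "(4 \<times> 4, 'k) mpoly set"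
  assume char: "CHAR('k) > 3" and P: "P \<in> minimal_primes (permanental_ideal 3)"
  have "(2 :: 'k) \<noteq> 0" "(3 :: 'k) \<noteq> 0"
    using char unfolding numeral_eq_0_iff_CHAR by (auto dest!: dvd_imp_le)
  then have "2 \<notin> P" "3 \<notin> P" using numeral_notin_prime[OF min_prime[OF P]] by blast+
  then show "has_listed_type P" using minimal_prime_listed[OF P] by blast
next
  assume char: "CHAR('k) = 3"
  let ?D = "determinantal_ideal 2 :: (4 \<times> 4, 'k) mpoly set"
  have two: "(2 :: 'k) \<noteq> 0" and three: "(3 :: 'k) = 0"
    unfolding numeral_eq_0_iff_CHAR char by auto
  have D: "?D = ideal_gen minors2" by (rule determinantal_ideal_2_eq)
  show "{P \<in> minimal_primes (permanental_ideal 3 :: (4 \<times> 4, 'k) mpoly set). \<not> has_listed_type P} = {?D}"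
  proof
    show "{P \<in> minimal_primes (permanental_ideal 3 :: (4 \<times> 4, 'k) mpoly set). \<not> has_listed_type P} \<subseteq> {?D}"
    proof
      fix P assume "P \<in> {P \<in> minimal_primes (permanental_ideal 3 :: (4 \<times> 4, 'k) mpoly set). \<not> has_listed_type P}"
      then have P: "P \<in> minimal_primes (permanental_ideal 3)" "\<not> has_listed_type P" by blast+
      have "2 \<notin> P" using two by (rule numeral_notin_prime[OF min_prime[OF P(1)]])
      then have "minors2 \<subseteq> P" using minimal_prime_listed[OF P(1)] P(2) by blast
      then have "?D \<subseteq> P" unfolding D using ideal_gen_subset_iff[OF min_ideal[OF P(1)]] by blast
      then have "P = ?D"
        using minimal_primes_eq[OF P(1)] prime_ideal_minors2 permanental_ideal_3_subset_minors2[OF three]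
        unfolding D by blast
      then show "P \<in> {?D}" by blast
    qed
    have "\<not> has_listed_type ?D" using listed_Var_in Var_notin_minors2 unfolding D by blast
    then show "{?D} \<subseteq> {P \<in> minimal_primes (permanental_ideal 3). \<not> has_listed_type P}"
      using minors2_minimal_prime[OF three] unfolding D by blast
  qed
qed

end
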